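(* Let $\mathscr A$ be a unital $C^*$-algebra, let $\mathscr X$ be a (right) Hilbert $\mathscr A$-module, and let $\mathcal L(\mathscr X)$ be the $C^*$-algebra of adjointable maps on $\mathscr X$. Let $J\subseteq\mathbb R$ be an interval containing $0$ and let $f:J\to\mathbb R$ be an operator convex function with $f(0)\le 0$. Let $S,R_i,T_i\in\mathcal L(\mathscr X)$ $(1\le i\le n)$ be such that $S$ and all the $T_i$ are self-adjoint and the spectra of $S-\sum_{i=1}^nR_i^*T_iR_i$ and of each $T_i$ $(1\le i\le n)$ are contained in $J$. Then for every $x\in\mathscr X$ with $\|x\|\le1$, $$\left\langle x,\left[f\Big(S-\sum_{i=1}^nR_i^*T_iR_i\Big)+\sum_{i=1}^nR_i^*f(T_i)R_i\right]x\right\rangle\ \ge\ k_n^{-1}f\big(k_n\langle x,Sx\rangle\big),$$ where $k_n=\left(1+\sum_{i=1}^n\|R_ix\|^2\right)^{-1}$.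
   Context: A continuous function $f:J\to\mathbb R$ on an interval $J$ is operator convex if $f((1-\lambda)A+\lambda B)\le(1-\lambda)f(A)+\lambda f(B)$ for all $\lambda\in[0,1]$ and all self-adjoint bounded operators $A,B$ on a Hilbert space with spectra contained in $J$. Hilbert $C^*$-modules over $\mathscr A$ are right modules whose $\mathscr A$-valued inner product is linear in the second variable, with norm $\|x\|=\|\langle x,x\rangle\|^{1/2}$. The order $\ge$ is the usual order on self-adjoint elements of $\mathscr A$, and $f$ is applied to self-adjoint elements by continuous functional calculus. *)

theory Defs
  imports "HOL-Analysis.Analysis" "HOL-Computational_Algebra.Polynomial"
    "HOL-Library.Function_Algebras"
begin

section \<open>Unital \<open>C\<^sup>*\<close>-algebras\<close>

text \<open>The class \<^class>\<open>real_normed_algebra_1\<close> provides the unit (with norm 1, so the algebra is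
  nonzero) and the submultiplicative norm, \<^class>\<open>banach\<close> provides completeness.\<close>

class cstar_algebra = real_normed_algebra_1 + banach +
  fixes scaleC :: "complex \<Rightarrow> 'a \<Rightarrow> 'a" (infixr "*\<^sub>C" 75)
    and star :: "'a \<Rightarrow> 'a"
  assumes scaleC_of_real: "complex_of_real r *\<^sub>C a = r *\<^sub>R a"
    and scaleC_add_right: "c *\<^sub>C (a + b) = c *\<^sub>C a + c *\<^sub>C b"
    and scaleC_add_left: "(c + d) *\<^sub>C a = c *\<^sub>C a + d *\<^sub>C a"
    and scaleC_scaleC: "c *\<^sub>C d *\<^sub>C a = (c * d) *\<^sub>C a"
    and mult_scaleC_left: "(c *\<^sub>C a) * b = c *\<^sub>C (a * b)"
    and mult_scaleC_right: "a * (c *\<^sub>C b) = c *\<^sub>C (a * b)"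
    and norm_scaleC: "norm (c *\<^sub>C a) = cmod c * norm a"
    and star_add: "star (a + b) = star a + star b"
    and star_scaleC: "star (c *\<^sub>C a) = cnj c *\<^sub>C star a"
    and star_mult: "star (a * b) = star b * star a"
    and star_star: "star (star a) = a"
    and cstar_identity: "norm (star a * a) = (norm a)\<^sup>2"

instantiation complex :: cstar_algebra
begin
definition scaleC_complex :: "complex \<Rightarrow> complex \<Rightarrow> complex" where "scaleC_complex = (*)"
definition star_complex :: "complex \<Rightarrow> complex" where "star_complex = cnj"
instance
  by standard
    (auto simp: scaleC_complex_def star_complex_def algebra_simps scaleR_conv_of_real norm_mult
      power2_eq_square)
end

definition spectrum :: "'a::cstar_algebra \<Rightarrow> complex set" where
  "spectrum a = {c. \<not> (\<exists>b. b * (a - c *\<^sub>C 1) = 1 \<and> (a - c *\<^sub>C 1) * b = 1)}"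

definition cstar_pos :: "'a::cstar_algebra \<Rightarrow> bool" where
  "cstar_pos a \<longleftrightarrow> star a = a \<and> spectrum a \<subseteq> complex_of_real ` {0..}"

definition cstar_le :: "'a::cstar_algebra \<Rightarrow> 'a \<Rightarrow> bool" (infix "\<preceq>" 50) where
  "a \<preceq> b \<longleftrightarrow> cstar_pos (b - a)"

definition poly_of :: "real poly \<Rightarrow> 'a::cstar_algebra \<Rightarrow> 'a" where
  "poly_of p a = (\<Sum>i\<le>degree p. coeff p i *\<^sub>R a ^ i)"

text \<open>Continuous functional calculus, meant for self-adjoint \<open>a\<close> (whose spectrum is a compact
  set of reals) and for real functions continuous on the spectrum: \<open>f(a)\<close> is the norm limit of
  \<open>p\<^sub>m(a)\<close> for every sequence of real polynomials converging to \<open>f\<close> uniformly on the spectrum.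
  (Such sequences exist by Weierstrass.)\<close>

definition cfc :: "(real \<Rightarrow> real) \<Rightarrow> 'a::cstar_algebra \<Rightarrow> 'a" where
  "cfc f a = (THE b. \<forall>p :: nat \<Rightarrow> real poly.
     uniform_limit {t. complex_of_real t \<in> spectrum a} (\<lambda>m. poly (p m)) f sequentially
       \<longrightarrow> (\<lambda>m. poly_of (p m) a) \<longlonglongrightarrow> b)"

section \<open>Hilbert \<open>C\<^sup>*\<close>-modules\<close>

text \<open>The underlying set of a module is a subset of an ambient abelian group type, so that one can
  quantify over modules inside a formula; only the values of the operations on that set matter.
  Since the algebra is unital, complex scalars act on the module through multiples of the unit.\<close>

record ('x, 'a) hmodule =
  elems :: "'x set"
  act :: "'x \<Rightarrow> 'a \<Rightarrow> 'x"
  ip :: "'x \<Rightarrow> 'x \<Rightarrow> 'a"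

definition mnorm :: "('x, 'a::cstar_algebra) hmodule \<Rightarrow> 'x \<Rightarrow> real" where
  "mnorm X x = sqrt (norm (ip X x x))"

locale hilbert_module =
  fixes X :: "('x::ab_group_add, 'a::cstar_algebra) hmodule"
  assumes zero_closed: "0 \<in> elems X"
    and add_closed: "\<lbrakk>x \<in> elems X; y \<in> elems X\<rbrakk> \<Longrightarrow> x + y \<in> elems X"
    and uminus_closed: "x \<in> elems X \<Longrightarrow> - x \<in> elems X"
    and act_closed: "x \<in> elems X \<Longrightarrow> act X x a \<in> elems X"
    and act_add_left: "\<lbrakk>x \<in> elems X; y \<in> elems X\<rbrakk> \<Longrightarrow> act X (x + y) a = act X x a + act X y a"
    and act_add_right: "x \<in> elems X \<Longrightarrow> act X x (a + b) = act X x a + act X x b"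
    and act_mult: "x \<in> elems X \<Longrightarrow> act X x (a * b) = act X (act X x a) b"
    and act_one: "x \<in> elems X \<Longrightarrow> act X x 1 = x"
    and ip_add_right: "\<lbrakk>x \<in> elems X; y \<in> elems X; z \<in> elems X\<rbrakk> \<Longrightarrow>
        ip X x (y + z) = ip X x y + ip X x z"
    and ip_act_right: "\<lbrakk>x \<in> elems X; y \<in> elems X\<rbrakk> \<Longrightarrow> ip X x (act X y a) = ip X x y * a"
    and ip_star: "\<lbrakk>x \<in> elems X; y \<in> elems X\<rbrakk> \<Longrightarrow> star (ip X x y) = ip X y x"
    and ip_pos: "x \<in> elems X \<Longrightarrow> cstar_pos (ip X x x)"
    and ip_definite: "\<lbrakk>x \<in> elems X; ip X x x = 0\<rbrakk> \<Longrightarrow> x = 0"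
    and complete: "\<lbrakk>\<And>m. s m \<in> elems X;
          \<forall>e>0. \<exists>N. \<forall>i\<ge>N. \<forall>j\<ge>N. mnorm X (s i - s j) < e\<rbrakk> \<Longrightarrow>
        \<exists>l\<in>elems X. (\<lambda>m. mnorm X (s m - l)) \<longlonglongrightarrow> 0"

section \<open>Operators\<close>

text \<open>An operator on a module is a function on the ambient type that vanishes outside the module.
  Thus operators that agree on the module are equal, and sums, differences (pointwise, from
  \<^theory>\<open>HOL-Library.Function_Algebras\<close>) and composites of operators are operators. The unit operator is
  \<open>op_one\<close>.\<close>

definition operator_on :: "('x::ab_group_add, 'a) hmodule \<Rightarrow> ('x \<Rightarrow> 'x) \<Rightarrow> bool" where
  "operator_on X T \<longleftrightarrow> (\<forall>x\<in>elems X. T x \<in> elems X) \<and> (\<forall>x. x \<notin> elems X \<longrightarrow> T x = 0)"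

definition op_one :: "('x::ab_group_add, 'a) hmodule \<Rightarrow> 'x \<Rightarrow> 'x" where
  "op_one X = (\<lambda>x. if x \<in> elems X then x else 0)"

definition op_scale :: "('x, 'a::cstar_algebra) hmodule \<Rightarrow> complex \<Rightarrow> ('x \<Rightarrow> 'x) \<Rightarrow> 'x \<Rightarrow> 'x" where
  "op_scale X c T = (\<lambda>x. act X (T x) (c *\<^sub>C 1))"

definition op_norm :: "('x, 'a::cstar_algebra) hmodule \<Rightarrow> ('x \<Rightarrow> 'x) \<Rightarrow> real" where
  "op_norm X T = (SUP x\<in>{x \<in> elems X. mnorm X x \<le> 1}. mnorm X (T x))"

text \<open>The algebra of adjointable maps (linearity and boundedness are automatic).\<close>

definition adjointables :: "('x::ab_group_add, 'a) hmodule \<Rightarrow> ('x \<Rightarrow> 'x) set" where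
  "adjointables X = {T. operator_on X T \<and>
     (\<exists>U. operator_on X U \<and> (\<forall>x\<in>elems X. \<forall>y\<in>elems X. ip X (T x) y = ip X x (U y)))}"

definition adj :: "('x::ab_group_add, 'a) hmodule \<Rightarrow> ('x \<Rightarrow> 'x) \<Rightarrow> 'x \<Rightarrow> 'x" where
  "adj X T = (THE U. operator_on X U \<and> (\<forall>x\<in>elems X. \<forall>y\<in>elems X. ip X (T x) y = ip X x (U y)))"

definition self_adjoint :: "('x, 'a) hmodule \<Rightarrow> ('x \<Rightarrow> 'x) \<Rightarrow> bool" where
  "self_adjoint X T \<longleftrightarrow> (\<forall>x\<in>elems X. \<forall>y\<in>elems X. ip X (T x) y = ip X x (T y))"

definition bounded_ops :: "('x::ab_group_add, 'a::cstar_algebra) hmodule \<Rightarrow> ('x \<Rightarrow> 'x) set" where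
  "bounded_ops X = {T. operator_on X T \<and>
     (\<forall>x\<in>elems X. \<forall>y\<in>elems X. T (x + y) = T x + T y) \<and>
     (\<forall>x\<in>elems X. \<forall>a. T (act X x a) = act X (T x) a) \<and>
     (\<exists>K. \<forall>x\<in>elems X. mnorm X (T x) \<le> K * mnorm X x)}"

text \<open>Spectrum and continuous functional calculus relative to an algebra \<open>L\<close> of operators on \<open>X\<close>.
  This is used with \<open>L = adjointables X\<close> and, for Hilbert spaces, with \<open>L = bounded_ops X\<close>.\<close>

definition op_spectrum ::
  "('x::ab_group_add, 'a::cstar_algebra) hmodule \<Rightarrow> ('x \<Rightarrow> 'x) set \<Rightarrow> ('x \<Rightarrow> 'x) \<Rightarrow> complex set" where
  "op_spectrum X L T = {c. \<not> (\<exists>U\<in>L. U \<circ> (T - op_scale X c (op_one X)) = op_one X \<and>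
                                       (T - op_scale X c (op_one X)) \<circ> U = op_one X)}"

definition op_poly ::
  "('x::ab_group_add, 'a::cstar_algebra) hmodule \<Rightarrow> real poly \<Rightarrow> ('x \<Rightarrow> 'x) \<Rightarrow> 'x \<Rightarrow> 'x" where
  "op_poly X p T =
     (\<Sum>i\<le>degree p. op_scale X (complex_of_real (coeff p i)) ((T ^^ i) \<circ> op_one X))"

definition op_cfc ::
  "('x::ab_group_add, 'a::cstar_algebra) hmodule \<Rightarrow> ('x \<Rightarrow> 'x) set \<Rightarrow> (real \<Rightarrow> real) \<Rightarrow>
     ('x \<Rightarrow> 'x) \<Rightarrow> 'x \<Rightarrow> 'x" where
  "op_cfc X L f T = (THE U. U \<in> L \<and> (\<forall>p :: nat \<Rightarrow> real poly.
     uniform_limit {t. complex_of_real t \<in> op_spectrum X L T} (\<lambda>m. poly (p m)) f sequentially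
       \<longrightarrow> (\<lambda>m. op_norm X (op_poly X (p m) T - U)) \<longlonglongrightarrow> 0))"

section \<open>Operator convexity\<close>

text \<open>A Hilbert space is a Hilbert module over \<^typ>\<open>complex\<close>. A bound variable needs a fixed
  ambient type; every Hilbert space whose cardinality is at most that of the continuum, in
  particular every separable one, is isomorphic to one inside \<^typ>\<open>nat \<Rightarrow> complex\<close> (with an
  arbitrary inner product). Enlarging the ambient type would only strengthen operator convexity.
  The order on bounded operators is the pointwise order of the quadratic forms.\<close>

definition operator_convex :: "real set \<Rightarrow> (real \<Rightarrow> real) \<Rightarrow> bool" where
  "operator_convex J f \<longleftrightarrow> continuous_on J f \<and>
     (\<forall>H :: (nat \<Rightarrow> complex, complex) hmodule. hilbert_module H \<longrightarrow>
       (\<forall>A\<in>bounded_ops H. \<forall>B\<in>bounded_ops H. \<forall>l\<in>{0..1::real}.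
         self_adjoint H A \<longrightarrow> self_adjoint H B \<longrightarrow>
         op_spectrum H (bounded_ops H) A \<subseteq> complex_of_real ` J \<longrightarrow>
         op_spectrum H (bounded_ops H) B \<subseteq> complex_of_real ` J \<longrightarrow>
         (\<forall>h\<in>elems H.
           ip H h (op_cfc H (bounded_ops H) f
                     (op_scale H (of_real (1 - l)) A + op_scale H (of_real l) B) h)
           \<preceq> ip H h ((op_scale H (of_real (1 - l)) (op_cfc H (bounded_ops H) f A) +
                        op_scale H (of_real l) (op_cfc H (bounded_ops H) f B)) h))))"

end

theory Submission
  imports Defs "HOL-Computational_Algebra.Fundamental_Theorem_Algebra"
begin

text \<open>With \<open>y\<^sub>0 = k\<^sup>1\<^sup>/\<^sup>2 x\<close>, \<open>y\<^sub>i = k\<^sup>1\<^sup>/\<^sup>2 R\<^sub>i x\<close>, \<open>G\<^sub>0 = S - \<Sum> R\<^sub>i\<^sup>* T\<^sub>i R\<^sub>i\<close> and \<open>G\<^sub>i = T\<^sub>i\<close> the claim is the Jensen inequality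
  \<open>f (\<Sum> \<langle>y\<^sub>j, G\<^sub>j y\<^sub>j\<rangle>) \<le> \<Sum> \<langle>y\<^sub>j, f(G\<^sub>j) y\<^sub>j\<rangle>\<close> for \<open>\<Sum> \<langle>y\<^sub>j, y\<^sub>j\<rangle> \<le> 1\<close>. It suffices to test it against
  the states of the algebra and to replace \<open>f\<close> by a polynomial that is uniformly close to it. A state
  turns the module into a semi-inner product space, and for a polynomial only the finitely many vectors
  of two Krylov spaces matter. On their span the inequality compares a symmetric matrix \<open>A\<close> with its
  compression to a subspace, which is a diagonal block of \<open>(A + UAU)/2\<close> for the reflection \<open>U\<close> in that
  subspace; so operator convexity is needed for matrices only. The functional
  calculus rests on \<open>\<parallel>p(a)\<parallel> \<le> sup \<bar>p\<bar>\<close> over the spectrum of a self-adjoint \<open>a\<close>, for real polynomials \<open>p\<close>.\<close>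

section \<open>Seminorms satisfying the \<open>C\<^sup>*\<close>-identity\<close>

text \<open>The obstacle is that \<open>operator_convex\<close> speaks only of Hilbert spaces inside
  \<open>nat \<Rightarrow> complex\<close>, whereas the Hilbert space that a state makes out of a
  module may be too large for that type. So no quotient or completion is formed, and f is never
  applied to operators on the state space: a polynomial of degree d sees an operator G only through
  the moments <v, G^m v> with m \<le> d, and finite matrices reproduce these exactly. The price is
  an error proportional to the uniform distance between the polynomial and f, which vanishes in the
  limit.

  The norm bound for real polynomials has an elementary proof. If p(a) has norm 1 but 1 - p(a)^2
  were bounded below, the sums of the even powers of p(a), times p(a), would stay bounded by
  telescoping; the C*-identity makes their norm at least the number of terms.

  The factor k scales x and the vectors R_i x so that their squares add up to at most 1. What is
  missing to 1 is where f(0) \<le> 0 enters.\<close>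

lemma map_poly_cnj_cnj: "map_poly cnj (map_poly cnj p) = p"
  by (simp add: poly_eq_iff coeff_map_poly)

lemma map_poly_cnj_mult: "map_poly cnj (p * q) = map_poly cnj p * map_poly cnj q"
  by (simp add: poly_eq_iff coeff_map_poly coeff_mult)

lemma map_poly_cnj_add: "map_poly cnj (p + q) = map_poly cnj p + map_poly cnj q"
  by (simp add: poly_eq_iff coeff_map_poly)

lemma map_poly_cnj_diff: "map_poly cnj (p - q) = map_poly cnj p - map_poly cnj q"
  by (simp add: poly_eq_iff coeff_map_poly)

lemma map_poly_cnj_smult: "map_poly cnj (smult c p) = smult (cnj c) (map_poly cnj p)"
  by (simp add: poly_eq_iff coeff_map_poly)

text \<open>These are the self-adjoint elements for the involution
  \<open>map_poly cnj\<close>.\<close>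

definition real_coeffs :: "complex poly \<Rightarrow> bool" where
  "real_coeffs p \<longleftrightarrow> map_poly cnj p = p"

lemma real_coeffs_simps [simp]:
  "real_coeffs 0" "real_coeffs 1"
  "real_coeffs p \<Longrightarrow> real_coeffs q \<Longrightarrow> real_coeffs (p + q)"
  "real_coeffs p \<Longrightarrow> real_coeffs q \<Longrightarrow> real_coeffs (p - q)"
  "real_coeffs p \<Longrightarrow> real_coeffs q \<Longrightarrow> real_coeffs (p * q)"
  "real_coeffs p \<Longrightarrow> real_coeffs (smult (complex_of_real r) p)"
  "real_coeffs (map_poly complex_of_real P)"
  "real_coeffs [:complex_of_real r:]"
  "real_coeffs [:complex_of_real r, 1:]"
  by (simp_all add: real_coeffs_def map_poly_cnj_mult map_poly_cnj_add map_poly_cnj_smult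
      map_poly_cnj_diff map_poly_pCons map_poly_map_poly o_def)

lemma real_coeffs_power [simp]: "real_coeffs p \<Longrightarrow> real_coeffs (p ^ n)"
  by (induction n) auto

lemma real_coeffs_sum [simp]: "(\<And>i. i \<in> A \<Longrightarrow> real_coeffs (p i)) \<Longrightarrow> real_coeffs (sum p A)"
  by (induction A rule: infinite_finite_induct) auto

lemma sum_up_index_split_lt: "(\<Sum>i<m + n. f i) = (\<Sum>i<m. f i) + (\<Sum>i<n. f (m + i))"
  for f :: "nat \<Rightarrow> 'b::comm_monoid_add"
  by (induction n) (simp_all add: add.assoc)

lemma poly_map_poly_of_real:
  "poly (map_poly complex_of_real P) (complex_of_real t) = complex_of_real (poly P t)"
  by (induction P) (simp_all add: map_poly_pCons)

section \<open>Seminorms on complex polynomials: first consequences of the C*-inequality\<close>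

text \<open>The model is the norm of p(a) for a self-adjoint a. \<open>N 1\<close> may be 0, as
  happens for operators on the zero module.\<close>

locale poly_seminorm =
  fixes N :: "complex poly \<Rightarrow> real"
  assumes N_add: "N (p + q) \<le> N p + N q"
    and N_smult: "N (smult c p) = cmod c * N p"
    and N_mult: "N (p * q) \<le> N p * N q"
    and N_cstar: "(N p)\<^sup>2 \<le> N (map_poly cnj p * p)"
begin

lemma N_zero: "N 0 = 0"
  using N_smult[of 0 0] by simp

lemma N_minus: "N (- p) = N p"
  using N_smult[of "-1" p] by simp

lemma N_nonneg: "0 \<le> N p"
  using N_add[of p "- p"] by (simp add: N_zero N_minus)

lemma N_diff: "N (p - q) \<le> N p + N q"
  using N_add[of p "- q"] by (simp add: N_minus)

lemma N_cnj: "N (map_poly cnj p) = N p"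
proof -
  have "N q \<le> N (map_poly cnj q)" for q
  proof (cases "N q = 0")
    case False
    then have "0 < N q" using N_nonneg[of q] by simp
    moreover have "N q * N q \<le> N (map_poly cnj q) * N q"
      using N_cstar[of q] N_mult[of "map_poly cnj q" q] by (simp add: power2_eq_square)
    ultimately show ?thesis by simp
  qed (simp add: N_nonneg)
  from this[of p] this[of "map_poly cnj p"] show ?thesis by (simp add: map_poly_cnj_cnj)
qed

lemma N_cstar_eq: "N (map_poly cnj p * p) = (N p)\<^sup>2"
  using N_cstar[of p] N_mult[of "map_poly cnj p" p] by (simp add: power2_eq_square N_cnj)

text \<open>The two factors \<open>u \<plusminus> iv\<close> are adjoint to each other and commute, so multiplication by either
  one has the same effect on the seminorm.\<close>

lemma
  assumes "real_coeffs u" "real_coeffs v"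
  shows N_Re_le: "N (u * q) \<le> N ((u + smult \<i> v) * q)"
    and N_Im_le: "N (v * q) \<le> N ((u + smult \<i> v) * q)"
    and N_square: "(N ((u + smult \<i> v) * q))\<^sup>2 = N ((u\<^sup>2 + v\<^sup>2) * (map_poly cnj q * q))"
proof -
  let ?z = "u + smult \<i> v" and ?z' = "u - smult \<i> v"
  have cnj_z: "map_poly cnj ?z = ?z'" and cnj_z': "map_poly cnj ?z' = ?z"
    using assms by (auto simp: map_poly_cnj_add map_poly_cnj_smult real_coeffs_def diff_conv_add_uminus
        simp flip: smult_minus_left simp del: add_uminus_conv_diff)
  have zz: "?z * ?z' = u\<^sup>2 + v\<^sup>2"
    by (simp add: power2_eq_square algebra_simps)
  have a: "(N (?z * q))\<^sup>2 = N ((u\<^sup>2 + v\<^sup>2) * (map_poly cnj q * q))"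
    unfolding N_cstar_eq[symmetric] map_poly_cnj_mult cnj_z zz[symmetric] by (simp add: mult_ac)
  have b: "(N (?z' * q))\<^sup>2 = N ((u\<^sup>2 + v\<^sup>2) * (map_poly cnj q * q))"
    unfolding N_cstar_eq[symmetric] map_poly_cnj_mult cnj_z' zz[symmetric] by (simp add: mult_ac)
  have eq: "N (?z' * q) = N (?z * q)"
    using a b N_nonneg by (metis power2_eq_imp_eq)
  show "(N (?z * q))\<^sup>2 = N ((u\<^sup>2 + v\<^sup>2) * (map_poly cnj q * q))" by fact
  have "N (smult 2 (u * q)) \<le> N (?z * q) + N (?z' * q)"
  proof -
    have "smult 2 (u * q) = ?z * q + ?z' * q"
      using smult_add_left[of 1 1 "u * q"] by (simp add: algebra_simps)
    then show ?thesis by (simp only: N_add)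
  qed
  then show "N (u * q) \<le> N (?z * q)" by (simp add: N_smult eq)
  have "N (smult (2 * \<i>) (v * q)) \<le> N (?z * q) + N (?z' * q)"
  proof -
    have "smult (2 * \<i>) (v * q) = ?z * q - ?z' * q"
      using smult_add_left[of \<i> \<i> "v * q"] by (simp add: algebra_simps)
    then show ?thesis by (simp only: N_diff)
  qed
  then show "N (v * q) \<le> N (?z * q)" by (simp add: N_smult eq norm_mult)
qed

text \<open>The linear factor X - c has X - Re c as real part and the constant - Im c as imaginary
  part, so \<open>N_Im_le\<close> yields the usual resolvent bound off the real axis.\<close>

lemma N_nonreal: "\<bar>Im c\<bar> * N q \<le> N ([:- c, 1:] * q)"
proof -
  have "[:- c, 1:] = [:complex_of_real (- Re c), 1:] + smult \<i> [:complex_of_real (- Im c):]"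
    by (simp add: complex_eq_iff)
  moreover have "N ([:complex_of_real (- Im c):] * q) = \<bar>Im c\<bar> * N q"
    using N_smult[of "complex_of_real (- Im c)" q] by (simp add: N_minus)
  ultimately show ?thesis
    using N_Im_le[of "[:complex_of_real (- Re c), 1:]" "[:complex_of_real (- Im c):]" q]
    by (metis real_coeffs_simps(8,9))
qed

section \<open>Powers and geometric sums\<close>

lemma N_power_le: "N p \<le> 1 \<Longrightarrow> n > 0 \<Longrightarrow> N (p ^ n) \<le> 1"
proof (induction n)
  case (Suc n)
  show ?case
  proof (cases "n = 0")
    case False
    then have "N p * N (p ^ n) \<le> 1 * 1" using Suc N_nonneg by (intro mult_mono) auto
    then show ?thesis using N_mult[of p "p ^ n"] by simp
  qed (use Suc in simp)
qed simp

text \<open>The C*-identity handles the exponents 2^k. For other n the factorisation p^(2^n) = p^n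
  p^(2^n - n) and submultiplicativity leave no room below 1.\<close>

lemma N_power_eq_1:
  assumes "real_coeffs p" "N p = 1" "n > 0"
  shows "N (p ^ n) = 1"
proof -
  have *: "N (p ^ (2 ^ k)) = 1" for k
  proof (induction k)
    case (Suc k)
    have "p ^ (2 ^ Suc k) = p ^ (2 ^ k) * p ^ (2 ^ k)"
      by (simp add: mult_2 power_add)
    then have "N (p ^ (2 ^ Suc k)) = (N (p ^ (2 ^ k)))\<^sup>2"
      using N_cstar_eq[of "p ^ (2 ^ k)"] real_coeffs_power[OF assms(1), of "2 ^ k"]
      by (simp add: real_coeffs_def)
    then show ?case using Suc by simp
  qed (use assms in simp)
  have "2 ^ n = n + (2 ^ n - n)" by (simp add: less_imp_le)
  then have "p ^ (2 ^ n) = p ^ n * p ^ (2 ^ n - n)" by (metis power_add)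
  then have "1 \<le> N (p ^ n) * N (p ^ (2 ^ n - n))" using *[of n] N_mult by metis
  moreover have "N (p ^ (2 ^ n - n)) \<le> 1" using assms by (intro N_power_le) auto
  moreover have "N (p ^ n) \<le> 1" using assms by (intro N_power_le) auto
  ultimately show ?thesis
    using mult_left_le[OF \<open>N (p ^ (2 ^ n - n)) \<le> 1\<close> N_nonneg[of "p ^ n"]] by linarith
qed

text \<open>With \<open>s(n) = \<Sum>i<n. p ^ (2 i)\<close> one has \<open>s(2 m)\<^sup>2 = (2 s(m) p ^ m)\<^sup>2 + (s(m) (1 - p ^ (2 m)))\<^sup>2\<close>.\<close>

lemma N_geometric:
  assumes p: "real_coeffs p" "N p = 1" and j: "j > 0"
  shows "2 ^ k \<le> N ((\<Sum>i<2 ^ k. (p\<^sup>2) ^ i) * p ^ j)"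
  using j
\<comment> \<open>\<open>j\<close> is generalised because each doubling of the number of terms moves
  a factor \<open>p ^ m\<close> from the sum into the final power.\<close>
proof (induction k arbitrary: j)
  case 0
  then show ?case using N_power_eq_1[OF p] by simp
next
  case (Suc k)
  define m where "m = (2::nat) ^ k"
  define s where "s = (\<Sum>i<m. (p\<^sup>2) ^ i)"
  define s2 where "s2 = (\<Sum>i<2 * m. (p\<^sup>2) ^ i)"
  define u where "u = s * p ^ m + s * p ^ m"
  define v where "v = s * (1 - p ^ m * p ^ m)"
  have rs: "real_coeffs s" "real_coeffs s2" using p by (auto simp: s_def s2_def)
  have u: "real_coeffs u" unfolding u_def using rs p by (intro real_coeffs_simps real_coeffs_power)
  have v: "real_coeffs v" using rs p by (simp add: v_def)
  have "s2 = s + (\<Sum>i<m. (p\<^sup>2) ^ (m + i))"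
    unfolding s2_def s_def mult_2 by (rule sum_up_index_split_lt)
  also have "(\<Sum>i<m. (p\<^sup>2) ^ (m + i)) = s * (p ^ m * p ^ m)"
    unfolding s_def sum_distrib_right by (rule sum.cong) (simp_all add: power_add power_mult_distrib power2_eq_square)
  finally have s2: "s2 = s * (1 + p ^ m * p ^ m)"
    by (simp add: distrib_left)
  have "u\<^sup>2 + v\<^sup>2 = s2 * s2"
    unfolding s2 u_def v_def
    by (simp add: power2_eq_square algebra_simps)
  then have "(N ((u + smult \<i> v) * p ^ j))\<^sup>2 = N ((s2 * s2) * (map_poly cnj (p ^ j) * p ^ j))"
    using N_square[OF u v, of "p ^ j"] by simp
  also have "\<dots> = N (map_poly cnj (s2 * p ^ j) * (s2 * p ^ j))"
    using rs p real_coeffs_power[of p j] by (simp add: real_coeffs_def map_poly_cnj_mult mult_ac)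
  also have "\<dots> = (N (s2 * p ^ j))\<^sup>2" by (rule N_cstar_eq)
  finally have "N ((u + smult \<i> v) * p ^ j) = N (s2 * p ^ j)"
    using N_nonneg by (metis power2_eq_imp_eq)
  then have "N (u * p ^ j) \<le> N (s2 * p ^ j)"
    using N_Re_le[OF u v, of "p ^ j"] by simp
  moreover have "N (u * p ^ j) = 2 * N (s * p ^ (m + j))"
  proof -
    have "u * p ^ j = smult 2 (s * p ^ (m + j))"
      using smult_add_left[of 1 1 "s * p ^ (m + j)"] by (simp add: u_def power_add algebra_simps)
    then show ?thesis by (simp add: N_smult)
  qed
  moreover have "m \<le> N (s * p ^ (m + j))"
    using Suc.IH[of "m + j"] Suc.prems by (simp add: s_def m_def)
  ultimately show ?case by (simp add: s2_def m_def)
qed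

section \<open>The approximate spectrum and the bound by the supremum over it\<close>

definition bdd_below_at :: "complex poly \<Rightarrow> bool" where
  "bdd_below_at r \<longleftrightarrow> (\<exists>K. \<forall>q. N q \<le> K * N (r * q))"

lemma bdd_below_at_mult:
  assumes "bdd_below_at r" "bdd_below_at s"
  shows "bdd_below_at (r * s)"
proof -
  obtain K L where K: "\<And>q. N q \<le> K * N (r * q)" and L: "\<And>q. N q \<le> L * N (s * q)"
    using assms unfolding bdd_below_at_def by blast
  have "N q \<le> (\<bar>L\<bar> * K) * N (r * s * q)" for q
  proof -
    have "N q \<le> \<bar>L\<bar> * N (s * q)"
      using L[of q] by (rule order_trans) (intro mult_right_mono, auto simp: N_nonneg)
    also have "\<dots> \<le> \<bar>L\<bar> * (K * N (r * (s * q)))"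
      using K[of "s * q"] by (intro mult_left_mono) auto
    finally show ?thesis by (simp add: mult_ac)
  qed
  then show ?thesis unfolding bdd_below_at_def by blast
qed

text \<open>Over the complex numbers \<open>r\<close> splits into linear factors, and lower bounds
  multiply; the induction removes one root at a time.\<close>

lemma bdd_below_at_poly:
  assumes "r \<noteq> 0" "\<And>c. poly r c = 0 \<Longrightarrow> bdd_below_at [:- c, 1:]"
  shows "bdd_below_at r"
  using assms
proof (induction "degree r" arbitrary: r)
  case 0
  obtain a where a: "r = [:a:]" by (rule degree_eq_zeroE[OF 0(1)[symmetric]])
  then have "a \<noteq> 0" using 0 by auto
  then have "N q \<le> (1 / cmod a) * N (r * q)" for q by (simp add: a N_smult)
  then show ?case unfolding bdd_below_at_def by blast
next
  case (Suc n)
  then have "\<not> constant (poly r)" by (simp add: constant_degree)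
  then obtain c where c: "poly r c = 0" using fundamental_theorem_of_algebra by blast
  then have "[:- c, 1:] dvd r" by (simp add: poly_eq_0_iff_dvd)
  then obtain s where s: "r = [:- c, 1:] * s" by (rule dvdE)
  then have "s \<noteq> 0" using Suc.prems(1) by auto
  then have "degree r = 1 + degree s" unfolding s by (subst degree_mult_eq) simp_all
  then have "n = degree s" using Suc.hyps(2) by simp
  moreover have "poly r d = 0" if "poly s d = 0" for d unfolding s poly_mult that by simp
  ultimately have "bdd_below_at s"
    using \<open>s \<noteq> 0\<close> Suc.prems(2) by (rule_tac Suc.hyps(1)) blast+
  then show ?case
    using Suc.prems(2)[OF c] bdd_below_at_mult unfolding s by blast
qed

text \<open>The approximate point spectrum. It can be defined with polynomials alone, before any
  inverse exists; completeness will later identify it with the spectrum.\<close>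

definition apx_spec :: "real set" where
  "apx_spec = {t. \<not> bdd_below_at [:- complex_of_real t, 1:]}"

lemma bdd_below_at_linear: "c \<notin> complex_of_real ` apx_spec \<Longrightarrow> bdd_below_at [:- c, 1:]"
proof (cases "Im c = 0")
  case True
  then have "c = complex_of_real (Re c)" by (simp add: complex_eq_iff)
  moreover assume "c \<notin> complex_of_real ` apx_spec"
  ultimately show ?thesis unfolding apx_spec_def by (metis (no_types, lifting) imageI mem_Collect_eq)
next
  case False
  then have "N q \<le> (1 / \<bar>Im c\<bar>) * N ([:- c, 1:] * q)" for q
    using N_nonreal[of c q] by (simp add: field_simps)
  then show ?thesis unfolding bdd_below_at_def by blast
qed

text \<open>If no t qualified, all roots of 1 - p1^2, where p1 is p scaled to norm 1, would avoid
  the approximate spectrum, so 1 - p1^2 would be bounded below. Times a geometric sum it telescopes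
  to something of norm at most 2, while the sum itself has norm at least 2^k by
  \<open>N_geometric\<close>. The case excluded by \<open>ne\<close> is 1 - p1^2 = 0, where there is
  nothing to factor.\<close>

lemma apx_spec_attained:
  assumes p: "real_coeffs p" and b: "0 < N p" and ne: "[:complex_of_real (N p):]\<^sup>2 \<noteq> p\<^sup>2"
  obtains t where "t \<in> apx_spec" "cmod (poly p (complex_of_real t)) = N p"
proof (rule ccontr)
  assume not: "\<not> thesis"
  define b where "b = N p"
  define p1 where "p1 = smult (complex_of_real (1 / b)) p"
  have b0: "b > 0" using assms by (simp add: b_def)
  then have N1: "N p1 = 1" by (simp add: p1_def N_smult norm_divide) (simp add: b_def)
  have rp: "real_coeffs p1" using p by (simp add: p1_def del: of_real_divide)
  have p: "p = [:complex_of_real b:] * p1" using b0 by (simp add: p1_def)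
  have "1 - p1\<^sup>2 \<noteq> 0"
    using ne unfolding b_def[symmetric] by (auto simp: p power_mult_distrib simp del: mult_pCons_left)
  then have "bdd_below_at (1 - p1\<^sup>2)"
  proof (rule bdd_below_at_poly)
    fix c assume c: "poly (1 - p1\<^sup>2) c = 0"
    then have "(poly p1 c)\<^sup>2 = 1" by simp
    then have "cmod (poly p1 c) = 1"
      by (auto simp: power2_eq_1_iff)
    then have "cmod (poly p c) = b" using b0 by (simp add: p norm_mult)
    then have "c \<notin> complex_of_real ` apx_spec" using not that unfolding b_def by auto
    then show "bdd_below_at [:- c, 1:]" by (rule bdd_below_at_linear)
  qed
  then obtain K where K: "\<And>q. N q \<le> K * N ((1 - p1\<^sup>2) * q)"
    unfolding bdd_below_at_def by blast
  have "2 ^ k \<le> \<bar>K\<bar> * 2" for k :: nat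
  proof -
    define n where "n = (2::nat) ^ k"
    let ?q = "(\<Sum>i<n. (p1\<^sup>2) ^ i) * p1"
    have "(1 - p1\<^sup>2) * ?q = (1 - (p1\<^sup>2) ^ n) * p1"
      by (simp only: one_diff_power_eq[of "p1\<^sup>2" n] mult.assoc)
    also have "\<dots> = p1 - p1 ^ (2 * n + 1)"
      by (simp add: algebra_simps flip: power_mult)
    finally have "(1 - p1\<^sup>2) * ?q = p1 - p1 ^ (2 * n + 1)" .
    then have "N ((1 - p1\<^sup>2) * ?q) \<le> 1 + 1"
      using N_diff[of p1 "p1 ^ (2 * n + 1)"] N_power_le[of p1 "2 * n + 1"] N1 by simp
    then have "K * N ((1 - p1\<^sup>2) * ?q) \<le> \<bar>K\<bar> * 2"
      using N_nonneg by (intro mult_mono) auto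
    then show ?thesis using N_geometric[OF rp N1, of 1 k] K[of ?q] by (simp add: n_def)
  qed
  moreover obtain k where "2 ^ k > \<bar>K\<bar> * 2" using real_arch_pow[of 2 "\<bar>K\<bar> * 2"] by auto
  ultimately show False by (meson not_le)
qed

text \<open>If X has seminorm 0, so has every multiple of it, and 0 is a point; otherwise X attains
  its norm.\<close>

lemma apx_spec_nonempty: "N 1 \<noteq> 0 \<Longrightarrow> apx_spec \<noteq> {}"
proof (cases "N [:0, 1:] = 0")
  case True
  assume 1: "N 1 \<noteq> 0"
  have "N ([:0, 1:] * q) = 0" for q
    using N_mult[of "[:0, 1:]" q] N_nonneg[of "[:0, 1:] * q"] True by simp
  then have "\<not> bdd_below_at [:0, 1:]"
    unfolding bdd_below_at_def using 1 N_nonneg[of 1] by (metis antisym mult_zero_right)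
  then show ?thesis unfolding apx_spec_def by (auto intro: exI[of _ 0])
next
  case False
  have "real_coeffs [:0, 1:]" using real_coeffs_simps(9)[of 0] by simp
  moreover have "[:complex_of_real (N [:0, 1:]):]\<^sup>2 \<noteq> [:0, 1:]\<^sup>2"
    by (simp add: power2_eq_square)
  ultimately show ?thesis
    using apx_spec_attained[of "[:0, 1:]"] False N_nonneg[of "[:0, 1:]"] by fastforce
qed

theorem N_le_sup:
  assumes M: "0 \<le> M" "\<And>t. t \<in> apx_spec \<Longrightarrow> \<bar>poly P t\<bar> \<le> M"
  shows "N (map_poly complex_of_real P) \<le> M"
proof (rule ccontr)
  define p where "p = map_poly complex_of_real P"
  assume "\<not> ?thesis"
  then have b: "M < N p" by (simp add: p_def)
  have P: "cmod (poly p (complex_of_real t)) = \<bar>poly P t\<bar>" for t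
    by (simp add: p_def poly_map_poly_of_real)
  have "\<exists>t\<in>apx_spec. cmod (poly p (complex_of_real t)) = N p"
  proof (cases "[:complex_of_real (N p):]\<^sup>2 = p\<^sup>2")
    case True
    \<comment> \<open>Here p^2 is constant, so |p| equals its norm everywhere and any point of the
      nonempty set will do.\<close>
    have "N 1 \<noteq> 0" using N_mult[of 1 p] b M by auto
    then obtain t where "t \<in> apx_spec" using apx_spec_nonempty by blast
    moreover have "cmod (poly p (complex_of_real t)) = N p"
    proof -
      have "(complex_of_real (N p))\<^sup>2 = (poly p (complex_of_real t))\<^sup>2"
        using arg_cong[OF True, of "\<lambda>q. poly q (complex_of_real t)"] by simp
      then have "(cmod (poly p (complex_of_real t)))\<^sup>2 = (N p)\<^sup>2"
        by (metis norm_of_real norm_power power2_abs)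
      then show ?thesis using N_nonneg by (simp add: power2_eq_iff_nonneg)
    qed
    ultimately show ?thesis by blast
  next
    case False
    have "real_coeffs p" by (simp add: p_def)
    then show ?thesis using apx_spec_attained[of p] False b M by force
  qed
  then show False using M(2) b P by force
qed

text \<open>Real and imaginary parts are estimated separately, hence the factor 2. It is harmless,
  as the bound only serves to prove convergence.\<close>

lemma N_le_sup_complex:
  assumes M: "0 \<le> M" "\<And>t. t \<in> apx_spec \<Longrightarrow> cmod (poly p (complex_of_real t)) \<le> M"
  shows "N p \<le> 2 * M"
proof -
  define u v where "u = map_poly Re p" and "v = map_poly Im p"
  have p: "p = map_poly complex_of_real u + smult \<i> (map_poly complex_of_real v)"
    by (simp add: poly_eq_iff u_def v_def coeff_map_poly complex_eq_iff)
  have uv: "poly p (complex_of_real t) = Complex (poly u t) (poly v t)" for t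
    unfolding p poly_add poly_smult poly_map_poly_of_real by (simp add: complex_eq_iff)
  have "\<bar>poly u t\<bar> \<le> M" "\<bar>poly v t\<bar> \<le> M" if "t \<in> apx_spec" for t
    using M(2)[OF that] abs_Re_le_cmod[of "poly p (complex_of_real t)"]
      abs_Im_le_cmod[of "poly p (complex_of_real t)"] by (auto simp: uv)
  then have "N (map_poly complex_of_real u) \<le> M" "N (map_poly complex_of_real v) \<le> M"
    using M(1) by (auto intro!: N_le_sup)
  then show ?thesis
    unfolding p using N_add[of "map_poly complex_of_real u" "smult \<i> (map_poly complex_of_real v)"]
    by (simp add: N_smult)
qed

text \<open>If |p(t)| exceeded N p, then p - p(t) would be bounded below by the gap; being a
  multiple of X - t, it would make X - t bounded below too.\<close>

lemma apx_spec_poly_le: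
  assumes t: "t \<in> apx_spec"
  shows "cmod (poly p (complex_of_real t)) \<le> N p"
proof (rule ccontr)
  let ?c = "poly p (complex_of_real t)" and ?L = "[:- complex_of_real t, 1:]"
  assume less: "\<not> cmod ?c \<le> N p"
  have "poly (p - [:?c:]) (complex_of_real t) = 0" by simp
  then have "?L dvd p - [:?c:]" by (simp only: poly_eq_0_iff_dvd)
  then obtain s where s: "p - [:?c:] = ?L * s" by (rule dvdE)
  have "(cmod ?c - N p) * N q \<le> N s * N (?L * q)" for q
  proof -
    have "smult ?c q = p * q - (p - [:?c:]) * q" by (simp add: algebra_simps)
    also have "\<dots> = p * q - s * (?L * q)" unfolding s by (simp only: mult_ac)
    finally have "cmod ?c * N q \<le> N (p * q) + N (s * (?L * q))"
      using N_diff N_smult by metis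
    then show ?thesis
      using N_mult[of p q] N_mult[of s "?L * q"] by (simp only: left_diff_distrib)
  qed
  moreover have d: "0 < cmod ?c - N p" using less by simp
  ultimately have "N q \<le> (N s / (cmod ?c - N p)) * N (?L * q)" for q
    unfolding times_divide_eq_left pos_le_divide_eq[OF d] mult.commute[of "N q"] by blast
  then show False using t unfolding apx_spec_def bdd_below_at_def by blast
qed

lemma bdd_apx_spec: "t \<in> apx_spec \<Longrightarrow> \<bar>t\<bar> \<le> N [:0, 1:]"
  using apx_spec_poly_le[of t "[:0, 1:]"] by simp

text \<open>Lower bounds survive small shifts: moving t by less than 1/(2 L) costs at most half of
  \<open>N q\<close>.\<close>

lemma closed_apx_spec: "closed apx_spec"
proof -
  have "\<exists>e>0. ball t e \<subseteq> - apx_spec" if t: "t \<in> - apx_spec" for t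
  proof -
    obtain K where K: "\<And>q. N q \<le> K * N ([:- complex_of_real t, 1:] * q)"
      using t unfolding apx_spec_def bdd_below_at_def by auto
    define L where "L = \<bar>K\<bar> + 1"
    have L: "N q \<le> L * N ([:- complex_of_real t, 1:] * q)" for q
      using K[of q] by (rule order_trans) (auto simp: L_def intro!: mult_right_mono N_nonneg)
    have L0: "L > 0" by (simp add: L_def)
    have "bdd_below_at [:- complex_of_real s, 1:]" if s: "\<bar>t - s\<bar> < 1 / (2 * L)" for s
    proof -
      have "N q \<le> (2 * L) * N ([:- complex_of_real s, 1:] * q)" for q
      proof -
        have "[:- complex_of_real t, 1:] * q = [:- complex_of_real s, 1:] * q + smult (complex_of_real (s - t)) q"
          by (simp add: algebra_simps flip: smult_add_left)
        then have "N ([:- complex_of_real t, 1:] * q) \<le> N ([:- complex_of_real s, 1:] * q) + \<bar>s - t\<bar> * N q"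
          using N_add[of "[:- complex_of_real s, 1:] * q" "smult (complex_of_real (s - t)) q"]
            N_smult[of "complex_of_real (s - t)" q] unfolding norm_of_real by metis
        moreover have "\<bar>s - t\<bar> * N q \<le> 1 / (2 * L) * N q"
          using s N_nonneg by (intro mult_right_mono) auto
        ultimately have "L * N ([:- complex_of_real t, 1:] * q)
            \<le> L * (N ([:- complex_of_real s, 1:] * q) + 1 / (2 * L) * N q)"
          using L0 by (intro mult_left_mono) auto
        also have "\<dots> = L * N ([:- complex_of_real s, 1:] * q) + N q / 2"
          using L0 unfolding distrib_left by simp
        finally show ?thesis using L[of q] by linarith
      qed
      then show ?thesis unfolding bdd_below_at_def by blast
    qed
    then have "ball t (1 / (2 * L)) \<subseteq> - apx_spec" by (auto simp: apx_spec_def dist_real_def)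
    then show ?thesis using L0 by (intro exI[of _ "1 / (2 * L)"]) auto
  qed
  then have "open (- apx_spec)" unfolding open_contains_ball by blast
  then show ?thesis by (simp add: closed_def)
qed

lemma compact_apx_spec: "compact apx_spec"
  using closed_apx_spec bdd_apx_spec by (auto simp: compact_eq_bounded_closed bounded_iff)

end

section \<open>Spectrum and functional calculus of a self-adjoint element\<close>

lemma Weierstrass_sequence:
  fixes f :: "real \<Rightarrow> real"
  assumes "compact S" "continuous_on S f"
  obtains p :: "nat \<Rightarrow> real poly" where
    "\<And>m t. t \<in> S \<Longrightarrow> \<bar>poly (p m) t - f t\<bar> \<le> inverse (real (Suc m))"
proof -
  have "\<exists>p. \<forall>t\<in>S. \<bar>poly p t - f t\<bar> \<le> e" if "e > 0" for e
  proof -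
    obtain g where g: "real_polynomial_function g" "\<And>t. t \<in> S \<Longrightarrow> \<bar>f t - g t\<bar> < e"
      using Stone_Weierstrass_real_polynomial_function[OF assms \<open>e > 0\<close>] by blast
    then obtain a n where "g = (\<lambda>x. \<Sum>i\<le>n. a i * x ^ i)"
      unfolding real_polynomial_function_iff_sum by blast
    then have "poly (\<Sum>i\<le>n. monom (a i) i) t = g t" for t
      by (simp add: poly_sum poly_monom)
    then show ?thesis using g(2) by (intro exI[of _ "\<Sum>i\<le>n. monom (a i) i"]) (force simp: abs_minus_commute)
  qed
  then have "\<exists>p. \<forall>t\<in>S. \<bar>poly p t - f t\<bar> \<le> inverse (real (Suc m))" for m by simp
  then show ?thesis using that by metis
qed

lemma uniform_limit_inverse_Suc:
  fixes f :: "real \<Rightarrow> real"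
  assumes "\<And>m t. t \<in> S \<Longrightarrow> \<bar>g m t - f t\<bar> \<le> inverse (real (Suc m))"
  shows "uniform_limit S g f sequentially"
proof (rule uniform_limitI)
  fix e :: real assume "e > 0"
  then have "\<forall>\<^sub>F m in sequentially. inverse (real (Suc m)) < e"
    using LIMSEQ_inverse_real_of_nat by (rule order_tendstoD(2)[rotated])
  then show "\<forall>\<^sub>F m in sequentially. \<forall>t\<in>S. dist (g m t) (f t) < e"
    by eventually_elim (auto simp: dist_real_def intro: le_less_trans assms)
qed

text \<open>Squares of polynomials approximate every nonnegative continuous function; this is how
  nonnegativity on a spectrum turns into positivity without constructing square roots. The constant
  2 L + 1 bounds |g + sqrt h| \<le> |g - sqrt h| + 2 sqrt h.\<close>

lemma sqrt_approximation:
  fixes h :: "real \<Rightarrow> real"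
  assumes S: "compact S" "continuous_on S h" and pos: "\<And>t. t \<in> S \<Longrightarrow> 0 \<le> h t"
  obtains g :: "nat \<Rightarrow> real poly" and M where "0 \<le> M"
    "\<And>m t. t \<in> S \<Longrightarrow> \<bar>poly (g m) t * poly (g m) t - h t\<bar> \<le> inverse (real (Suc m)) * M"
proof -
  have c: "continuous_on S (\<lambda>t. sqrt (h t))" using S(2) by (intro continuous_intros)
  from Weierstrass_sequence[OF S(1) c]
  obtain g where g: "\<And>m t. t \<in> S \<Longrightarrow> \<bar>poly (g m) t - sqrt (h t)\<bar> \<le> inverse (real (Suc m))" by metis
  obtain L where L: "\<And>t. t \<in> S \<Longrightarrow> \<bar>sqrt (h t)\<bar> \<le> L"
    using compact_imp_bounded[OF compact_continuous_image[OF c S(1)]] by (auto simp: bounded_iff)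
  have "\<bar>poly (g m) t * poly (g m) t - h t\<bar> \<le> inverse (real (Suc m)) * (2 * \<bar>L\<bar> + 1)" if t: "t \<in> S" for m t
  proof -
    have "poly (g m) t * poly (g m) t - h t = (poly (g m) t - sqrt (h t)) * (poly (g m) t + sqrt (h t))"
      using pos[OF t] by (simp add: algebra_simps)
    also have "\<bar>\<dots>\<bar> \<le> inverse (real (Suc m)) * (2 * \<bar>L\<bar> + 1)"
      unfolding abs_mult
    proof (rule mult_mono[OF g[OF t]])
      have "inverse (real (Suc m)) \<le> 1" by (simp add: field_simps)
      then have "\<bar>poly (g m) t - sqrt (h t)\<bar> \<le> 1" using g[OF t, of m] by linarith
      then show "\<bar>poly (g m) t + sqrt (h t)\<bar> \<le> 2 * \<bar>L\<bar> + 1" using L[OF t] by linarith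
    qed auto
    finally show ?thesis .
  qed
  then show ?thesis using that[of "2 * \<bar>L\<bar> + 1" g] by simp
qed

section \<open>An abstract functional calculus\<close>

abbreviation cpoly :: "real poly \<Rightarrow> complex poly" where
  "cpoly \<equiv> map_poly complex_of_real"

lemma cpoly_simps:
  "cpoly (p + q) = cpoly p + cpoly q" "cpoly (p - q) = cpoly p - cpoly q"
  "cpoly (p * q) = cpoly p * cpoly q" "cpoly (smult r p) = smult (complex_of_real r) (cpoly p)"
  by (simp_all add: poly_eq_iff coeff_map_poly coeff_mult)

text \<open>There are two instances: an element of an algebra of class \<open>cstar_algebra\<close>,
  and an adjointable map, where the algebra is a set of functions and not a type. Hence the carrier
  \<open>C\<close> and explicit norm, product and unit. The element itself enters only through the
  evaluation \<open>ev\<close>.\<close>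

locale sa_calculus =
  fixes C :: "'b::ab_group_add set" and nm :: "'b \<Rightarrow> real" and mul :: "'b \<Rightarrow> 'b \<Rightarrow> 'b"
    and one :: 'b and ev :: "complex poly \<Rightarrow> 'b"
  assumes C_add: "x \<in> C \<Longrightarrow> y \<in> C \<Longrightarrow> x + y \<in> C"
    and C_uminus: "x \<in> C \<Longrightarrow> - x \<in> C"
    and C_mul: "x \<in> C \<Longrightarrow> y \<in> C \<Longrightarrow> mul x y \<in> C"
    and mul_one: "x \<in> C \<Longrightarrow> mul one x = x"
    and mul_assoc: "x \<in> C \<Longrightarrow> y \<in> C \<Longrightarrow> z \<in> C \<Longrightarrow> mul (mul x y) z = mul x (mul y z)"
    and mul_diff_left: "x \<in> C \<Longrightarrow> y \<in> C \<Longrightarrow> z \<in> C \<Longrightarrow> mul (x - y) z = mul x z - mul y z"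
    and mul_diff_right: "x \<in> C \<Longrightarrow> y \<in> C \<Longrightarrow> z \<in> C \<Longrightarrow> mul x (y - z) = mul x y - mul x z"
    and nm_add: "x \<in> C \<Longrightarrow> y \<in> C \<Longrightarrow> nm (x + y) \<le> nm x + nm y"
    and nm_minus: "x \<in> C \<Longrightarrow> nm (- x) = nm x"
    and nm_eq_0: "x \<in> C \<Longrightarrow> nm x = 0 \<Longrightarrow> x = 0"
    and nm_nonneg: "x \<in> C \<Longrightarrow> 0 \<le> nm x"
    and nm_mul: "x \<in> C \<Longrightarrow> y \<in> C \<Longrightarrow> nm (mul x y) \<le> nm x * nm y"
    and nm_complete: "(\<And>m. s m \<in> C) \<Longrightarrow> \<forall>e>0. \<exists>N. \<forall>i\<ge>N. \<forall>j\<ge>N. nm (s i - s j) < e \<Longrightarrow>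
          \<exists>l\<in>C. (\<lambda>m. nm (s m - l)) \<longlonglongrightarrow> 0"
    and ev_closed: "ev p \<in> C"
    and ev_add: "ev (p + q) = ev p + ev q"
    and ev_mult: "ev (p * q) = mul (ev p) (ev q)"
    and ev_one: "ev 1 = one"
    and nm_ev_smult: "nm (ev (smult c p)) = cmod c * nm (ev p)"
    and ev_cstar: "(nm (ev p))\<^sup>2 \<le> nm (ev (map_poly cnj p * p))"
begin

sublocale poly_seminorm "\<lambda>p. nm (ev p)"
  by unfold_locales
    (simp_all add: ev_add nm_add ev_closed nm_ev_smult ev_mult[symmetric] nm_mul ev_cstar,
     simp add: ev_mult nm_mul ev_closed)

lemma C_diff: "x \<in> C \<Longrightarrow> y \<in> C \<Longrightarrow> x - y \<in> C"
  using C_add[OF _ C_uminus] by fastforce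

lemma nm_diff_comm: "x \<in> C \<Longrightarrow> y \<in> C \<Longrightarrow> nm (x - y) = nm (y - x)"
  using nm_minus[OF C_diff, of x y] by simp

lemma nm_triangle: "x \<in> C \<Longrightarrow> y \<in> C \<Longrightarrow> z \<in> C \<Longrightarrow> nm (x - z) \<le> nm (x - y) + nm (y - z)"
  using nm_add[OF C_diff C_diff, of x y y z] by simp

lemma ev_diff: "ev (p - q) = ev p - ev q"
  using ev_add[of "p - q" q] by (simp add: algebra_simps)

lemma limit_unique:
  assumes "x \<in> C" "y \<in> C" "\<And>m. s m \<in> C"
    and "(\<lambda>m. nm (s m - x)) \<longlonglongrightarrow> 0" "(\<lambda>m. nm (s m - y)) \<longlonglongrightarrow> 0"
  shows "x = y"
proof -
  have "(\<lambda>m. nm (s m - x) + nm (s m - y)) \<longlonglongrightarrow> 0"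
    using tendsto_add[OF assms(4,5)] by simp
  moreover have "nm (x - y) \<le> nm (s m - x) + nm (s m - y)" for m
    using nm_triangle[of x "s m" y] nm_diff_comm[of "s m" x] assms(1-3) by simp
  ultimately have "nm (x - y) \<le> 0" by (meson LIMSEQ_le_const)
  then have "x - y = 0" using assms C_diff nm_nonneg[of "x - y"] by (intro nm_eq_0) auto
  then show ?thesis by simp
qed

lemma ev_limit_exists:
  assumes "\<And>m t. t \<in> apx_spec \<Longrightarrow> cmod (poly (p m) (complex_of_real t) - f t) \<le> inverse (real (Suc m))"
  obtains U where "U \<in> C" "(\<lambda>m. nm (ev (p m) - U)) \<longlonglongrightarrow> 0"
proof -
  have "\<exists>N. \<forall>i\<ge>N. \<forall>j\<ge>N. nm (ev (p i) - ev (p j)) < e" if e: "e > 0" for e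
  proof -
    \<comment> \<open>Four: two approximation errors, each doubled by
      \<open>N_le_sup_complex\<close>.\<close>
    obtain N where N: "inverse (real (Suc N)) < e / 4"
      using reals_Archimedean[of "e / 4"] e by auto
    have "nm (ev (p i) - ev (p j)) < e" if "i \<ge> N" "j \<ge> N" for i j
    proof -
      have le: "inverse (real (Suc k)) \<le> inverse (real (Suc N))" if "k \<ge> N" for k
        using that by (simp add: field_simps)
      have "cmod (poly (p i - p j) (complex_of_real t)) \<le> 2 * inverse (real (Suc N))" if t: "t \<in> apx_spec" for t
      proof -
        have "cmod (poly (p i - p j) (complex_of_real t))
            \<le> cmod (poly (p i) (complex_of_real t) - f t) + cmod (poly (p j) (complex_of_real t) - f t)"
          using norm_triangle_ineq4[of "poly (p i) (complex_of_real t) - f t" "poly (p j) (complex_of_real t) - f t"]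
          by simp
        then show ?thesis
          using assms[OF t, of i] assms[OF t, of j] le[OF \<open>i \<ge> N\<close>] le[OF \<open>j \<ge> N\<close>] by linarith
      qed
      then have "nm (ev (p i - p j)) \<le> 2 * (2 * inverse (real (Suc N)))"
        by (intro N_le_sup_complex) auto
      then show ?thesis using N by (simp add: ev_diff)
    qed
    then show ?thesis by blast
  qed
  then show ?thesis using nm_complete[of "\<lambda>m. ev (p m)"] ev_closed that by blast
qed

section \<open>The spectrum is the approximate spectrum\<close>

definition spec :: "complex set" where
  "spec = {c. \<not> (\<exists>u\<in>C. mul u (ev [:- c, 1:]) = one \<and> mul (ev [:- c, 1:]) u = one)}"

lemma apx_spec_subset_spec: "complex_of_real ` apx_spec \<subseteq> spec"
proof
  fix c assume "c \<in> complex_of_real ` apx_spec"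
  then have c: "\<not> bdd_below_at [:- c, 1:]" unfolding apx_spec_def by auto
  have False if u: "u \<in> C" "mul u (ev [:- c, 1:]) = one" for u
  proof -
    have "nm (ev q) \<le> nm u * nm (ev ([:- c, 1:] * q))" for q
    proof -
      have "ev q = mul u (ev ([:- c, 1:] * q))"
        unfolding ev_mult using u ev_closed mul_one[of "ev q"] mul_assoc[of u "ev [:- c, 1:]" "ev q"] by simp
      then show ?thesis using nm_mul[OF u(1) ev_closed] by metis
    qed
    then show False using c unfolding bdd_below_at_def by blast
  qed
  then show "c \<in> spec" unfolding spec_def by blast
qed

text \<open>Off the compact set \<open>apx_spec\<close> the function 1/(t - c) is a uniform limit of
  polynomials q m. Their evaluations converge by completeness, and (X - c) q m tends to 1, so the
  limit is a two-sided inverse.\<close>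

lemma inverse_exists:
  assumes "c \<notin> complex_of_real ` apx_spec"
  obtains u where "u \<in> C" "mul u (ev [:- c, 1:]) = one" "mul (ev [:- c, 1:]) u = one"
proof -
  let ?g = "\<lambda>t. inverse (complex_of_real t - c)"
  let ?L = "[:- c, 1:]"
  have ne: "complex_of_real t - c \<noteq> 0" if "t \<in> apx_spec" for t using assms that by auto
  have cg: "continuous_on apx_spec ?g"
    by (intro continuous_intros) (use ne in auto)
  obtain a where a: "\<And>m t. t \<in> apx_spec \<Longrightarrow> \<bar>poly (a m) t - Re (?g t)\<bar> \<le> inverse (real (Suc m))"
    using Weierstrass_sequence[OF compact_apx_spec continuous_on_Re[OF cg]] by metis
  obtain b where b: "\<And>m t. t \<in> apx_spec \<Longrightarrow> \<bar>poly (b m) t - Im (?g t)\<bar> \<le> inverse (real (Suc m))"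
    using Weierstrass_sequence[OF compact_apx_spec continuous_on_Im[OF cg]] by metis
  \<comment> \<open>The index 2 m + 1 makes the errors of the real and the imaginary part add up to
    exactly 1/(m + 1).\<close>
  define q where "q m = cpoly (a (2 * m + 1)) + smult \<i> (cpoly (b (2 * m + 1)))" for m
  have q: "cmod (poly (q m) (complex_of_real t) - ?g t) \<le> inverse (real (Suc m))" if t: "t \<in> apx_spec" for m t
  proof -
    have "poly (q m) (complex_of_real t) - ?g t
        = Complex (poly (a (2 * m + 1)) t - Re (?g t)) (poly (b (2 * m + 1)) t - Im (?g t))"
      unfolding q_def poly_add poly_smult poly_map_poly_of_real by (simp add: complex_eq_iff)
    then have "cmod (poly (q m) (complex_of_real t) - ?g t)
        \<le> \<bar>poly (a (2 * m + 1)) t - Re (?g t)\<bar> + \<bar>poly (b (2 * m + 1)) t - Im (?g t)\<bar>"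
      using cmod_le[of "poly (q m) (complex_of_real t) - ?g t"] by simp
    also have "\<dots> \<le> inverse (real (Suc (2 * m + 1))) + inverse (real (Suc (2 * m + 1)))"
      using a[OF t] b[OF t] by (intro add_mono)
    also have "\<dots> = inverse (real (Suc m))" by (simp add: field_simps)
    finally show ?thesis .
  qed
  then obtain u where u: "u \<in> C" "(\<lambda>m. nm (ev (q m) - u)) \<longlonglongrightarrow> 0"
    using ev_limit_exists[of q ?g] by blast
  define M where "M = nm (ev [:0, 1:]) + cmod c"
  have M: "cmod (complex_of_real t - c) \<le> M" if "t \<in> apx_spec" for t
    using bdd_apx_spec[OF that] norm_triangle_ineq4[of "complex_of_real t" c] by (simp add: M_def)
  have M0: "M \<ge> 0" using N_nonneg by (simp add: M_def)
  have Lq: "nm (ev (?L * q m) - one) \<le> 2 * (M * inverse (real (Suc m)))" for m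
  proof -
    have "cmod (poly (?L * q m - 1) (complex_of_real t)) \<le> M * inverse (real (Suc m))" if t: "t \<in> apx_spec" for t
    proof -
      have "poly (?L * q m - 1) (complex_of_real t) = (complex_of_real t - c) * (poly (q m) (complex_of_real t) - ?g t)"
        using right_inverse[OF ne[OF t]] by (simp add: algebra_simps)
      then have "cmod (poly (?L * q m - 1) (complex_of_real t))
          = cmod (complex_of_real t - c) * cmod (poly (q m) (complex_of_real t) - ?g t)"
        by (simp only: norm_mult)
      also have "\<dots> \<le> M * inverse (real (Suc m))"
        by (intro mult_mono M q t M0 norm_ge_zero)
      finally show ?thesis .
    qed
    then have "nm (ev (?L * q m - 1)) \<le> 2 * (M * inverse (real (Suc m)))"
      using M0 by (intro N_le_sup_complex) auto
    then show ?thesis by (simp add: ev_diff ev_one)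
  qed
  have Lq0: "(\<lambda>m. nm (ev (?L * q m) - one)) \<longlonglongrightarrow> 0"
  proof (rule tendsto_sandwich[of "\<lambda>_. 0"])
    show "(\<lambda>m. 2 * (M * inverse (real (Suc m)))) \<longlonglongrightarrow> 0"
      using LIMSEQ_inverse_real_of_nat by (intro tendsto_mult_right_zero)
    show "\<forall>\<^sub>F m in sequentially. 0 \<le> nm (ev (?L * q m) - one)"
      by (metis C_diff ev_closed ev_one eventually_sequentiallyI nm_nonneg)
  qed (use Lq in auto)
  have bound0: "(\<lambda>m. nm (ev ?L) * nm (ev (q m) - u)) \<longlonglongrightarrow> 0"
    using u(2) by (rule tendsto_mult_right_zero)
  have "(\<lambda>m. nm (ev (?L * q m) - mul (ev ?L) u)) \<longlonglongrightarrow> 0"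
  proof (rule tendsto_sandwich[of "\<lambda>_. 0", OF _ _ _ bound0])
    show "\<forall>\<^sub>F m in sequentially. nm (ev (?L * q m) - mul (ev ?L) u) \<le> nm (ev ?L) * nm (ev (q m) - u)"
      unfolding ev_mult by (intro always_eventually allI)
        (metis C_diff ev_closed mul_diff_right nm_mul u(1))
    show "\<forall>\<^sub>F m in sequentially. 0 \<le> nm (ev (?L * q m) - mul (ev ?L) u)"
      by (intro always_eventually allI nm_nonneg C_diff ev_closed C_mul u)
  qed simp
  then have 1: "mul (ev ?L) u = one"
    using Lq0 u(1) ev_closed C_mul ev_one by (intro limit_unique[of _ _ "\<lambda>m. ev (?L * q m)"]) metis+
  have "(\<lambda>m. nm (ev (?L * q m) - mul u (ev ?L))) \<longlonglongrightarrow> 0"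
  proof (rule tendsto_sandwich[of "\<lambda>_. 0", OF _ _ _ bound0])
    have "nm (ev (?L * q m) - mul u (ev ?L)) \<le> nm (ev ?L) * nm (ev (q m) - u)" for m
      using nm_mul[OF C_diff[OF ev_closed u(1)] ev_closed, of "q m" ?L]
      unfolding mult.commute[of ?L] ev_mult mul_diff_left[OF ev_closed u(1) ev_closed, symmetric]
      by (simp add: mult.commute)
    then show "\<forall>\<^sub>F m in sequentially. nm (ev (?L * q m) - mul u (ev ?L)) \<le> nm (ev ?L) * nm (ev (q m) - u)"
      by simp
    show "\<forall>\<^sub>F m in sequentially. 0 \<le> nm (ev (?L * q m) - mul u (ev ?L))"
      by (intro always_eventually allI nm_nonneg C_diff ev_closed C_mul u)
  qed simp
  then have 2: "mul u (ev ?L) = one"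
    using Lq0 u(1) ev_closed C_mul ev_one by (intro limit_unique[of _ _ "\<lambda>m. ev (?L * q m)"]) metis+
  show ?thesis using that u(1) 1 2 by blast
qed

theorem spec_eq: "spec = complex_of_real ` apx_spec"
  using apx_spec_subset_spec inverse_exists unfolding spec_def by blast

lemma real_spec: "{t. complex_of_real t \<in> spec} = apx_spec"
  unfolding spec_eq by auto

text \<open>The first three clauses are the existence and uniqueness required by the definite
  descriptions in \<open>cfc\<close> and \<open>op_cfc\<close>. The last one, an error bound for a
  single polynomial, is the form used in all later estimates.\<close>

theorem calculus:
  assumes "continuous_on apx_spec f"
  obtains U where "U \<in> C"
    "\<And>p :: nat \<Rightarrow> real poly. uniform_limit apx_spec (\<lambda>m. poly (p m)) f sequentially \<Longrightarrow>
        (\<lambda>m. nm (ev (cpoly (p m)) - U)) \<longlonglongrightarrow> 0"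
    "\<And>V. V \<in> C \<Longrightarrow> (\<And>p :: nat \<Rightarrow> real poly. uniform_limit apx_spec (\<lambda>m. poly (p m)) f sequentially \<Longrightarrow>
        (\<lambda>m. nm (ev (cpoly (p m)) - V)) \<longlonglongrightarrow> 0) \<Longrightarrow> V = U"
    "\<And>P M. 0 \<le> M \<Longrightarrow> (\<And>t. t \<in> apx_spec \<Longrightarrow> \<bar>poly P t - f t\<bar> \<le> M) \<Longrightarrow> nm (ev (cpoly P) - U) \<le> M"
proof -
  obtain q where q: "\<And>m t. t \<in> apx_spec \<Longrightarrow> \<bar>poly (q m) t - f t\<bar> \<le> inverse (real (Suc m))"
    using Weierstrass_sequence[OF compact_apx_spec assms] by metis
  have "cmod (poly (cpoly (q m)) (complex_of_real t) - complex_of_real (f t)) \<le> inverse (real (Suc m))"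
    if "t \<in> apx_spec" for m t
    using q[OF that, of m] unfolding poly_map_poly_of_real of_real_diff[symmetric] norm_of_real .
  then obtain U where U: "U \<in> C" "(\<lambda>m. nm (ev (cpoly (q m)) - U)) \<longlonglongrightarrow> 0"
    using ev_limit_exists[of "\<lambda>m. cpoly (q m)" "\<lambda>t. complex_of_real (f t)"] by blast
  have close: "nm (ev (cpoly P) - U) \<le> M" if M: "0 \<le> M" "\<And>t. t \<in> apx_spec \<Longrightarrow> \<bar>poly P t - f t\<bar> \<le> M" for P M
  proof (rule LIMSEQ_le_const)
    show "(\<lambda>m. M + inverse (real (Suc m)) + nm (ev (cpoly (q m)) - U)) \<longlonglongrightarrow> M"
      using tendsto_add[OF tendsto_add[OF tendsto_const[of M] LIMSEQ_inverse_real_of_nat] U(2)] by simp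
    have "nm (ev (cpoly P) - U) \<le> M + inverse (real (Suc m)) + nm (ev (cpoly (q m)) - U)" for m
    proof -
      have "\<bar>poly (P - q m) t\<bar> \<le> M + inverse (real (Suc m))" if "t \<in> apx_spec" for t
        using M(2)[OF that] q[OF that, of m] by simp
      then have "nm (ev (cpoly (P - q m))) \<le> M + inverse (real (Suc m))"
        using M(1) by (intro N_le_sup) auto
      then show ?thesis
        using nm_triangle[OF ev_closed ev_closed U(1), of "cpoly P" "cpoly (q m)"]
        by (simp add: cpoly_simps ev_diff)
    qed
    then show "\<exists>N. \<forall>m\<ge>N. nm (ev (cpoly P) - U) \<le> M + inverse (real (Suc m)) + nm (ev (cpoly (q m)) - U)"
      by blast
  qed
  have lim: "(\<lambda>m. nm (ev (cpoly (p m)) - U)) \<longlonglongrightarrow> 0"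
    if p: "uniform_limit apx_spec (\<lambda>m. poly (p m)) f sequentially" for p :: "nat \<Rightarrow> real poly"
  proof (rule LIMSEQ_I)
    fix r :: real assume r: "0 < r"
    then have "\<forall>\<^sub>F m in sequentially. \<forall>t\<in>apx_spec. dist (poly (p m) t) (f t) < r / 2"
      using uniform_limitD[OF p, of "r / 2"] by simp
    then have "\<forall>\<^sub>F m in sequentially. nm (ev (cpoly (p m)) - U) < r"
    proof eventually_elim
      case (elim m)
      then have "nm (ev (cpoly (p m)) - U) \<le> r / 2"
        using r by (intro close) (auto simp: dist_real_def less_imp_le)
      then show ?case using r by simp
    qed
    then show "\<exists>no. \<forall>n\<ge>no. norm (nm (ev (cpoly (p n)) - U) - 0) < r"
      using nm_nonneg[OF C_diff[OF ev_closed U(1)]] by (simp add: eventually_sequentially)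
  qed
  show ?thesis
  proof (rule that[OF U(1) lim _ close])
    fix V assume V: "V \<in> C" "\<And>p :: nat \<Rightarrow> real poly. uniform_limit apx_spec (\<lambda>m. poly (p m)) f sequentially \<Longrightarrow>
        (\<lambda>m. nm (ev (cpoly (p m)) - V)) \<longlonglongrightarrow> 0"
    have "uniform_limit apx_spec (\<lambda>m. poly (q m)) f sequentially"
      by (rule uniform_limit_inverse_Suc) (rule q)
    then show "V = U"
      using V U ev_closed by (intro limit_unique[of _ _ "\<lambda>m. ev (cpoly (q m))"]) auto
  qed auto
qed

end

section \<open>Positive elements\<close>

lemma star_0 [simp]: "star (0::'a::cstar_algebra) = 0"
  using star_add[of 0 "0::'a"] by simp

lemma star_minus: "star (- a) = - star (a::'a::cstar_algebra)"
  using star_add[of a "- a"] by (simp add: eq_neg_iff_add_eq_0 add.commute)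

lemma star_diff: "star (a - b) = star a - star (b::'a::cstar_algebra)"
  using star_add[of a "- b"] by (simp add: star_minus)

lemma star_1 [simp]: "star (1::'a::cstar_algebra) = 1"
  using star_mult[of "star 1" "1::'a"] by (simp add: star_star)

lemma star_scaleR: "star (r *\<^sub>R a) = r *\<^sub>R star (a::'a::cstar_algebra)"
  using star_scaleC[of "complex_of_real r" a] by (simp add: scaleC_of_real)

lemma star_sum: "star (sum g A) = (\<Sum>i\<in>A. star (g i :: 'a::cstar_algebra))"
  by (induction A rule: infinite_finite_induct) (simp_all add: star_add)

lemma norm_star: "norm (star a) = norm (a::'a::cstar_algebra)"
proof -
  have "norm b \<le> norm (star b)" for b :: 'a
  proof (cases "b = 0")
    case False
    have "norm b * norm b \<le> norm (star b) * norm b"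
      using cstar_identity[of b] norm_mult_ineq[of "star b" b] by (simp add: power2_eq_square)
    then show ?thesis using False by simp
  qed simp
  from this[of a] this[of "star a"] show ?thesis by (simp add: star_star)
qed

lemma bounded_linear_star: "bounded_linear (star :: 'a::cstar_algebra \<Rightarrow> 'a)"
  by (rule bounded_linear_intro[where K = 1]) (simp_all add: star_add star_scaleR norm_star)

lemma tendsto_star: "s \<longlonglongrightarrow> l \<Longrightarrow> (\<lambda>m. star (s m :: 'a::cstar_algebra)) \<longlonglongrightarrow> star l"
  by (rule bounded_linear.tendsto[OF bounded_linear_star])

lemma scaleC_0_left [simp]: "0 *\<^sub>C a = (0::'a::cstar_algebra)"
  using scaleC_of_real[of 0 a] by simp

lemma scaleC_1 [simp]: "1 *\<^sub>C a = (a::'a::cstar_algebra)"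
  using scaleC_of_real[of 1 a] by simp

lemma scaleC_0_right [simp]: "c *\<^sub>C 0 = (0::'a::cstar_algebra)"
  using scaleC_add_right[of c 0 "0::'a"] by simp

lemma scaleC_minus_left: "(- c) *\<^sub>C a = - (c *\<^sub>C a :: 'a::cstar_algebra)"
  using scaleC_add_left[of "- c" c a] by (simp add: eq_neg_iff_add_eq_0)

lemma scaleC_minus_right: "c *\<^sub>C (- a) = - (c *\<^sub>C a :: 'a::cstar_algebra)"
  using scaleC_add_right[of c "- a" a] by (simp add: eq_neg_iff_add_eq_0)

lemma scaleC_diff_right: "c *\<^sub>C (a - b) = c *\<^sub>C a - c *\<^sub>C (b :: 'a::cstar_algebra)"
  using scaleC_add_right[of c a "- b"] by (simp add: scaleC_minus_right)

section \<open>Polynomials in an algebra element\<close>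

text \<open>\<open>poly_of\<close> has real coefficients only; splitting into linear factors needs
  complex ones. The fold is Horner's scheme.\<close>

definition pev :: "'a::cstar_algebra \<Rightarrow> complex poly \<Rightarrow> 'a" where
  "pev a p = fold_coeffs (\<lambda>c x. c *\<^sub>C 1 + a * x) p 0"

lemma pev_0 [simp]: "pev a 0 = 0"
  by (simp add: pev_def)

lemma pev_pCons [simp]: "pev a (pCons c p) = c *\<^sub>C 1 + a * pev a p"
  by (cases "p = 0 \<and> c = 0") (auto simp: pev_def)

lemma pev_add: "pev a (p + q) = pev a p + pev a q"
  by (induction p q rule: poly_induct2) (simp_all add: scaleC_add_left algebra_simps)

lemma pev_smult: "pev a (smult c p) = c *\<^sub>C pev a p"
  by (induction p) (simp_all add: scaleC_add_right scaleC_scaleC mult_scaleC_right)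

lemma pev_mult: "pev a (p * q) = pev a p * pev a q"
  by (induction p) (simp_all add: pev_add pev_smult algebra_simps mult_scaleC_left)

lemma pev_one: "pev a 1 = 1"
  by (simp add: one_pCons)

lemma pev_commute: "pev a p * a = a * pev a p"
  by (induction p) (simp_all add: algebra_simps mult_scaleC_left mult_scaleC_right)

lemma star_pev: "star a = a \<Longrightarrow> star (pev a p) = pev a (map_poly cnj p)"
  by (induction p) (simp_all add: map_poly_pCons star_add star_scaleC star_mult pev_commute)

lemma poly_of_pCons: "poly_of (pCons c P) a = c *\<^sub>R 1 + a * poly_of P a"
proof -
  have eq: "poly_of Q a = (\<Sum>i\<le>n. coeff Q i *\<^sub>R a ^ i)" if "degree Q \<le> n" for Q n
    unfolding poly_of_def using that
    by (intro sum.mono_neutral_left) (auto simp: coeff_eq_0)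
  show ?thesis
    unfolding eq[OF degree_pCons_le[of c P]] eq[OF order_refl, of P] sum.atMost_Suc_shift
    by (simp add: sum_distrib_left)
qed

lemma pev_cpoly: "pev a (cpoly P) = poly_of P a"
  by (induction P) (simp_all add: poly_of_pCons map_poly_pCons scaleC_of_real poly_of_def[of 0])

lemma sa_calculus_pev:
  assumes "star a = a"
  shows "sa_calculus UNIV norm (*) 1 (pev a)"
proof
  show "(norm (pev a p))\<^sup>2 \<le> norm (pev a (map_poly cnj p * p))" for p
    by (simp only: pev_mult star_pev[OF assms, symmetric] cstar_identity order_refl)
next
  fix s :: "nat \<Rightarrow> 'a" assume "\<forall>e>0. \<exists>N. \<forall>i\<ge>N. \<forall>j\<ge>N. norm (s i - s j) < e"
  then have "Cauchy s" unfolding Cauchy_def dist_norm by blast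
  then obtain l where "s \<longlonglongrightarrow> l" unfolding Cauchy_convergent_iff convergent_def by blast
  then have "(\<lambda>m. norm (s m - l)) \<longlonglongrightarrow> 0" by (simp add: LIM_zero tendsto_norm_zero)
  then show "\<exists>l\<in>UNIV. (\<lambda>m. norm (s m - l)) \<longlonglongrightarrow> 0" by blast
qed (simp_all add: norm_triangle_ineq norm_mult_ineq algebra_simps pev_add pev_mult pev_one pev_smult norm_scaleC)

lemma pev_linear: "pev a [:- c, 1:] = a - c *\<^sub>C 1"
  by (simp add: scaleC_minus_left)

section \<open>Real spectrum and calculus of a self-adjoint element\<close>

definition rspec :: "'a::cstar_algebra \<Rightarrow> real set" where
  "rspec a = {t. complex_of_real t \<in> spectrum a}"

context
  fixes a :: "'a::cstar_algebra"
  assumes sa: "star a = a"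
begin

interpretation A: sa_calculus UNIV norm "(*)" 1 "pev a"
  using sa by (rule sa_calculus_pev)

lemma spectrum_spec: "spectrum a = A.spec"
  unfolding spectrum_def A.spec_def pev_linear by simp

lemma rspec_eq: "rspec a = A.apx_spec"
  unfolding rspec_def spectrum_spec by (rule A.real_spec)

lemma spectrum_rspec: "spectrum a = complex_of_real ` rspec a"
  unfolding rspec_eq spectrum_spec by (rule A.spec_eq)

lemma compact_rspec: "compact (rspec a)"
  unfolding rspec_eq by (rule A.compact_apx_spec)

lemma rspec_nonempty: "rspec a \<noteq> {}"
  unfolding rspec_eq by (rule A.apx_spec_nonempty) (simp add: pev_one)

lemma norm_poly_of_le: "0 \<le> M \<Longrightarrow> (\<And>t. t \<in> rspec a \<Longrightarrow> \<bar>poly P t\<bar> \<le> M) \<Longrightarrow> norm (poly_of P a) \<le> M"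
  unfolding rspec_eq pev_cpoly[symmetric] by (rule A.N_le_sup)

lemma rspec_poly_le: "t \<in> rspec a \<Longrightarrow> \<bar>poly P t\<bar> \<le> norm (poly_of P a)"
  unfolding rspec_eq using A.apx_spec_poly_le[of t "cpoly P"]
  unfolding pev_cpoly poly_map_poly_of_real norm_of_real .

lemma cfc_close:
  assumes "continuous_on (rspec a) f" "0 \<le> M" "\<And>t. t \<in> rspec a \<Longrightarrow> \<bar>poly P t - f t\<bar> \<le> M"
  shows "norm (poly_of P a - cfc f a) \<le> M"
proof (rule A.calculus[OF assms(1)[unfolded rspec_eq]], unfold pev_cpoly rspec_eq[symmetric])
  fix U
  assume U: "\<And>p :: nat \<Rightarrow> real poly. uniform_limit (rspec a) (\<lambda>m. poly (p m)) f sequentially \<Longrightarrow>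
        (\<lambda>m. norm (poly_of (p m) a - U)) \<longlonglongrightarrow> 0"
    "\<And>V. V \<in> UNIV \<Longrightarrow> (\<And>p :: nat \<Rightarrow> real poly. uniform_limit (rspec a) (\<lambda>m. poly (p m)) f sequentially \<Longrightarrow>
        (\<lambda>m. norm (poly_of (p m) a - V)) \<longlonglongrightarrow> 0) \<Longrightarrow> V = U"
    "\<And>P M. 0 \<le> M \<Longrightarrow> (\<And>t. t \<in> rspec a \<Longrightarrow> \<bar>poly P t - f t\<bar> \<le> M) \<Longrightarrow> norm (poly_of P a - U) \<le> M"
  have "cfc f a = U"
    unfolding cfc_def rspec_def[symmetric]
  proof (rule the_equality)
    show "\<forall>p :: nat \<Rightarrow> real poly. uniform_limit (rspec a) (\<lambda>m. poly (p m)) f sequentially \<longrightarrow>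
        (\<lambda>m. poly_of (p m) a) \<longlonglongrightarrow> U"
      using U(1) by (simp add: tendsto_norm_zero_iff LIM_zero_iff)
    show "V = U" if V: "\<forall>p :: nat \<Rightarrow> real poly. uniform_limit (rspec a) (\<lambda>m. poly (p m)) f sequentially \<longrightarrow>
        (\<lambda>m. poly_of (p m) a) \<longlonglongrightarrow> V" for V
    proof (rule U(2)[OF UNIV_I])
      show "(\<lambda>m. norm (poly_of (p m) a - V)) \<longlonglongrightarrow> 0"
        if "uniform_limit (rspec a) (\<lambda>m. poly (p m)) f sequentially" for p :: "nat \<Rightarrow> real poly"
        using V that by (simp add: tendsto_norm_zero_iff LIM_zero_iff)
    qed
  qed
  then show ?thesis using U(3)[OF assms(2,3)] by simp
qed

lemma star_poly_of: "star (poly_of P a) = poly_of P a"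
  unfolding pev_cpoly[symmetric] star_pev[OF sa] by (simp add: map_poly_map_poly o_def)

lemma cstar_pos_iff_rspec: "cstar_pos a \<longleftrightarrow> rspec a \<subseteq> {0..}"
  unfolding cstar_pos_def spectrum_rspec inj_image_subset_iff[OF inj_of_real]
  using sa by simp

end

section \<open>The cone of positive elements\<close>

lemma poly_of_simps:
  "poly_of (P + Q) a = poly_of P a + poly_of Q a" "poly_of (P * Q) a = poly_of P a * poly_of Q a"
  "poly_of (P - Q) a = poly_of P a - poly_of Q a" "poly_of (smult r P) a = r *\<^sub>R poly_of P a"
  "poly_of 0 a = 0" "poly_of [:0, 1:] a = a" "poly_of [:r:] a = r *\<^sub>R 1"
proof -
  have "pev a (- p) = - pev a p" for p using pev_add[of a p "- p"] by (simp add: eq_neg_iff_add_eq_0 add.commute)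
  then have d: "pev a (p - q) = pev a p - pev a q" for p q using pev_add[of a p "- q"] by simp
  show "poly_of (P + Q) a = poly_of P a + poly_of Q a" "poly_of (P * Q) a = poly_of P a * poly_of Q a"
    "poly_of (P - Q) a = poly_of P a - poly_of Q a" "poly_of (smult r P) a = r *\<^sub>R poly_of P a"
    by (simp_all add: pev_cpoly[symmetric] cpoly_simps pev_add pev_mult d pev_smult scaleC_of_real)
  show 0: "poly_of 0 a = 0" by (simp add: poly_of_def)
  show "poly_of [:0, 1:] a = a" "poly_of [:r:] a = r *\<^sub>R 1" by (simp_all add: poly_of_pCons 0)
qed

lemma cstar_pos_star: "cstar_pos a \<Longrightarrow> star a = a"
  by (simp add: cstar_pos_def)

text \<open>For |t| \<le> r the conditions 0 \<le> t and |r - t| \<le> r agree. The norm condition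
  makes closure of the positive cone under sums and limits visible, which the definition by spectra
  hides.\<close>

lemma cstar_pos_iff_norm:
  assumes sa: "star a = a" and r: "norm a \<le> r"
  shows "cstar_pos a \<longleftrightarrow> norm (r *\<^sub>R 1 - a) \<le> r"
proof -
  have P: "poly_of [:r, -1:] a = r *\<^sub>R 1 - a" by (simp add: poly_of_pCons poly_of_simps)
  have r0: "r \<ge> 0" using r norm_ge_zero order_trans by blast
  have bd: "\<bar>t\<bar> \<le> r" if "t \<in> rspec a" for t
    using rspec_poly_le[OF sa that, of "[:0, 1:]"] r by (simp add: poly_of_simps)
  show ?thesis
  proof
    assume "cstar_pos a"
    then have "\<bar>poly [:r, -1:] t\<bar> \<le> r" if "t \<in> rspec a" for t
      using bd[OF that] that unfolding cstar_pos_iff_rspec[OF sa] by auto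
    then show "norm (r *\<^sub>R 1 - a) \<le> r"
      using norm_poly_of_le[OF sa r0, of "[:r, -1:]"] P by simp
  next
    assume "norm (r *\<^sub>R 1 - a) \<le> r"
    then have "\<bar>r - t\<bar> \<le> r" if "t \<in> rspec a" for t
      using rspec_poly_le[OF sa that, of "[:r, -1:]"] P by simp
    then show "cstar_pos a" unfolding cstar_pos_iff_rspec[OF sa] by force
  qed
qed

text \<open>The part of the spectral mapping theorem that concerns positivity. The norm criterion
  reduces it to r - P on the spectrum of a, so the spectrum of P(a) is never computed.\<close>

lemma cstar_pos_poly_of_iff:
  assumes sa: "star a = a"
  shows "cstar_pos (poly_of P a) \<longleftrightarrow> (\<forall>t\<in>rspec a. 0 \<le> poly P t)"
proof -
  define r where "r = norm (poly_of P a)"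
  have P: "poly_of ([:r:] - P) a = r *\<^sub>R 1 - poly_of P a" by (simp add: poly_of_simps)
  have bd: "\<bar>poly P t\<bar> \<le> r" if "t \<in> rspec a" for t
    unfolding r_def by (rule rspec_poly_le[OF sa that])
  have iff: "cstar_pos (poly_of P a) \<longleftrightarrow> norm (r *\<^sub>R 1 - poly_of P a) \<le> r"
    using cstar_pos_iff_norm[OF star_poly_of[OF sa]] by (simp add: r_def)
  show ?thesis
  proof
    assume "cstar_pos (poly_of P a)"
    then have "\<bar>r - poly P t\<bar> \<le> r" if "t \<in> rspec a" for t
      using rspec_poly_le[OF sa that, of "[:r:] - P"] unfolding iff P by simp
    then show "\<forall>t\<in>rspec a. 0 \<le> poly P t" by force
  next
    assume *: "\<forall>t\<in>rspec a. 0 \<le> poly P t"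
    have "norm (poly_of ([:r:] - P) a) \<le> r"
    proof (rule norm_poly_of_le[OF sa])
      show "0 \<le> r" by (simp add: r_def)
      show "\<bar>poly ([:r:] - P) t\<bar> \<le> r" if "t \<in> rspec a" for t
        using bd[OF that] * that by force
    qed
    then show "cstar_pos (poly_of P a)" unfolding iff P .
  qed
qed

lemma cstar_pos_add:
  assumes "cstar_pos a" "cstar_pos b"
  shows "cstar_pos (a + b)"
proof -
  have sa: "star a = a" "star b = b" using assms by (simp_all add: cstar_pos_star)
  have "norm (norm a *\<^sub>R 1 - a) \<le> norm a" "norm (norm b *\<^sub>R 1 - b) \<le> norm b"
    using assms sa cstar_pos_iff_norm by blast+
  then have "norm ((norm a + norm b) *\<^sub>R 1 - (a + b)) \<le> norm a + norm b"
    using norm_triangle_ineq[of "norm a *\<^sub>R 1 - a" "norm b *\<^sub>R 1 - b"] by (simp add: algebra_simps)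
  then show ?thesis
    using sa by (subst cstar_pos_iff_norm[of _ "norm a + norm b"]) (auto simp: star_add norm_triangle_ineq)
qed

lemma cstar_pos_poly_of: "star a = a \<Longrightarrow> (\<And>t. t \<in> rspec a \<Longrightarrow> 0 \<le> poly P t) \<Longrightarrow> cstar_pos (poly_of P a)"
  by (simp add: cstar_pos_poly_of_iff)

lemma cstar_pos_scaleR:
  assumes "cstar_pos a" "0 \<le> r"
  shows "cstar_pos (r *\<^sub>R a)"
proof -
  have sa: "star a = a" using assms by (simp add: cstar_pos_star)
  have "cstar_pos (poly_of [:0, r:] a)"
    using assms sa by (intro cstar_pos_poly_of) (auto simp: cstar_pos_iff_rspec)
  then show ?thesis by (simp add: poly_of_pCons poly_of_simps)
qed

lemma cstar_pos_scaleR_1: "0 \<le> r \<Longrightarrow> cstar_pos (r *\<^sub>R (1::'a::cstar_algebra))"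
  using cstar_pos_poly_of[of "0::'a" "[:r:]"] by (simp add: poly_of_simps)

lemma cstar_pos_1: "cstar_pos (1::'a::cstar_algebra)"
  using cstar_pos_scaleR_1[of 1] by simp

lemma cstar_pos_0: "cstar_pos (0::'a::cstar_algebra)"
  using cstar_pos_scaleR_1[of 0] by simp

lemma cstar_pos_sum: "(\<And>i. i \<in> A \<Longrightarrow> cstar_pos (g i)) \<Longrightarrow> cstar_pos (sum g A)"
  by (induction A rule: infinite_finite_induct) (simp_all add: cstar_pos_0 cstar_pos_add)

lemma cstar_pos_limit:
  assumes "\<And>m. cstar_pos (s m)" "s \<longlonglongrightarrow> l"
  shows "cstar_pos l"
proof -
  have sa: "star (s m) = s m" for m using assms by (simp add: cstar_pos_star)
  have "star l = l"
    using tendsto_star[OF assms(2)] assms(2) unfolding sa by (rule LIMSEQ_unique)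
  \<comment> \<open>A common norm bound for all terms lets the norm criterion pass to the
    limit.\<close>
  obtain K where K: "\<And>m. norm (s m) \<le> K"
    using Bseq_def convergent_imp_Bseq[OF convergentI[OF assms(2)]] by blast
  have "norm l \<le> K"
    using K by (intro LIMSEQ_le_const2[OF tendsto_norm[OF assms(2)]]) blast
  have "norm (K *\<^sub>R 1 - s m) \<le> K" for m
    using assms(1) sa K cstar_pos_iff_norm by blast
  then have "norm (K *\<^sub>R 1 - l) \<le> K"
    by (intro LIMSEQ_le_const2[OF tendsto_norm[OF tendsto_diff[OF tendsto_const assms(2)]]]) blast
  then show ?thesis using cstar_pos_iff_norm \<open>star l = l\<close> \<open>norm l \<le> K\<close> by blast
qed

lemma cstar_pos_square: "star a = a \<Longrightarrow> cstar_pos (a * a)"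
  using cstar_pos_poly_of[of a "[:0, 1:] * [:0, 1:]"] unfolding poly_of_simps by simp

lemma cstar_pos_norm_diff: "star a = a \<Longrightarrow> norm a \<le> r \<Longrightarrow> cstar_pos (r *\<^sub>R 1 - a)"
proof -
  assume a: "star a = a" "norm a \<le> r"
  have "cstar_pos (poly_of [:r, -1:] a)"
  proof (rule cstar_pos_poly_of[OF a(1)])
    show "0 \<le> poly [:r, -1:] t" if "t \<in> rspec a" for t
      using rspec_poly_le[OF a(1) that, of "[:0, 1:]"] a(2) by (simp add: poly_of_simps)
  qed
  then show ?thesis by (simp add: poly_of_pCons poly_of_simps)
qed

lemma rspec_bounds:
  assumes "star a = a" "cstar_pos (a - l *\<^sub>R 1)" "cstar_pos (u *\<^sub>R 1 - a)" "t \<in> rspec a"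
  shows "l \<le> t" "t \<le> u"
proof -
  have "poly_of [:- l, 1:] a = a - l *\<^sub>R 1" "poly_of [:u, -1:] a = u *\<^sub>R 1 - a"
    by (simp_all add: poly_of_pCons poly_of_simps)
  then have "\<forall>t\<in>rspec a. 0 \<le> poly [:- l, 1:] t" "\<forall>t\<in>rspec a. 0 \<le> poly [:u, -1:] t"
    using assms by (simp_all only: cstar_pos_poly_of_iff[OF assms(1), symmetric])
  then show "l \<le> t" "t \<le> u" using assms(4) by auto
qed

lemma norm_le_of_pos:
  assumes "cstar_pos a" "cstar_pos (r *\<^sub>R 1 - a)"
  shows "norm a \<le> r"
proof -
  have sa: "star a = a" using assms by (simp add: cstar_pos_star)
  have b: "0 \<le> t" "t \<le> r" if "t \<in> rspec a" for t
    using rspec_bounds[of a 0 r t] assms sa that by auto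
  obtain t where "t \<in> rspec a" using rspec_nonempty[OF sa] by blast
  then have "0 \<le> r" using b by force
  then show ?thesis using norm_poly_of_le[OF sa, of r "[:0, 1:]"] b by (simp add: poly_of_simps)
qed

section \<open>Positivity of products of an element with its adjoint\<close>

text \<open>If u inverts ba - c, then c^-1 (a u b - 1) inverts ab - c, as a comparison of the two
  Neumann series suggests.\<close>

lemma spectrum_mult_commute:
  assumes "c \<noteq> 0" "c \<in> spectrum (a * b)"
  shows "c \<in> spectrum (b * a :: 'a::cstar_algebra)"
proof (rule ccontr)
  let ?c1 = "c *\<^sub>C (1::'a)"
  have comm: "x * ?c1 = c *\<^sub>C x" "?c1 * x = c *\<^sub>C x" for x
    by (simp_all add: mult_scaleC_left mult_scaleC_right)
  assume "c \<notin> spectrum (b * a)"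
  then obtain u where u: "u * (b * a - ?c1) = 1" "(b * a - ?c1) * u = 1" unfolding spectrum_def by blast
  define w where "w = inverse c *\<^sub>C (a * u * b - 1)"
  have u': "u * (b * a) = 1 + c *\<^sub>C u" "b * a * u = 1 + c *\<^sub>C u"
    using u comm by (simp_all add: algebra_simps)
  have "(a * u * b - 1) * (a * b - ?c1) = ?c1"
  proof -
    have "a * u * b * (a * b) = a * (u * (b * a)) * b" by (simp only: mult.assoc)
    also have "\<dots> = a * b + c *\<^sub>C (a * u * b)"
      unfolding u' by (simp add: algebra_simps mult_scaleC_left mult_scaleC_right)
    finally show ?thesis by (simp add: left_diff_distrib right_diff_distrib comm scaleC_diff_right)
  qed
  moreover have "(a * b - ?c1) * (a * u * b - 1) = ?c1"
  proof -
    have "a * b * (a * u * b) = a * (b * a * u) * b" by (simp only: mult.assoc)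
    also have "\<dots> = a * b + c *\<^sub>C (a * u * b)"
      unfolding u' by (simp add: algebra_simps mult_scaleC_left mult_scaleC_right)
    finally show ?thesis by (simp add: left_diff_distrib right_diff_distrib comm scaleC_diff_right)
  qed
  ultimately have "w * (a * b - ?c1) = 1 \<and> (a * b - ?c1) * w = 1"
    using assms(1) by (simp add: w_def mult_scaleC_left mult_scaleC_right scaleC_scaleC)
  then show False using assms(2) unfolding spectrum_def by blast
qed

text \<open>Kaplansky's argument: if \<open>a = x\<^sup>*x\<close> had negative spectrum, cut \<open>x\<close> down to \<open>y = x g(a)\<close>, where the
  polynomial \<open>g\<close> approximates the negative part. Then \<open>y\<^sup>*y\<close> is almost negative, whereas
  \<open>y\<^sup>*y + yy\<^sup>*\<close> is a sum of squares and \<open>y\<^sup>*y\<close>, \<open>yy\<^sup>*\<close> have the same nonzero spectrum.\<close>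

theorem cstar_pos_star_mult: "cstar_pos (star x * (x :: 'a::cstar_algebra))"
proof -
  define a where "a = star x * x"
  have sa: "star a = a" by (simp add: a_def star_mult star_star)
  have "continuous_on (rspec a) (\<lambda>t. max (- t) 0)" by (intro continuous_intros)
  from Weierstrass_sequence[OF compact_rspec[OF sa] this]
  obtain g where g: "\<And>m t. t \<in> rspec a \<Longrightarrow> \<bar>poly (g m) t - max (- t) 0\<bar> \<le> inverse (real (Suc m))" by metis
  \<comment> \<open>At s > 0 in the spectrum g m is within 1/(m + 1) of 0, so s g(s)^2 is at most
    \<open>e m\<close>.\<close>
  define e where "e m = norm a * (inverse (real (Suc m)))\<^sup>2" for m
  have lower: "- e m \<le> t * (poly (g m) t)\<^sup>2" if t: "t \<in> rspec a" for m t
  proof -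
    define c where "c = poly_of (g m) a"
    define y where "y = x * c"
    define h where "h = [:0, 1:] * g m * g m"
    have sc: "star c = c" unfolding c_def using sa by (rule star_poly_of)
    have yy: "star y * y = poly_of h a"
    proof -
      have "star y * y = c * a * c" by (simp add: y_def star_mult sc a_def mult.assoc)
      also have "c * a = a * c"
        using poly_of_simps(2)[of "g m" "[:0, 1:]" a] poly_of_simps(2)[of "[:0, 1:]" "g m" a]
        unfolding c_def poly_of_simps mult.commute[of "g m"] by simp
      finally show ?thesis unfolding h_def poly_of_simps c_def .
    qed
    have "cstar_pos (poly_of ([:e m:] - h) a)"
    proof (rule cstar_pos_poly_of[OF sa])
      fix s assume s: "s \<in> rspec a"
      show "0 \<le> poly ([:e m:] - h) s"
      proof (cases "s \<le> 0")
        case True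
        then have "s * (poly (g m) s * poly (g m) s) \<le> 0" by (simp add: mult_nonpos_nonneg)
        moreover have "0 \<le> e m" by (simp add: e_def)
        ultimately show ?thesis by (simp add: h_def algebra_simps)
      next
        case False
        then have "\<bar>poly (g m) s\<bar> \<le> inverse (real (Suc m))" using g[OF s, of m] by simp
        then have "(poly (g m) s)\<^sup>2 \<le> (inverse (real (Suc m)))\<^sup>2" by (simp only: abs_le_square_iff[symmetric])
        moreover have "s \<le> norm a" using rspec_poly_le[OF sa s, of "[:0, 1:]"] by (simp add: poly_of_simps)
        ultimately have "s * (poly (g m) s)\<^sup>2 \<le> e m" unfolding e_def using False by (intro mult_mono) auto
        then show ?thesis by (simp add: h_def power2_eq_square algebra_simps)
      qed
    qed
    then have neg: "cstar_pos (e m *\<^sub>R 1 - star y * y)" by (simp add: yy poly_of_simps)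
    \<comment> \<open>\<open>u\<close> is twice the real part of y, and \<open>v\<close> is minus
      twice its imaginary part; both are self-adjoint.\<close>
    define u where "u = y + star y"
    define v where "v = \<i> *\<^sub>C (y - star y)"
    have "cstar_pos (u * u + v * v)"
      by (intro cstar_pos_add cstar_pos_square)
        (simp_all add: u_def v_def star_add star_scaleC star_diff star_star scaleC_minus_left scaleC_diff_right add.commute)
    moreover have "v * v = - ((y - star y) * (y - star y))"
      unfolding v_def mult_scaleC_left mult_scaleC_right scaleC_scaleC by (simp add: scaleC_minus_left)
    then have "u * u + v * v = 2 *\<^sub>R (star y * y + y * star y)"
      by (simp add: u_def algebra_simps scaleR_2)
    ultimately have "cstar_pos (2 *\<^sub>R (star y * y + y * star y))" by (simp only:)
    from cstar_pos_scaleR[OF this, of "1 / 2"] have "cstar_pos (star y * y + y * star y)"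
      by (simp del: scaleR_add_right)
    from cstar_pos_add[OF this neg] have pos: "cstar_pos (y * star y - (- e m) *\<^sub>R 1)" by (simp add: algebra_simps)
    have sy: "star (y * star y) = y * star y" by (simp add: star_mult star_star)
    have "0 \<le> poly ([:e m, 1:]) s" if "s \<in> rspec (y * star y)" for s
      using pos that cstar_pos_poly_of_iff[OF sy, of "[:e m, 1:]"] by (simp add: poly_of_pCons poly_of_simps add.commute)
    then have low: "- e m \<le> s" if "s \<in> rspec (y * star y)" for s using that by force
    have low2: "- e m \<le> s" if "s \<in> rspec (star y * y)" for s
    proof (cases "s = 0")
      case False
      then show ?thesis
        using that low[of s] spectrum_mult_commute[of "complex_of_real s" "star y" y] by (simp add: rspec_def)
    qed (simp add: e_def)
    have sh: "star (poly_of h a) = poly_of h a" using sa by (rule star_poly_of)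
    have "cstar_pos (poly_of [:e m, 1:] (poly_of h a))"
      using low2 by (intro cstar_pos_poly_of[OF sh]) (force simp: yy)
    then have "cstar_pos (poly_of ([:e m:] + h) a)" by (simp add: poly_of_pCons poly_of_simps)
    then have "0 \<le> poly ([:e m:] + h) t" using cstar_pos_poly_of_iff[OF sa] t by blast
    then show ?thesis by (simp add: h_def power2_eq_square algebra_simps)
  qed
  have "0 \<le> t" if t: "t \<in> rspec a" for t
  proof (rule ccontr)
    assume "\<not> 0 \<le> t"
    have "(\<lambda>m. poly (g m) t - max (- t) 0) \<longlonglongrightarrow> 0"
      using g[OF t] by (intro Lim_null_comparison[OF _ LIMSEQ_inverse_real_of_nat]) simp
    moreover have "max (- t) 0 = - t" using \<open>\<not> 0 \<le> t\<close> by simp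
    ultimately have "(\<lambda>m. poly (g m) t) \<longlonglongrightarrow> - t" by (simp only: LIM_zero_iff)
    then have "(\<lambda>m. t * (poly (g m) t)\<^sup>2 + e m) \<longlonglongrightarrow> t * (- t)\<^sup>2 + norm a * 0\<^sup>2"
      unfolding e_def by (intro tendsto_intros LIMSEQ_inverse_real_of_nat)
    moreover have "0 \<le> t * (poly (g m) t)\<^sup>2 + e m" for m using lower[OF t, of m] by simp
    ultimately have "0 \<le> t * (- t)\<^sup>2 + norm a * 0\<^sup>2" by (intro LIMSEQ_le_const) auto
    then show False using \<open>\<not> 0 \<le> t\<close> by (simp add: zero_le_mult_iff)
  qed
  then show ?thesis unfolding a_def[symmetric] cstar_pos_iff_rspec[OF sa] by auto
qed

text \<open>With polynomials c in w whose squares tend to w, the element is the limit of star (c u)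
  * (c u).\<close>

lemma cstar_pos_conj:
  assumes "cstar_pos w"
  shows "cstar_pos (star u * w * u)"
proof -
  have sa: "star w = w" using assms by (simp add: cstar_pos_star)
  have pos: "0 \<le> t" if "t \<in> rspec w" for t using assms that cstar_pos_iff_rspec[OF sa] by auto
  obtain g :: "nat \<Rightarrow> real poly" and M where M: "0 \<le> M"
    and g: "\<And>m t. t \<in> rspec w \<Longrightarrow> \<bar>poly (g m) t * poly (g m) t - t\<bar> \<le> inverse (real (Suc m)) * M"
    by (rule sqrt_approximation[OF compact_rspec[OF sa] continuous_on_id pos]) (assumption, rule that)
  define c where "c m = poly_of (g m) w" for m
  have sc: "star (c m) = c m" for m unfolding c_def using sa by (rule star_poly_of)
  have "norm (poly_of (g m * g m - [:0, 1:]) w) \<le> inverse (real (Suc m)) * M" for m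
    using g M by (intro norm_poly_of_le[OF sa]) simp_all
  then have "norm (c m * c m - w) \<le> inverse (real (Suc m)) * M" for m
    unfolding poly_of_simps c_def .
  then have "(\<lambda>m. c m * c m - w) \<longlonglongrightarrow> 0"
    by (intro Lim_null_comparison[OF _ tendsto_mult_left_zero[OF LIMSEQ_inverse_real_of_nat, of M]]) simp
  then have "(\<lambda>m. c m * c m) \<longlonglongrightarrow> w" by (rule LIM_zero_cancel)
  then have lim: "(\<lambda>m. star u * (c m * c m) * u) \<longlonglongrightarrow> star u * w * u"
    by (intro tendsto_intros)
  have "star u * (c m * c m) * u = star (c m * u) * (c m * u)" for m
    by (simp add: star_mult sc mult.assoc)
  then have "cstar_pos (star u * (c m * c m) * u)" for m by (simp only: cstar_pos_star_mult)
  then show ?thesis using lim by (rule cstar_pos_limit)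
qed

section \<open>Separating states\<close>

definition convex_cone :: "'a::real_vector set \<Rightarrow> bool" where
  "convex_cone Q \<longleftrightarrow> 0 \<in> Q \<and> (\<forall>x\<in>Q. \<forall>y\<in>Q. x + y \<in> Q) \<and> (\<forall>x\<in>Q. \<forall>r\<ge>0. r *\<^sub>R x \<in> Q)"

lemma convex_coneD:
  assumes "convex_cone Q"
  shows "0 \<in> Q" "x \<in> Q \<Longrightarrow> y \<in> Q \<Longrightarrow> x + y \<in> Q" "x \<in> Q \<Longrightarrow> 0 \<le> r \<Longrightarrow> r *\<^sub>R x \<in> Q"
  using assms unfolding convex_cone_def by blast+

definition adjoin :: "'a::real_vector \<Rightarrow> 'a set \<Rightarrow> 'a set" where
  "adjoin a Q = {q + t *\<^sub>R a | q t. q \<in> Q \<and> 0 \<le> t}"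

lemma adjoin:
  assumes "convex_cone Q"
  shows "convex_cone (adjoin a Q)" "Q \<subseteq> adjoin a Q" "a \<in> adjoin a Q"
proof -
  note Q = convex_coneD[OF assms]
  have I: "q + t *\<^sub>R a \<in> adjoin a Q" if "q \<in> Q" "0 \<le> t" for q t
    using that unfolding adjoin_def by blast
  have "x + y \<in> adjoin a Q" if xy: "x \<in> adjoin a Q" "y \<in> adjoin a Q" for x y
  proof -
    obtain p s where "p \<in> Q" "0 \<le> s" "x = p + s *\<^sub>R a" using xy(1) unfolding adjoin_def by blast
    moreover obtain q t where "q \<in> Q" "0 \<le> t" "y = q + t *\<^sub>R a" using xy(2) unfolding adjoin_def by blast
    ultimately show ?thesis using I[of "p + q" "s + t"] Q(2) by (simp add: algebra_simps)
  qed
  moreover have "r *\<^sub>R x \<in> adjoin a Q" if xr: "x \<in> adjoin a Q" "0 \<le> r" for x r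
  proof -
    obtain q t where "q \<in> Q" "0 \<le> t" "x = q + t *\<^sub>R a" using xr unfolding adjoin_def by blast
    then show ?thesis using I[of "r *\<^sub>R q" "r * t"] Q(3) xr(2) by (simp add: algebra_simps)
  qed
  ultimately show "convex_cone (adjoin a Q)"
    using I[OF Q(1), of 0] unfolding convex_cone_def by simp
  show "Q \<subseteq> adjoin a Q" using I[of _ 0] by auto
  show "a \<in> adjoin a Q" using I[OF Q(1), of 1] by simp
qed

text \<open>A maximal cone Q that contains Q0 and misses -e is total: it contains a or -a for every
  a. So a - r e leaves Q at a single value of r, and this value is linear in a; \<open>unit\<close>
  makes it finite.\<close>

theorem cone_functional:
  fixes Q0 :: "'a::real_vector set" and e :: 'a
  assumes Q0: "convex_cone Q0" "- e \<notin> Q0" and unit: "\<And>a. \<exists>r. a + r *\<^sub>R e \<in> Q0"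
  obtains \<phi> :: "'a \<Rightarrow> real" where "linear \<phi>" "\<phi> e = 1" "\<And>a. a \<in> Q0 \<Longrightarrow> 0 \<le> \<phi> a"
proof -
  let ?A = "{Q. convex_cone Q \<and> Q0 \<subseteq> Q \<and> - e \<notin> Q}"
  have "\<exists>M\<in>?A. \<forall>X\<in>?A. M \<subseteq> X \<longrightarrow> X = M"
  proof (rule subset_Zorn_nonempty)
    show "?A \<noteq> {}" using Q0 by blast
    fix \<C> assume ne: "\<C> \<noteq> {}" and chain: "subset.chain ?A \<C>"
    have cone: "convex_cone Q" if "Q \<in> \<C>" for Q using chain that unfolding subset.chain_def by auto
    have "x + y \<in> \<Union>\<C>" if xy: "x \<in> \<Union>\<C>" "y \<in> \<Union>\<C>" for x y
    proof -
      obtain X Y where "X \<in> \<C>" "x \<in> X" "Y \<in> \<C>" "y \<in> Y" using xy by blast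
      moreover from this have "X \<subseteq> Y \<or> Y \<subseteq> X" using chain unfolding subset_chain_def by blast
      ultimately show ?thesis using convex_coneD(2)[OF cone] by (meson UnionI subsetD)
    qed
    moreover have "r *\<^sub>R x \<in> \<Union>\<C>" if "x \<in> \<Union>\<C>" "0 \<le> r" for x r
      using that convex_coneD(3)[OF cone] by blast
    moreover have "0 \<in> \<Union>\<C>" using ne convex_coneD(1)[OF cone] by blast
    ultimately have "convex_cone (\<Union>\<C>)" unfolding convex_cone_def by blast
    moreover have "Q0 \<subseteq> \<Union>\<C>" "- e \<notin> \<Union>\<C>" using ne chain unfolding subset.chain_def by blast+
    ultimately show "\<Union>\<C> \<in> ?A" by blast
  qed
  then obtain Q where "Q \<in> ?A" and max': "\<forall>X\<in>?A. Q \<subseteq> X \<longrightarrow> X = Q" by (rule bexE)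
  then have Q: "convex_cone Q" "Q0 \<subseteq> Q" "- e \<notin> Q" by auto
  have max: "X = Q" if "convex_cone X" "- e \<notin> X" "Q \<subseteq> X" for X
    using that Q(2) by (intro max'[rule_format]) auto
  note cone = convex_coneD[OF Q(1)]
  have neg: "- (r *\<^sub>R e) \<notin> Q" if "r > 0" for r
    using cone(3)[of "- (r *\<^sub>R e)" "inverse r"] that Q(3) by auto
  have total: "a \<in> Q \<or> - a \<in> Q" for a
  proof (rule ccontr)
    assume *: "\<not> ?thesis"
    have mem: "- e \<in> adjoin b Q" if "b \<notin> Q" for b
      using max[OF adjoin(1)[OF Q(1)] _ adjoin(2)[OF Q(1)], of b] adjoin(3)[OF Q(1), of b] that by blast
    obtain q t where q: "q \<in> Q" "0 \<le> t" "- e = q + t *\<^sub>R a"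
      using mem[of a] * unfolding adjoin_def by blast
    obtain q' t' where q': "q' \<in> Q" "0 \<le> t'" "- e = q' + t' *\<^sub>R (- a)"
      using mem[of "- a"] * unfolding adjoin_def by blast
    have "t \<noteq> 0" using q Q(3) by auto
    \<comment> \<open>Eliminating a from the two representations of -e puts a negative multiple of e
      into Q.\<close>
    have "- ((t' + t) *\<^sub>R e) = t' *\<^sub>R (- e) + t *\<^sub>R (- e)" by (simp add: algebra_simps)
    also have "\<dots> = t' *\<^sub>R (q + t *\<^sub>R a) + t *\<^sub>R (q' + t' *\<^sub>R (- a))" using q(3) q'(3) by metis
    also have "\<dots> = t' *\<^sub>R q + t *\<^sub>R q'" by (simp add: algebra_simps)
    finally have "- ((t' + t) *\<^sub>R e) \<in> Q" using cone q q' by simp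
    then show False using neg[of "t' + t"] q(2) q'(2) \<open>t \<noteq> 0\<close> by simp
  qed
  have e: "e \<in> Q" using total[of e] Q(3) by blast
  define L where "L a = {r. a - r *\<^sub>R e \<in> Q}" for a
  define \<phi> where "\<phi> a = Sup (L a)" for a
  have L_ne: "L a \<noteq> {}" for a
  proof -
    obtain r where "a + r *\<^sub>R e \<in> Q0" using unit by blast
    then have "- r \<in> L a" using Q(2) by (auto simp: L_def)
    then show ?thesis by blast
  qed
  have L_bdd: "bdd_above (L a)" for a
  proof -
    obtain r where r: "- a + r *\<^sub>R e \<in> Q0" using unit by blast
    have "s \<le> r" if "s \<in> L a" for s
    proof (rule ccontr)
      assume "\<not> s \<le> r"
      moreover have "(a - s *\<^sub>R e) + (- a + r *\<^sub>R e) \<in> Q" using that r Q(2) cone(2) unfolding L_def by blast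
      then have "- ((s - r) *\<^sub>R e) \<in> Q" by (simp add: algebra_simps)
      ultimately show False using neg[of "s - r"] by simp
    qed
    then show ?thesis by (rule bdd_aboveI)
  qed
  have below: "a - r *\<^sub>R e \<in> Q" if r: "r < \<phi> a" for a r
  proof -
    obtain s where s: "s \<in> L a" "r < s" using r less_cSup_iff[OF L_ne L_bdd] unfolding \<phi>_def by blast
    have "(a - s *\<^sub>R e) + (s - r) *\<^sub>R e \<in> Q" using s e cone by (simp add: L_def)
    then show ?thesis by (simp add: algebra_simps)
  qed
  have le: "r \<le> \<phi> a" if "a - r *\<^sub>R e \<in> Q" for a r
    unfolding \<phi>_def using that L_bdd by (intro cSup_upper) (auto simp: L_def)
  have above: "r *\<^sub>R e - a \<in> Q" if "\<phi> a < r" for a r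
    using total[of "a - r *\<^sub>R e"] le[of a r] that by auto
  \<comment> \<open>A value of \<open>\<phi>\<close> is recognised up to every d > 0, which avoids
    asking whether the supremum is attained.\<close>
  have eqI: "\<phi> a = s" if "\<And>d. d > 0 \<Longrightarrow> a - (s - d) *\<^sub>R e \<in> Q" "\<And>d. d > 0 \<Longrightarrow> (s + d) *\<^sub>R e - a \<in> Q" for a s
  proof (rule antisym)
    show "s \<le> \<phi> a"
    proof (rule field_le_epsilon)
      show "s \<le> \<phi> a + d" if "0 < d" for d using le[OF \<open>\<And>d. d > 0 \<Longrightarrow> a - (s - d) *\<^sub>R e \<in> Q\<close>[OF that]] by simp
    qed
    show "\<phi> a \<le> s"
    proof (rule ccontr)
      assume "\<not> \<phi> a \<le> s"
      \<comment> \<open>With \<phi> a = s + 3 d the two members of Q below add up to -(d/2)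
        e.\<close>
      define d where "d = (\<phi> a - s) / 3"
      have d: "d > 0" "\<phi> a - 2 * d < \<phi> a" using \<open>\<not> \<phi> a \<le> s\<close> by (simp_all add: d_def)
      have "((s + d / 2) *\<^sub>R e - a) + (a - (\<phi> a - 2 * d) *\<^sub>R e) \<in> Q"
        using that(2)[of "d / 2"] d(1) by (rule_tac cone(2)[OF _ below[OF d(2)]]) simp
      moreover have "((s + d / 2) *\<^sub>R e - a) + (a - (\<phi> a - 2 * d) *\<^sub>R e) = (s + d / 2 - (\<phi> a - 2 * d)) *\<^sub>R e"
        by (simp only: scaleR_left_diff_distrib scaleR_left_distrib) simp
      moreover have "s + d / 2 - (\<phi> a - 2 * d) = - (d / 2)" by (simp add: d_def field_simps)
      ultimately show False using neg[of "d / 2"] d by simp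
    qed
  qed
  have add: "\<phi> (a + b) = \<phi> a + \<phi> b" for a b
  proof (rule eqI)
    fix d :: real assume "d > 0"
    then have "(a - (\<phi> a - d / 2) *\<^sub>R e) + (b - (\<phi> b - d / 2) *\<^sub>R e) \<in> Q"
      and "((\<phi> a + d / 2) *\<^sub>R e - a) + ((\<phi> b + d / 2) *\<^sub>R e - b) \<in> Q"
      by (simp_all add: cone(2)[OF below below] cone(2)[OF above above])
    moreover have "(a - (\<phi> a - d / 2) *\<^sub>R e) + (b - (\<phi> b - d / 2) *\<^sub>R e) = a + b - (\<phi> a + \<phi> b - d) *\<^sub>R e"
      and "((\<phi> a + d / 2) *\<^sub>R e - a) + ((\<phi> b + d / 2) *\<^sub>R e - b) = (\<phi> a + \<phi> b + d) *\<^sub>R e - (a + b)"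
      by (simp_all add: algebra_simps flip: scaleR_add_left)
    ultimately show "a + b - (\<phi> a + \<phi> b - d) *\<^sub>R e \<in> Q" "(\<phi> a + \<phi> b + d) *\<^sub>R e - (a + b) \<in> Q" by simp_all
  qed
  have zero: "\<phi> 0 = 0" using add[of 0 0] by simp
  have minus: "\<phi> (- a) = - \<phi> a" for a using add[of a "- a"] zero by simp
  have scale_pos: "\<phi> (r *\<^sub>R a) = r * \<phi> a" if r: "r > 0" for r a
  proof (rule eqI)
    fix d :: real assume "d > 0"
    then have "r *\<^sub>R (a - (\<phi> a - d / r) *\<^sub>R e) \<in> Q" "r *\<^sub>R ((\<phi> a + d / r) *\<^sub>R e - a) \<in> Q"
      using r by (simp_all add: cone(3)[OF below] cone(3)[OF above])
    then show "r *\<^sub>R a - (r * \<phi> a - d) *\<^sub>R e \<in> Q" "(r * \<phi> a + d) *\<^sub>R e - r *\<^sub>R a \<in> Q"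
      using r by (simp_all add: algebra_simps)
  qed
  have "\<phi> (r *\<^sub>R a) = r * \<phi> a" for r a
    using scale_pos[of r a] scale_pos[of "- r" a] minus[of "r *\<^sub>R a"] zero by (cases r "0::real" rule: linorder_cases) auto
  then have "linear \<phi>" using add by (intro linearI) auto
  moreover have "\<phi> e = 1"
    using e cone(1,3) by (rule_tac eqI) (simp_all add: scaleR_diff_left scaleR_add_left)
  moreover have "0 \<le> \<phi> a" if "a \<in> Q0" for a using le[of a 0] that Q(2) by auto
  ultimately show ?thesis by (rule that)
qed

section \<open>States of the algebra\<close>

lemma cstar_pos_scaleR_cancel: "0 < r \<Longrightarrow> cstar_pos (r *\<^sub>R a) \<Longrightarrow> cstar_pos a"
  using cstar_pos_scaleR[of "r *\<^sub>R a" "inverse r"] by simp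

text \<open>Adjoining -(c + \<epsilon>) to the cone \<open>P\<close> of elements with positive real
  part forces \<phi> c \<le> -\<epsilon>; the shift by \<epsilon> is what makes the inequality
  strict. Skew-adjoint elements lie in \<open>P\<close> together with their negatives, which gives
  \<phi> (star a) = \<phi> a. So \<phi> is the real part of a state.\<close>

theorem separating_state:
  fixes c :: "'a::cstar_algebra"
  assumes sa: "star c = c" and c: "\<not> cstar_pos c"
  obtains \<phi> :: "'a \<Rightarrow> real" where "linear \<phi>" "\<phi> 1 = 1" "\<And>a. cstar_pos a \<Longrightarrow> 0 \<le> \<phi> a"
    "\<And>a. \<phi> (star a) = \<phi> a" "\<And>a. \<bar>\<phi> a\<bar> \<le> norm a" "\<phi> c < 0"
proof -
  have "\<exists>\<epsilon>>0. \<not> cstar_pos (c + \<epsilon> *\<^sub>R 1)"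
  proof (rule ccontr)
    assume "\<nexists>\<epsilon>. \<epsilon> > 0 \<and> \<not> cstar_pos (c + \<epsilon> *\<^sub>R 1)"
    then have *: "cstar_pos (c + inverse (real (Suc m)) *\<^sub>R 1)" for m by simp
    have "(\<lambda>m. c + inverse (real (Suc m)) *\<^sub>R 1) \<longlonglongrightarrow> c + 0 *\<^sub>R 1"
      by (intro tendsto_intros LIMSEQ_inverse_real_of_nat)
    with * have "cstar_pos (c + 0 *\<^sub>R 1)" by (rule cstar_pos_limit)
    then show False using c by simp
  qed
  then obtain \<epsilon> where \<epsilon>: "\<epsilon> > 0" "\<not> cstar_pos (c + \<epsilon> *\<^sub>R 1)" by blast
  define P where "P = {a::'a. cstar_pos (a + star a)}"
  define d where "d = - (c + \<epsilon> *\<^sub>R 1)"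
  have P: "convex_cone P"
    unfolding convex_cone_def P_def
  proof (intro conjI ballI allI impI)
    show "0 \<in> {a::'a. cstar_pos (a + star a)}" by (simp add: cstar_pos_0)
    show "x + y \<in> {a::'a. cstar_pos (a + star a)}"
      if "x \<in> {a::'a. cstar_pos (a + star a)}" "y \<in> {a::'a. cstar_pos (a + star a)}" for x y :: 'a
      using cstar_pos_add[of "x + star x" "y + star y"] that by (simp add: star_add algebra_simps)
    show "r *\<^sub>R x \<in> {a::'a. cstar_pos (a + star a)}"
      if "x \<in> {a::'a. cstar_pos (a + star a)}" "0 \<le> r" for x :: 'a and r
      using cstar_pos_scaleR[of "x + star x" r] that by (simp add: star_scaleR algebra_simps)
  qed
  have P_sa: "a \<in> P \<longleftrightarrow> cstar_pos a" if "star a = a" for a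
    using cstar_pos_scaleR[of a 2] cstar_pos_scaleR_cancel[of 2 a] that by (auto simp: P_def scaleR_2)
  have unit: "a + norm a *\<^sub>R 1 \<in> P" for a
  proof -
    have "norm (- (a + star a)) \<le> 2 * norm a"
      using norm_triangle_ineq[of a "star a"] by (simp add: norm_star norm_minus_commute del: minus_add_distrib)
    then have "cstar_pos ((2 * norm a) *\<^sub>R 1 - (- (a + star a)))"
      by (intro cstar_pos_norm_diff) (simp_all add: star_minus star_add star_star star_diff)
    moreover have "(2 * norm a) *\<^sub>R 1 - (- (a + star a)) = (a + norm a *\<^sub>R 1) + star (a + norm a *\<^sub>R 1)"
    proof -
      have "(2 * norm a) *\<^sub>R 1 = norm a *\<^sub>R 1 + norm a *\<^sub>R (1::'a)" by (simp flip: scaleR_left_distrib)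
      then show ?thesis unfolding star_add star_scaleR star_1 by simp
    qed
    ultimately show ?thesis unfolding P_def by (simp only: mem_Collect_eq)
  qed
  define Q0 where "Q0 = adjoin d P"
  have not1: "- 1 \<notin> Q0"
  proof
    assume "- 1 \<in> Q0"
    \<comment> \<open>This representation makes t (c + \<epsilon>) = q + 1 positive. For t > 0 that
      contradicts the choice of \<epsilon>; for t = 0 it is -1 that would be positive.\<close>
    then obtain q t where q: "q \<in> P" "0 \<le> t" "- 1 = q + t *\<^sub>R d" unfolding Q0_def adjoin_def by blast
    have "t *\<^sub>R (c + \<epsilon> *\<^sub>R 1) = q + 1" using q(3) by (simp add: d_def algebra_simps eq_neg_iff_add_eq_0 add_eq_0_iff)
    moreover have "q + 1 \<in> P" 
      by (rule convex_coneD(2)[OF P q(1)]) (simp add: P_sa cstar_pos_1)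
    ultimately have *: "t *\<^sub>R (c + \<epsilon> *\<^sub>R 1) \<in> P" by simp
    show False
    proof (cases "t = 0")
      case True
      then have "- 1 \<in> P" using q by simp
      then have "cstar_pos (- 1 :: 'a)" by (subst (asm) P_sa) (simp_all add: star_minus)
      then have "cstar_pos ((- 1) *\<^sub>R 1 - (0::'a))" by simp
      from norm_le_of_pos[OF cstar_pos_0 this] show False by simp
    next
      case False
      have "cstar_pos (t *\<^sub>R (c + \<epsilon> *\<^sub>R 1))"
        using * by (subst (asm) P_sa) (simp_all add: star_scaleR star_add sa)
      moreover have "0 < t" using False q(2) by simp
      ultimately show False using \<epsilon>(2) cstar_pos_scaleR_cancel by blast
    qed
  qed
  have unit': "\<exists>r. a + r *\<^sub>R 1 \<in> Q0" for a
    using unit[of a] adjoin(2)[OF P, of d] unfolding Q0_def by blast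
  obtain \<phi> :: "'a \<Rightarrow> real" where \<phi>: "linear \<phi>" "\<phi> 1 = 1" "\<And>a. a \<in> Q0 \<Longrightarrow> 0 \<le> \<phi> a"
    by (rule cone_functional[OF adjoin(1)[OF P, of d, folded Q0_def] not1 unit']) (rule that)
  then have pos: "0 \<le> \<phi> a" if "a \<in> P" for a using that adjoin(2)[OF P] unfolding Q0_def by blast
  interpret linear \<phi> by fact
  have star: "\<phi> (star a) = \<phi> a" for a
  proof -
    have "a - star a \<in> P" "star a - a \<in> P" by (simp_all add: P_def star_diff star_star cstar_pos_0)
    then have "0 \<le> \<phi> a - \<phi> (star a)" "0 \<le> \<phi> (star a) - \<phi> a" using pos by (auto simp flip: diff)
    then show ?thesis by simp
  qed
  show ?thesis
  proof (rule that[OF \<phi>(1,2) _ star])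
    show "0 \<le> \<phi> a" if "cstar_pos a" for a using pos that P_sa cstar_pos_star by blast
    show "\<bar>\<phi> a\<bar> \<le> norm a" for a
    proof -
      have "0 \<le> \<phi> (a + norm a *\<^sub>R 1)" "0 \<le> \<phi> (- a + norm (- a) *\<^sub>R 1)" using pos unit by blast+
      then show ?thesis by (simp add: add diff scale neg \<phi>(2))
    qed
    have "0 \<le> \<phi> d" using \<phi>(3) adjoin(3)[OF P] unfolding Q0_def by blast
    then show "\<phi> c < 0" using \<epsilon>(1) by (simp add: d_def add diff scale neg \<phi>(2))
  qed
qed

section \<open>Adjointable operators\<close>

context hilbert_module
begin

section \<open>Inner product and norm of the module\<close>

lemma diff_closed: "x \<in> elems X \<Longrightarrow> y \<in> elems X \<Longrightarrow> x - y \<in> elems X"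
  using add_closed[of x "- y"] uminus_closed by simp

lemma sum_closed: "(\<And>i. i \<in> A \<Longrightarrow> g i \<in> elems X) \<Longrightarrow> sum g A \<in> elems X"
  by (induction A rule: infinite_finite_induct) (simp_all add: zero_closed add_closed)

lemma ip_add_left:
  assumes "x \<in> elems X" "y \<in> elems X" "z \<in> elems X"
  shows "ip X (x + y) z = ip X x z + ip X y z"
  using arg_cong[OF ip_add_right[of z x y], of star] assms by (simp add: star_add ip_star add_closed)

lemma ip_act_left:
  assumes "x \<in> elems X" "y \<in> elems X"
  shows "ip X (act X x a) y = star a * ip X x y"
  using arg_cong[OF ip_act_right[of y x a], of star] assms by (simp add: star_mult ip_star act_closed)

lemma ip_zero_right: "x \<in> elems X \<Longrightarrow> ip X x 0 = 0"
  using ip_add_right[of x 0 0] by (simp add: zero_closed)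

lemma ip_zero_left: "x \<in> elems X \<Longrightarrow> ip X 0 x = 0"
  using ip_add_left[of 0 0 x] by (simp add: zero_closed)

lemma ip_minus_right: "x \<in> elems X \<Longrightarrow> y \<in> elems X \<Longrightarrow> ip X x (- y) = - ip X x y"
  using ip_add_right[of x y "- y"] by (simp add: uminus_closed ip_zero_right eq_neg_iff_add_eq_0 add.commute)

lemma ip_minus_left: "x \<in> elems X \<Longrightarrow> y \<in> elems X \<Longrightarrow> ip X (- x) y = - ip X x y"
  using ip_add_left[of x "- x" y] by (simp add: uminus_closed ip_zero_left eq_neg_iff_add_eq_0 add.commute)

lemma ip_diff_right:
  "x \<in> elems X \<Longrightarrow> y \<in> elems X \<Longrightarrow> z \<in> elems X \<Longrightarrow> ip X x (y - z) = ip X x y - ip X x z"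
  using ip_add_right[of x y "- z"] by (simp add: uminus_closed ip_minus_right)

lemma ip_diff_left:
  "x \<in> elems X \<Longrightarrow> y \<in> elems X \<Longrightarrow> z \<in> elems X \<Longrightarrow> ip X (x - y) z = ip X x z - ip X y z"
  using ip_add_left[of x "- y" z] by (simp add: uminus_closed ip_minus_left)

lemma ip_sum_right:
  assumes "x \<in> elems X" "\<And>i. i \<in> A \<Longrightarrow> g i \<in> elems X"
  shows "ip X x (sum g A) = (\<Sum>i\<in>A. ip X x (g i))"
  using assms(2)
  by (induction A rule: infinite_finite_induct)
     (simp_all add: assms(1) ip_zero_right ip_add_right sum_closed)

text \<open>The source of linearity: adjointable maps are not assumed linear, so identities between
  their values are tested against all inner products.\<close>

lemma ip_ext_right:
  assumes "y \<in> elems X" "z \<in> elems X" "\<And>x. x \<in> elems X \<Longrightarrow> ip X x y = ip X x z"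
  shows "y = z"
proof -
  have "ip X (y - z) (y - z) = 0"
    using assms diff_closed by (simp add: ip_diff_right)
  then have "y - z = 0" using assms diff_closed ip_definite by blast
  then show ?thesis by simp
qed

lemma act_zero_left: "act X 0 a = 0"
  using act_add_left[of 0 0 a] by (simp add: zero_closed)

lemma act_zero_right: "x \<in> elems X \<Longrightarrow> act X x 0 = 0"
  using act_add_right[of x 0 0] by simp

lemma ip_act_scaleR: "x \<in> elems X \<Longrightarrow> y \<in> elems X \<Longrightarrow> ip X x (act X y (r *\<^sub>R 1)) = r *\<^sub>R ip X x y"
  by (simp add: ip_act_right)

lemma ip_act_scaleR_left: "x \<in> elems X \<Longrightarrow> y \<in> elems X \<Longrightarrow> ip X (act X x (r *\<^sub>R 1)) y = r *\<^sub>R ip X x y"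
  by (simp add: ip_act_left star_scaleR)

lemma mnorm_nonneg: "0 \<le> mnorm X x"
  by (simp add: mnorm_def)

lemma mnorm_square: "(mnorm X x)\<^sup>2 = norm (ip X x x)"
  by (simp add: mnorm_def)

lemma mnorm_zero: "mnorm X 0 = 0"
  by (simp add: mnorm_def ip_zero_right zero_closed)

lemma mnorm_eq_0: "x \<in> elems X \<Longrightarrow> mnorm X x = 0 \<Longrightarrow> x = 0"
  using ip_definite by (simp add: mnorm_def)

lemma mnorm_minus: "x \<in> elems X \<Longrightarrow> mnorm X (- x) = mnorm X x"
  by (simp add: mnorm_def ip_minus_left ip_minus_right uminus_closed)

lemma mnorm_diff_commute: "x \<in> elems X \<Longrightarrow> y \<in> elems X \<Longrightarrow> mnorm X (x - y) = mnorm X (y - x)"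
  using mnorm_minus[of "x - y"] by (simp add: diff_closed)

text \<open>With h = <y, x>, w = <y, y> and t = 1/|w|, positivity of <x - y t h, x - y t h> and h* w
  h \<le> |w| h* h give t h* h \<le> <x, x>. Then norms are compared by
  \<open>norm_le_of_pos\<close>.\<close>

lemma Cauchy_Schwarz:
  assumes x: "x \<in> elems X" and y: "y \<in> elems X"
  shows "norm (ip X x y) \<le> mnorm X x * mnorm X y"
proof (cases "y = 0")
  case True
  then show ?thesis using x by (simp add: ip_zero_right mnorm_zero)
next
  case False
  define h w t where "h = ip X y x" and "w = ip X y y" and "t = inverse (norm w)"
  define g where "g = star h * h"
  define z where "z = act X y (t *\<^sub>R h)"
  have w0: "norm w > 0" using False y ip_definite by (auto simp: w_def)
  then have t0: "t > 0" by (simp add: t_def)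
  have sh: "ip X x y = star h" using x y by (simp add: h_def ip_star)
  have z: "z \<in> elems X" using y by (simp add: z_def act_closed)
  have "ip X (x - z) (x - z) = ip X x x - t *\<^sub>R g - (t *\<^sub>R g - (t * t) *\<^sub>R (star h * w * h))"
    using x y z
    by (simp add: ip_diff_left ip_diff_right diff_closed)
       (simp add: z_def act_closed ip_act_left ip_act_right star_scaleR sh g_def w_def h_def[symmetric] mult.assoc)
  then have 1: "cstar_pos (ip X x x - t *\<^sub>R g - (t *\<^sub>R g - (t * t) *\<^sub>R (star h * w * h)))"
    using ip_pos[OF diff_closed[OF x z]] by simp
  have "cstar_pos (norm w *\<^sub>R 1 - w)"
    using ip_pos[OF y] by (intro cstar_pos_norm_diff) (simp_all add: w_def cstar_pos_star)
  then have "cstar_pos ((t * t) *\<^sub>R (star h * (norm w *\<^sub>R 1 - w) * h))"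
    by (intro cstar_pos_scaleR cstar_pos_conj) simp_all
  also have "(t * t) *\<^sub>R (star h * (norm w *\<^sub>R 1 - w) * h) = t *\<^sub>R g - (t * t) *\<^sub>R (star h * w * h)"
  proof -
    have "star h * (norm w *\<^sub>R 1 - w) * h = norm w *\<^sub>R g - star h * w * h"
      by (simp add: g_def algebra_simps)
    moreover have "t * t * norm w = t" using w0 by (simp add: t_def)
    ultimately show ?thesis by (simp add: scaleR_diff_right)
  qed
  finally have "cstar_pos (ip X x x - t *\<^sub>R g)" using cstar_pos_add[OF 1] by fastforce
  moreover have "cstar_pos (norm (ip X x x) *\<^sub>R 1 - ip X x x)"
    using ip_pos[OF x] by (intro cstar_pos_norm_diff) (simp_all add: cstar_pos_star)
  ultimately have "cstar_pos (norm (ip X x x) *\<^sub>R 1 - t *\<^sub>R g)"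
    using cstar_pos_add by fastforce
  moreover have "cstar_pos (t *\<^sub>R g)"
    using t0 cstar_pos_star_mult[of h] unfolding g_def by (intro cstar_pos_scaleR) simp_all
  ultimately have "norm (t *\<^sub>R g) \<le> norm (ip X x x)" by (intro norm_le_of_pos)
  then have "t * (norm h)\<^sup>2 \<le> norm (ip X x x)" using t0 by (simp add: g_def cstar_identity)
  then have "(norm h)\<^sup>2 \<le> norm (ip X x x) * norm w" using w0 by (simp add: t_def field_simps)
  then have "(norm h)\<^sup>2 \<le> (mnorm X x * mnorm X y)\<^sup>2" by (simp add: power_mult_distrib mnorm_square w_def)
  then show ?thesis
    unfolding sh norm_star by (rule power2_le_imp_le) (simp add: mnorm_nonneg)
qed

lemma mnorm_triangle:
  assumes x: "x \<in> elems X" and y: "y \<in> elems X"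
  shows "mnorm X (x + y) \<le> mnorm X x + mnorm X y"
proof (rule power2_le_imp_le)
  have "(mnorm X (x + y))\<^sup>2 = norm ((ip X x x + ip X y x) + (ip X x y + ip X y y))"
    unfolding mnorm_square using x y by (simp add: ip_add_left ip_add_right add_closed algebra_simps)
  also have "\<dots> \<le> (norm (ip X x x) + norm (ip X y x)) + (norm (ip X x y) + norm (ip X y y))"
    by (intro order_trans[OF norm_triangle_ineq] add_mono norm_triangle_ineq)
  also have "\<dots> \<le> ((mnorm X x)\<^sup>2 + mnorm X y * mnorm X x) + (mnorm X x * mnorm X y + (mnorm X y)\<^sup>2)"
    unfolding mnorm_square by (intro add_mono Cauchy_Schwarz order_refl x y)
  also have "\<dots> = (mnorm X x + mnorm X y)\<^sup>2" by (simp add: power2_eq_square algebra_simps)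
  finally show "(mnorm X (x + y))\<^sup>2 \<le> (mnorm X x + mnorm X y)\<^sup>2" .
qed (simp add: mnorm_nonneg)

lemma mnorm_triangle_diff:
  assumes "x \<in> elems X" "y \<in> elems X" "z \<in> elems X"
  shows "mnorm X (x - z) \<le> mnorm X (x - y) + mnorm X (y - z)"
  using mnorm_triangle[of "x - y" "y - z"] assms by (simp add: diff_closed)

lemma mnorm_act_scaleC: "x \<in> elems X \<Longrightarrow> mnorm X (act X x (c *\<^sub>C 1)) = cmod c * mnorm X x"
proof -
  assume x: "x \<in> elems X"
  have "ip X (act X x (c *\<^sub>C 1)) (act X x (c *\<^sub>C 1)) = (cnj c * c) *\<^sub>C ip X x x"
    using x by (simp add: ip_act_left ip_act_right act_closed star_scaleC mult_scaleC_left mult_scaleC_right scaleC_scaleC mult.commute)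
  then show ?thesis
    unfolding mnorm_def by (simp add: norm_scaleC norm_mult real_sqrt_mult)
qed

lemma mnorm_act_scaleR: "x \<in> elems X \<Longrightarrow> mnorm X (act X x (r *\<^sub>R 1)) = \<bar>r\<bar> * mnorm X x"
  using mnorm_act_scaleC[of x "complex_of_real r"] by (simp add: scaleC_of_real)

section \<open>Adjoints and the algebra of adjointable maps\<close>

text \<open>A symmetric relation, so that each closure property is proved for a map and its adjoint
  at once.\<close>

definition is_adjoint :: "('x \<Rightarrow> 'x) \<Rightarrow> ('x \<Rightarrow> 'x) \<Rightarrow> bool" where
  "is_adjoint T U \<longleftrightarrow> operator_on X T \<and> operator_on X U \<and>
     (\<forall>x\<in>elems X. \<forall>y\<in>elems X. ip X (T x) y = ip X x (U y))"

lemma adjointables_iff: "T \<in> adjointables X \<longleftrightarrow> (\<exists>U. is_adjoint T U)"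
  unfolding adjointables_def is_adjoint_def by auto

lemma operator_ext:
  assumes "operator_on X T" "operator_on X U" "\<And>x. x \<in> elems X \<Longrightarrow> T x = U x"
  shows "T = U"
proof
  show "T x = U x" for x using assms unfolding operator_on_def by (cases "x \<in> elems X") auto
qed

lemma is_adjoint_sym:
  assumes "is_adjoint T U"
  shows "is_adjoint U T"
proof -
  have "ip X (U x) y = ip X x (T y)" if "x \<in> elems X" "y \<in> elems X" for x y
  proof -
    have "T y \<in> elems X" "U x \<in> elems X" "ip X (T y) x = ip X y (U x)"
      using assms that unfolding is_adjoint_def operator_on_def by blast+
    then show ?thesis using ip_star[of "T y" x] ip_star[of y "U x"] that by simp
  qed
  then show ?thesis using assms unfolding is_adjoint_def by simp
qed

lemma is_adjoint_unique:
  assumes "is_adjoint T U" "is_adjoint T V"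
  shows "U = V"
  using assms unfolding is_adjoint_def
  by (intro operator_ext ip_ext_right) (auto simp: operator_on_def)

lemma adj_eqI: "is_adjoint T U \<Longrightarrow> adj X T = U"
  unfolding adj_def by (rule the_equality) (auto simp: is_adjoint_def intro: is_adjoint_unique)

lemma is_adjoint_adj: "T \<in> adjointables X \<Longrightarrow> is_adjoint T (adj X T)"
  using adj_eqI adjointables_iff by metis

lemma adj_closed: "T \<in> adjointables X \<Longrightarrow> adj X T \<in> adjointables X"
  using is_adjoint_adj is_adjoint_sym adjointables_iff by blast

lemma ip_adj: "T \<in> adjointables X \<Longrightarrow> x \<in> elems X \<Longrightarrow> y \<in> elems X \<Longrightarrow> ip X (T x) y = ip X x (adj X T y)"
  using is_adjoint_adj unfolding is_adjoint_def by blast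

lemma ip_adj_left: "T \<in> adjointables X \<Longrightarrow> x \<in> elems X \<Longrightarrow> y \<in> elems X \<Longrightarrow> ip X (adj X T x) y = ip X x (T y)"
  using is_adjoint_sym[OF is_adjoint_adj] unfolding is_adjoint_def by blast

lemma op_closed: "T \<in> adjointables X \<Longrightarrow> x \<in> elems X \<Longrightarrow> T x \<in> elems X"
  unfolding adjointables_def operator_on_def by blast

lemma op_outside: "T \<in> adjointables X \<Longrightarrow> x \<notin> elems X \<Longrightarrow> T x = 0"
  unfolding adjointables_def operator_on_def by blast

lemma op_add:
  assumes "T \<in> adjointables X" "x \<in> elems X" "y \<in> elems X"
  shows "T (x + y) = T x + T y"
proof (rule ip_ext_right)
  fix z assume z: "z \<in> elems X"
  have "adj X T z \<in> elems X" using adj_closed op_closed assms z by blast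
  then show "ip X z (T (x + y)) = ip X z (T x + T y)"
    using assms z by (simp add: ip_adj_left[symmetric] ip_add_right op_closed add_closed)
qed (use assms op_closed add_closed in auto)

lemma op_act:
  assumes "T \<in> adjointables X" "x \<in> elems X"
  shows "T (act X x a) = act X (T x) a"
proof (rule ip_ext_right)
  fix z assume z: "z \<in> elems X"
  have "adj X T z \<in> elems X" using adj_closed op_closed assms z by blast
  then show "ip X z (T (act X x a)) = ip X z (act X (T x) a)"
    using assms z by (simp add: ip_adj_left[symmetric] ip_act_right op_closed act_closed)
qed (use assms op_closed act_closed in auto)

lemma op_zero: "T \<in> adjointables X \<Longrightarrow> T 0 = 0"
  using op_add[of T 0 0] zero_closed by simp

lemma op_minus: "T \<in> adjointables X \<Longrightarrow> x \<in> elems X \<Longrightarrow> T (- x) = - T x"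
  using op_add[of T x "- x"] op_zero[of T] uminus_closed[of x]
  by (simp add: eq_neg_iff_add_eq_0 add.commute)

lemma op_diff: "T \<in> adjointables X \<Longrightarrow> x \<in> elems X \<Longrightarrow> y \<in> elems X \<Longrightarrow> T (x - y) = T x - T y"
  using op_add[of T x "- y"] op_minus uminus_closed by simp

lemma op_sum:
  assumes "T \<in> adjointables X" "\<And>i. i \<in> A \<Longrightarrow> g i \<in> elems X"
  shows "T (sum g A) = (\<Sum>i\<in>A. T (g i))"
  using assms(2)
  by (induction A rule: infinite_finite_induct)
     (simp_all add: assms(1) op_zero op_add sum_closed)

lemma is_adjoint_add: "is_adjoint T U \<Longrightarrow> is_adjoint T' U' \<Longrightarrow> is_adjoint (T + T') (U + U')"
  unfolding is_adjoint_def operator_on_def by (auto simp: add_closed ip_add_left ip_add_right)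

lemma is_adjoint_uminus: "is_adjoint T U \<Longrightarrow> is_adjoint (- T) (- U)"
  unfolding is_adjoint_def operator_on_def by (auto simp: uminus_closed ip_minus_left ip_minus_right)

lemma is_adjoint_comp: "is_adjoint T U \<Longrightarrow> is_adjoint T' U' \<Longrightarrow> is_adjoint (T \<circ> T') (U' \<circ> U)"
proof -
  assume TU: "is_adjoint T U" "is_adjoint T' U'"
  then have "T \<in> adjointables X" "U' \<in> adjointables X"
    unfolding adjointables_iff using is_adjoint_sym by blast+
  \<comment> \<open>Outside the module a composite evaluates its outer factor at 0.\<close>
  then have "T 0 = 0" "U' 0 = 0" by (simp_all add: op_zero)
  with TU show ?thesis unfolding is_adjoint_def operator_on_def by simp
qed

lemma is_adjoint_zero: "is_adjoint 0 0"
  unfolding is_adjoint_def operator_on_def by (auto simp: zero_closed ip_zero_left ip_zero_right)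

lemma is_adjoint_scale: "is_adjoint (op_scale X c (op_one X)) (op_scale X (cnj c) (op_one X))"
  unfolding is_adjoint_def operator_on_def op_scale_def op_one_def
  by (auto simp: act_closed act_zero_left ip_act_left ip_act_right star_scaleC mult_scaleC_left mult_scaleC_right)

lemma op_scale_1: "op_scale X 1 (op_one X) = op_one X"
  by (rule ext) (simp add: op_scale_def op_one_def act_one act_zero_left)

lemma adjointables_closed:
  "T \<in> adjointables X \<Longrightarrow> U \<in> adjointables X \<Longrightarrow> T + U \<in> adjointables X"
  "T \<in> adjointables X \<Longrightarrow> - T \<in> adjointables X"
  "T \<in> adjointables X \<Longrightarrow> U \<in> adjointables X \<Longrightarrow> T \<circ> U \<in> adjointables X"
  "0 \<in> adjointables X"
  "op_scale X c (op_one X) \<in> adjointables X"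
  "op_one X \<in> adjointables X"
  unfolding adjointables_iff
  using is_adjoint_add is_adjoint_uminus is_adjoint_comp is_adjoint_zero is_adjoint_scale
    is_adjoint_scale[of 1, unfolded op_scale_1] by blast+

lemma adjointables_diff: "T \<in> adjointables X \<Longrightarrow> U \<in> adjointables X \<Longrightarrow> T - U \<in> adjointables X"
  using adjointables_closed(1)[of T "- U"] adjointables_closed(2) by simp

lemma adjointables_sum: "(\<And>i. i \<in> A \<Longrightarrow> G i \<in> adjointables X) \<Longrightarrow> sum G A \<in> adjointables X"
  by (induction A rule: infinite_finite_induct) (simp_all add: adjointables_closed)

text \<open>Gliding hump: if \<open>T u\<^sub>n\<close> grows fast relative to \<open>u\<^sub>n\<close>, the vector \<open>y\<close> built from signed multiples of
  \<open>T u\<^sub>n\<close> of norm \<open>3\<^sup>-\<^sup>n\<close> makes \<open>\<langle>T u\<^sub>n, y\<rangle> = \<langle>u\<^sub>n, T\<^sup>*y\<rangle>\<close> too large.\<close>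

lemma adjointable_bounded:
  assumes T: "T \<in> adjointables X"
  shows "\<exists>K\<ge>0. \<forall>x\<in>elems X. mnorm X (T x) \<le> K * mnorm X x"
proof (rule ccontr)
  assume neg: "\<not> ?thesis"
  \<comment> \<open>The factor anticipates the final estimate: 3^n cancels \<open>c n\<close>, the 2
    absorbs the tail of the series, and n remains.\<close>
  have "\<exists>u\<in>elems X. mnorm X (T u) > 2 * 3 ^ n * real n * mnorm X u" for n :: nat
  proof -
    have "0 \<le> 2 * 3 ^ n * real n" by simp
    then show ?thesis using neg by (meson not_le)
  qed
  then obtain u where u: "\<And>n. u n \<in> elems X" "\<And>n. mnorm X (T (u n)) > 2 * 3 ^ n * real n * mnorm X (u n)"
    by metis
  define z where "z n = T (u n)" for n
  have z: "z n \<in> elems X" for n using T u op_closed by (simp add: z_def)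
  have z0: "0 < mnorm X (z n)" for n
    using u(2)[of n] mnorm_nonneg[of "u n"] by (simp add: z_def le_less_trans[rotated])
  define c :: "nat \<Rightarrow> real" where "c n = inverse (3 ^ n)" for n
  define w where "w n = act X (z n) ((c n / mnorm X (z n)) *\<^sub>R 1)" for n
  have w: "w n \<in> elems X" for n using z by (simp add: w_def act_closed)
  have norm_w: "mnorm X (w n) = c n" for n
    unfolding w_def mnorm_act_scaleR[OF z] using z0[of n] by (simp add: c_def)
  have ip_w: "norm (ip X (z n) (w n)) = c n * mnorm X (z n)" for n
    unfolding w_def ip_act_scaleR[OF z z] norm_scaleR mnorm_square[symmetric]
    using z0[of n] by (simp add: c_def power2_eq_square)
  \<comment> \<open>By the triangle inequality one of the two signs keeps the inner product with
    \<open>z n\<close> at least as large as that of \<open>w n\<close> alone.\<close>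
  define y where "y = rec_nat 0 (\<lambda>n v. if norm (ip X (z n) (w n)) \<le> norm (ip X (z n) (v + w n))
      then v + w n else v - w n)"
  have y_Suc: "y (Suc n) = (if norm (ip X (z n) (w n)) \<le> norm (ip X (z n) (y n + w n))
      then y n + w n else y n - w n)" for n
    by (simp add: y_def)
  have y: "y n \<in> elems X" for n
  proof (induction n)
    case (Suc n)
    then show ?case using w y_Suc add_closed diff_closed by simp
  qed (simp add: y_def zero_closed)
  have big: "c n * mnorm X (z n) \<le> norm (ip X (z n) (y (Suc n)))" for n
  proof -
    have "2 * norm (ip X (z n) (w n)) = norm (ip X (z n) (y n + w n) - ip X (z n) (y n - w n))"
      using z w y by (simp add: ip_add_right ip_diff_right flip: scaleR_2)
    also have "\<dots> \<le> norm (ip X (z n) (y n + w n)) + norm (ip X (z n) (y n - w n))"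
      by (rule norm_triangle_ineq4)
    finally show ?thesis unfolding y_Suc ip_w[symmetric] by auto
  qed
  have step: "mnorm X (y (Suc n) - y n) = c n" for n
    using y_Suc[of n] norm_w mnorm_minus[OF w] by simp
  \<comment> \<open>The step from n to n + 1 has length 3^-n, so all steps from n on add up to 3/2
    of \<open>c n\<close>.\<close>
  have dist: "mnorm X (y (n + k) - y n) \<le> 3/2 * (c n - c (n + k))" for n k
  proof (induction k)
    case (Suc k)
    have "mnorm X (y (n + Suc k) - y n) \<le> mnorm X (y (Suc (n + k)) - y (n + k)) + mnorm X (y (n + k) - y n)"
      using mnorm_triangle_diff[OF y y y] by simp
    also have "\<dots> \<le> c (n + k) + 3/2 * (c n - c (n + k))" using Suc step by simp
    also have "c (n + k) = 3 * c (n + Suc k)" by (simp add: c_def)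
    also have "3 * c (n + Suc k) + 3/2 * (c n - 3 * c (n + Suc k)) = 3/2 * (c n - c (n + Suc k))"
      by (simp add: right_diff_distrib)
    finally show ?case .
  qed (simp add: mnorm_zero)
  have dist': "mnorm X (y m - y n) \<le> 3/2 * c n" if "n \<le> m" for m n
  proof -
    have "0 \<le> c m" by (simp add: c_def)
    then show ?thesis using dist[of n "m - n"] that by simp
  qed
  have c0: "c \<longlonglongrightarrow> 0"
    unfolding c_def power_inverse[symmetric] by (rule LIMSEQ_power_zero) simp
  have "\<exists>l\<in>elems X. (\<lambda>m. mnorm X (y m - l)) \<longlonglongrightarrow> 0"
  proof (rule complete[OF y], intro allI impI)
    fix e :: real assume "e > 0"
    then obtain N where N: "c N < e / 3"
      using order_tendstoD(2)[OF c0, of "e / 3"] by (auto simp: eventually_sequentially)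
    have "mnorm X (y i - y j) < e" if "i \<ge> N" "j \<ge> N" for i j
    proof -
      have "mnorm X (y i - y j) \<le> mnorm X (y i - y N) + mnorm X (y j - y N)"
        using mnorm_triangle_diff[OF y y y, of i j N] mnorm_diff_commute[OF y y, of j N] by simp
      then show ?thesis using dist'[OF that(1)] dist'[OF that(2)] N by simp
    qed
    then show "\<exists>N. \<forall>i\<ge>N. \<forall>j\<ge>N. mnorm X (y i - y j) < e" by blast
  qed
  then obtain l where l: "l \<in> elems X" "(\<lambda>m. mnorm X (y m - l)) \<longlonglongrightarrow> 0" by blast
  have close: "mnorm X (y n - l) \<le> 3/2 * c n" for n
  proof (rule LIMSEQ_le_const)
    show "(\<lambda>m. 3/2 * c n + mnorm X (y m - l)) \<longlonglongrightarrow> 3/2 * c n"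
      using tendsto_add[OF tendsto_const l(2)] by simp
    have "mnorm X (y n - l) \<le> 3/2 * c n + mnorm X (y m - l)" if "m \<ge> n" for m
      using mnorm_triangle_diff[OF y y l(1), of n m] mnorm_diff_commute[OF y y, of n m] dist'[OF that] by simp
    then show "\<exists>N. \<forall>m\<ge>N. mnorm X (y n - l) \<le> 3/2 * c n + mnorm X (y m - l)" by blast
  qed
  have bound: "real n * mnorm X (u n) < mnorm X (u n) * mnorm X (adj X T l)" for n
  proof -
    have "c n * mnorm X (z n) \<le> norm (ip X (z n) (y (Suc n) - l) + ip X (z n) l)"
      using big[of n] z y l(1) by (simp add: ip_diff_right)
    also have "\<dots> \<le> mnorm X (z n) * mnorm X (y (Suc n) - l) + norm (ip X (z n) l)"
      using Cauchy_Schwarz[OF z diff_closed[OF y l(1)]] by (intro order_trans[OF norm_triangle_ineq] add_mono) auto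
    \<comment> \<open>The steps after the n-th can undo only half of what it contributed.\<close>
    also have "\<dots> \<le> mnorm X (z n) * (c n / 2) + norm (ip X (z n) l)"
    proof -
      have "3/2 * c (Suc n) = c n / 2" by (simp add: c_def)
      then have "mnorm X (y (Suc n) - l) \<le> c n / 2" using close[of "Suc n"] by linarith
      then show ?thesis by (intro add_right_mono mult_left_mono mnorm_nonneg)
    qed
    finally have "c n * mnorm X (z n) / 2 \<le> norm (ip X (z n) l)" by (simp add: mult.commute)
    also have "\<dots> = norm (ip X (u n) (adj X T l))" using T u l by (simp add: z_def ip_adj)
    also have "\<dots> \<le> mnorm X (u n) * mnorm X (adj X T l)"
      using T u l by (intro Cauchy_Schwarz) (simp_all add: op_closed adj_closed)
    finally have *: "c n * mnorm X (z n) / 2 \<le> mnorm X (u n) * mnorm X (adj X T l)" .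
    have "real n * mnorm X (u n) = c n / 2 * (2 * 3 ^ n * real n * mnorm X (u n))"
      by (simp add: c_def)
    also have "\<dots> < c n / 2 * mnorm X (z n)"
      using u(2)[of n] by (intro mult_strict_left_mono) (simp_all add: z_def c_def)
    also have "\<dots> = c n * mnorm X (z n) / 2" by simp
    also note *
    finally show ?thesis .
  qed
  obtain n :: nat where n: "mnorm X (adj X T l) \<le> real n" using real_arch_simple by blast
  have "mnorm X (u n) * mnorm X (adj X T l) \<le> mnorm X (u n) * real n"
    using n by (intro mult_left_mono) (simp_all add: mnorm_nonneg)
  then show False using bound[of n] by (simp add: mult.commute)
qed

section \<open>The operator norm\<close>

text \<open>\<open>adjointable_bounded\<close> makes the supremum in \<open>op_norm\<close> one over
  a bounded set; then x is scaled to norm 1.\<close>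

lemma op_norm_upper:
  assumes T: "T \<in> adjointables X" and x: "x \<in> elems X"
  shows "mnorm X (T x) \<le> op_norm X T * mnorm X x"
proof (cases "x = 0")
  case True
  then show ?thesis using T by (simp add: op_zero mnorm_zero)
next
  case False
  obtain K where K: "K \<ge> 0" "\<And>x. x \<in> elems X \<Longrightarrow> mnorm X (T x) \<le> K * mnorm X x"
    using adjointable_bounded[OF T] by blast
  have nz: "mnorm X x > 0" using False x mnorm_eq_0 mnorm_nonneg[of x] by force
  define y where "y = act X x (inverse (mnorm X x) *\<^sub>R 1)"
  have y: "y \<in> elems X" "mnorm X y = 1"
    using x nz by (simp_all add: y_def act_closed mnorm_act_scaleR)
  have "mnorm X (T y) \<le> op_norm X T"
    unfolding op_norm_def
  proof (rule cSUP_upper)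
    show "bdd_above ((\<lambda>x. mnorm X (T x)) ` {x \<in> elems X. mnorm X x \<le> 1})"
    proof (rule bdd_aboveI2)
      fix x assume "x \<in> {x \<in> elems X. mnorm X x \<le> 1}"
      then show "mnorm X (T x) \<le> K" using K(2)[of x] K(1) mult_left_le[of "mnorm X x" K] by simp
    qed
  qed (use y in simp)
  moreover have "mnorm X (T y) = inverse (mnorm X x) * mnorm X (T x)"
    using T x nz by (simp add: y_def op_act mnorm_act_scaleR op_closed)
  ultimately show ?thesis using nz by (simp add: field_simps)
qed

lemma op_norm_le:
  assumes K: "0 \<le> K" "\<And>x. x \<in> elems X \<Longrightarrow> mnorm X (T x) \<le> K * mnorm X x"
  shows "op_norm X T \<le> K"
  unfolding op_norm_def
proof (rule cSUP_least)
  show "{x \<in> elems X. mnorm X x \<le> 1} \<noteq> {}" using zero_closed mnorm_zero by force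
  fix x assume "x \<in> {x \<in> elems X. mnorm X x \<le> 1}"
  then show "mnorm X (T x) \<le> K" using K(2)[of x] K(1) mult_left_le[of "mnorm X x" K] by simp
qed

lemma op_norm_nonneg:
  assumes T: "T \<in> adjointables X"
  shows "0 \<le> op_norm X T"
proof -
  obtain K where K: "K \<ge> 0" "\<And>x. x \<in> elems X \<Longrightarrow> mnorm X (T x) \<le> K * mnorm X x"
    using adjointable_bounded[OF T] by blast
  have "mnorm X (T 0) \<le> op_norm X T"
    unfolding op_norm_def
  proof (rule cSUP_upper)
    show "bdd_above ((\<lambda>x. mnorm X (T x)) ` {x \<in> elems X. mnorm X x \<le> 1})"
    proof (rule bdd_aboveI2)
      fix x assume "x \<in> {x \<in> elems X. mnorm X x \<le> 1}"
      then show "mnorm X (T x) \<le> K" using K(2)[of x] K(1) mult_left_le[of "mnorm X x" K] by simp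
    qed
  qed (simp add: zero_closed mnorm_zero)
  then show ?thesis using mnorm_nonneg order_trans by blast
qed

lemma norm_ip_op_le:
  assumes "T \<in> adjointables X" "x \<in> elems X"
  shows "norm (ip X x (T x)) \<le> op_norm X T * (mnorm X x)\<^sup>2"
proof -
  have "norm (ip X x (T x)) \<le> mnorm X x * mnorm X (T x)"
    using assms by (intro Cauchy_Schwarz) (simp_all add: op_closed)
  also have "\<dots> \<le> mnorm X x * (op_norm X T * mnorm X x)"
    using assms by (intro mult_left_mono op_norm_upper) (simp_all add: mnorm_nonneg)
  finally show ?thesis by (simp add: power2_eq_square mult_ac)
qed

end

section \<open>Functional calculus for adjointable operators\<close>

lemma sum_fun_apply: "(\<Sum>i\<in>A. G i) x = (\<Sum>i\<in>A. G i x)"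
  for G :: "'i \<Rightarrow> 'b \<Rightarrow> 'c::comm_monoid_add"
  by (induction A rule: infinite_finite_induct) simp_all

context hilbert_module
begin

lemma op_norm_add:
  assumes "T \<in> adjointables X" "U \<in> adjointables X"
  shows "op_norm X (T + U) \<le> op_norm X T + op_norm X U"
proof (rule op_norm_le)
  fix x assume x: "x \<in> elems X"
  have "mnorm X (T x + U x) \<le> mnorm X (T x) + mnorm X (U x)"
    using assms x by (intro mnorm_triangle) (simp_all add: op_closed)
  also have "\<dots> \<le> op_norm X T * mnorm X x + op_norm X U * mnorm X x"
    using assms x by (intro add_mono op_norm_upper)
  finally show "mnorm X ((T + U) x) \<le> (op_norm X T + op_norm X U) * mnorm X x"
    by (simp add: distrib_right)
qed (use assms op_norm_nonneg in auto)

lemma op_norm_comp: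
  assumes "T \<in> adjointables X" "U \<in> adjointables X"
  shows "op_norm X (T \<circ> U) \<le> op_norm X T * op_norm X U"
proof (rule op_norm_le)
  fix x assume x: "x \<in> elems X"
  have "mnorm X (T (U x)) \<le> op_norm X T * mnorm X (U x)"
    using assms x by (intro op_norm_upper) (simp_all add: op_closed)
  also have "\<dots> \<le> op_norm X T * (op_norm X U * mnorm X x)"
    using assms x by (intro mult_left_mono op_norm_upper op_norm_nonneg)
  finally show "mnorm X ((T \<circ> U) x) \<le> (op_norm X T * op_norm X U) * mnorm X x"
    by (simp add: mult.assoc)
qed (use assms op_norm_nonneg in auto)

lemma op_norm_minus_le: "T \<in> adjointables X \<Longrightarrow> op_norm X (- T) \<le> op_norm X T"
  by (rule op_norm_le) (simp_all add: op_norm_nonneg mnorm_minus op_closed op_norm_upper)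

lemma op_norm_minus: "T \<in> adjointables X \<Longrightarrow> op_norm X (- T) = op_norm X T"
  using op_norm_minus_le[of T] op_norm_minus_le[of "- T"] adjointables_closed(2)[of T] by simp

lemma op_norm_eq_0:
  assumes T: "T \<in> adjointables X" and 0: "op_norm X T = 0"
  shows "T = 0"
proof
  fix x
  show "T x = 0 x"
  proof (cases "x \<in> elems X")
    case True
    then have "mnorm X (T x) = 0" using op_norm_upper[OF T True] 0 mnorm_nonneg[of "T x"] by simp
    then show ?thesis using mnorm_eq_0 op_closed[OF T True] by simp
  qed (simp add: op_outside[OF T])
qed

lemma op_norm_scale:
  assumes T: "T \<in> adjointables X"
  shows "op_norm X (op_scale X c T) = cmod c * op_norm X T"
proof -
  have n: "mnorm X (op_scale X c T x) = cmod c * mnorm X (T x)" if "x \<in> elems X" for x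
    using op_closed[OF T that] by (simp add: op_scale_def mnorm_act_scaleC)
  have "op_norm X (op_scale X c T) \<le> cmod c * op_norm X T"
    by (rule op_norm_le) (simp_all add: n op_norm_nonneg[OF T] op_norm_upper[OF T] mult_left_mono mult.assoc)
  moreover have "cmod c * op_norm X T \<le> op_norm X (op_scale X c T)"
  proof (cases "c = 0")
    case True
    have "op_scale X c T = 0"
      using op_outside[OF T] op_closed[OF T] True
      by (intro ext) (metis act_zero_left act_zero_right op_scale_def scaleC_0_left zero_fun_apply)
    then show ?thesis using True op_norm_nonneg[OF adjointables_closed(4)] by simp
  next
    case False
    have eq: "op_scale X c T = op_scale X c (op_one X) \<circ> T"
    proof
      show "op_scale X c T x = (op_scale X c (op_one X) \<circ> T) x" for x
        using op_closed[OF T] op_outside[OF T] zero_closed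
        by (cases "x \<in> elems X") (simp_all add: op_scale_def op_one_def)
    qed
    then have cT: "op_scale X c T \<in> adjointables X"
      using T adjointables_closed by metis
    have "op_norm X T \<le> op_norm X (op_scale X c T) / cmod c"
    proof (rule op_norm_le)
      fix x assume x: "x \<in> elems X"
      show "mnorm X (T x) \<le> op_norm X (op_scale X c T) / cmod c * mnorm X x"
        using op_norm_upper[OF cT x] n[OF x] False by (simp add: field_simps)
    qed (simp add: op_norm_nonneg[OF cT])
    then show ?thesis using False by (simp add: field_simps)
  qed
  ultimately show ?thesis by simp
qed

lemma op_norm_adj:
  assumes T: "T \<in> adjointables X"
  shows "op_norm X (adj X T) \<le> op_norm X T"
proof (rule op_norm_le)
  fix x assume x: "x \<in> elems X"
  define y where "y = adj X T x"
  have y: "y \<in> elems X" using T x by (simp add: y_def op_closed adj_closed)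
  have "(mnorm X y)\<^sup>2 = norm (ip X x (T y))"
    unfolding mnorm_square using ip_adj_left[OF T x y] by (simp add: y_def)
  also have "\<dots> \<le> mnorm X x * mnorm X (T y)" using T x y by (intro Cauchy_Schwarz) (simp_all add: op_closed)
  also have "\<dots> \<le> mnorm X x * (op_norm X T * mnorm X y)"
    using T y by (intro mult_left_mono op_norm_upper) (simp_all add: mnorm_nonneg)
  finally have "mnorm X y * mnorm X y \<le> (op_norm X T * mnorm X x) * mnorm X y"
    by (simp add: power2_eq_square mult_ac)
  then show "mnorm X (adj X T x) \<le> op_norm X T * mnorm X x"
    unfolding y_def[symmetric]
    using mnorm_nonneg[of y] mult_nonneg_nonneg[OF op_norm_nonneg[OF T] mnorm_nonneg[of x]]
    by (cases "mnorm X y = 0") (auto simp: mult_le_cancel_right)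
qed (simp add: op_norm_nonneg T)

lemma adj_diff:
  assumes "T \<in> adjointables X" "U \<in> adjointables X"
  shows "adj X (T - U) = adj X T - adj X U"
proof (rule adj_eqI)
  show "is_adjoint (T - U) (adj X T - adj X U)"
    using is_adjoint_add[OF is_adjoint_adj[OF assms(1)] is_adjoint_uminus[OF is_adjoint_adj[OF assms(2)]]]
    by simp
qed

section \<open>Completeness of the adjointable maps\<close>

definition mlim :: "(nat \<Rightarrow> 'x) \<Rightarrow> 'x" where
  "mlim s = (SOME l. l \<in> elems X \<and> (\<lambda>m. mnorm X (s m - l)) \<longlonglongrightarrow> 0)"

lemma pointwise_limit:
  assumes s: "\<And>m. s m \<in> adjointables X"
    and C: "\<forall>e>0. \<exists>N. \<forall>i\<ge>N. \<forall>j\<ge>N. op_norm X (s i - s j) < e" and x: "x \<in> elems X"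
  shows "mlim (\<lambda>m. s m x) \<in> elems X" "(\<lambda>m. mnorm X (s m x - mlim (\<lambda>m. s m x))) \<longlonglongrightarrow> 0"
proof -
  have "\<exists>l\<in>elems X. (\<lambda>m. mnorm X (s m x - l)) \<longlonglongrightarrow> 0"
  proof (rule complete, rule op_closed[OF s x], intro allI impI)
    fix e :: real assume "e > 0"
    define K where "K = mnorm X x + 1"
    have K: "K > 0" "mnorm X x \<le> K" using mnorm_nonneg[of x] by (simp_all add: K_def)
    then obtain N where N: "\<And>i j. i \<ge> N \<Longrightarrow> j \<ge> N \<Longrightarrow> op_norm X (s i - s j) < e / K"
      using C \<open>e > 0\<close> by (metis divide_pos_pos)
    have "mnorm X (s i x - s j x) < e" if "i \<ge> N" "j \<ge> N" for i j
    proof -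
      have d: "s i - s j \<in> adjointables X" using s by (simp add: adjointables_diff)
      have "mnorm X (s i x - s j x) \<le> op_norm X (s i - s j) * mnorm X x"
        using op_norm_upper[OF d x] by simp
      also have "\<dots> \<le> op_norm X (s i - s j) * K"
        using K by (intro mult_left_mono op_norm_nonneg[OF d])
      also have "\<dots> < e" using N[OF that] K by (simp add: field_simps)
      finally show ?thesis .
    qed
    then show "\<exists>N. \<forall>i\<ge>N. \<forall>j\<ge>N. mnorm X (s i x - s j x) < e" by blast
  qed
  then have "mlim (\<lambda>m. s m x) \<in> elems X \<and> (\<lambda>m. mnorm X (s m x - mlim (\<lambda>m. s m x))) \<longlonglongrightarrow> 0"
    unfolding mlim_def Bex_def by (rule someI_ex)
  then show "mlim (\<lambda>m. s m x) \<in> elems X" "(\<lambda>m. mnorm X (s m x - mlim (\<lambda>m. s m x))) \<longlonglongrightarrow> 0" by blast+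
qed

lemma ip_tendsto_right:
  assumes "\<And>m. s m \<in> elems X" "l \<in> elems X" "x \<in> elems X" "(\<lambda>m. mnorm X (s m - l)) \<longlonglongrightarrow> 0"
  shows "(\<lambda>m. ip X x (s m)) \<longlonglongrightarrow> ip X x l"
proof -
  have "(\<lambda>m. mnorm X x * mnorm X (s m - l)) \<longlonglongrightarrow> 0"
    using assms(4) by (rule tendsto_mult_right_zero)
  moreover have "norm (ip X x (s m) - ip X x l) \<le> mnorm X x * mnorm X (s m - l)" for m
    using Cauchy_Schwarz[of x "s m - l"] assms by (simp add: diff_closed ip_diff_right)
  ultimately have "(\<lambda>m. ip X x (s m) - ip X x l) \<longlonglongrightarrow> 0"
    by (rule_tac Lim_null_comparison[of _ "\<lambda>m. mnorm X x * mnorm X (s m - l)"]) simp_all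
  then show ?thesis by (rule LIM_zero_cancel)
qed

text \<open>Taking adjoints does not increase the norm, so the adjoints form a Cauchy sequence as
  well. Both sequences converge pointwise and the adjoint relation passes to the limits, which
  supplies the adjoint of the limit.\<close>

lemma adjointables_complete:
  assumes s: "\<And>m. s m \<in> adjointables X"
    and C: "\<forall>e>0. \<exists>N. \<forall>i\<ge>N. \<forall>j\<ge>N. op_norm X (s i - s j) < e"
  shows "\<exists>T\<in>adjointables X. (\<lambda>m. op_norm X (s m - T)) \<longlonglongrightarrow> 0"
proof -
  define r where "r m = adj X (s m)" for m
  have r: "r m \<in> adjointables X" for m using s by (simp add: r_def adj_closed)
  have "op_norm X (r i - r j) \<le> op_norm X (s i - s j)" for i j
    using op_norm_adj[OF adjointables_diff[OF s s]] by (simp add: r_def adj_diff s)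
  then have Cr: "\<forall>e>0. \<exists>N. \<forall>i\<ge>N. \<forall>j\<ge>N. op_norm X (r i - r j) < e"
    using C by (meson le_less_trans)
  define T where "T x = (if x \<in> elems X then mlim (\<lambda>m. s m x) else 0)" for x
  define U where "U x = (if x \<in> elems X then mlim (\<lambda>m. r m x) else 0)" for x
  note limT = pointwise_limit[OF s C] and limU = pointwise_limit[OF r Cr]
  have "is_adjoint T U"
    unfolding is_adjoint_def operator_on_def
  proof (intro conjI ballI)
    fix x y assume xy: "x \<in> elems X" "y \<in> elems X"
    have "(\<lambda>m. ip X x (r m y)) \<longlonglongrightarrow> ip X x (U y)"
      using xy limU[of y] r by (intro ip_tendsto_right) (simp_all add: U_def op_closed)
    moreover have "(\<lambda>m. ip X y (s m x)) \<longlonglongrightarrow> ip X y (T x)"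
      using xy limT[of x] s by (intro ip_tendsto_right) (simp_all add: T_def op_closed)
    then have "(\<lambda>m. star (ip X y (s m x))) \<longlonglongrightarrow> star (ip X y (T x))" by (rule tendsto_star)
    moreover have "star (ip X y (s m x)) = ip X x (r m y)" for m
      using xy s ip_adj[OF s xy, of m] by (simp add: ip_star op_closed r_def)
    ultimately have "star (ip X y (T x)) = ip X x (U y)" by (simp add: LIMSEQ_unique)
    then show "ip X (T x) y = ip X x (U y)" using xy limT by (simp add: ip_star T_def)
  qed (simp_all add: T_def U_def limT limU)
  then have T: "T \<in> adjointables X" using adjointables_iff by blast
  have "(\<lambda>m. op_norm X (s m - T)) \<longlonglongrightarrow> 0"
  proof (rule LIMSEQ_I)
    fix e :: real assume "e > 0"
    then obtain N where N: "\<And>i j. i \<ge> N \<Longrightarrow> j \<ge> N \<Longrightarrow> op_norm X (s i - s j) < e / 2"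
      using C by (metis half_gt_zero)
    have "op_norm X (s m - T) \<le> e / 2" if "m \<ge> N" for m
    proof (rule op_norm_le)
      fix x assume x: "x \<in> elems X"
      show "mnorm X ((s m - T) x) \<le> e / 2 * mnorm X x"
      proof (rule LIMSEQ_le_const)
        show "(\<lambda>j. e / 2 * mnorm X x + mnorm X (s j x - T x)) \<longlonglongrightarrow> e / 2 * mnorm X x"
          using tendsto_add[OF tendsto_const limT(2)[OF x]] x by (simp add: T_def)
        have "mnorm X ((s m - T) x) \<le> e / 2 * mnorm X x + mnorm X (s j x - T x)" if "j \<ge> N" for j
        proof -
          have "mnorm X (s m x - T x) \<le> mnorm X (s m x - s j x) + mnorm X (s j x - T x)"
            by (rule mnorm_triangle_diff) (simp_all add: op_closed x s T)
          moreover have "mnorm X (s m x - s j x) \<le> op_norm X (s m - s j) * mnorm X x"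
            using op_norm_upper[OF adjointables_diff[OF s s] x] by simp
          moreover have "op_norm X (s m - s j) * mnorm X x \<le> e / 2 * mnorm X x"
            using N[OF \<open>m \<ge> N\<close> that] by (intro mult_right_mono mnorm_nonneg) simp
          ultimately show ?thesis by simp
        qed
        then show "\<exists>N. \<forall>j\<ge>N. mnorm X ((s m - T) x) \<le> e / 2 * mnorm X x + mnorm X (s j x - T x)" by blast
      qed
    qed (use \<open>e > 0\<close> in simp)
    then have "norm (op_norm X (s m - T) - 0) < e" if "m \<ge> N" for m
      using that \<open>e > 0\<close> op_norm_nonneg[OF adjointables_diff[OF s T], of m] by fastforce
    then show "\<exists>no. \<forall>n\<ge>no. norm (op_norm X (s n - T) - 0) < e" by blast
  qed
  then show ?thesis using T by blast
qed

section \<open>Polynomials in an operator\<close>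

definition opev :: "('x \<Rightarrow> 'x) \<Rightarrow> complex poly \<Rightarrow> 'x \<Rightarrow> 'x" where
  "opev T p = fold_coeffs (\<lambda>c U. op_scale X c (op_one X) + (T \<circ> U)) p 0"

lemma opev_0 [simp]: "opev T 0 = 0"
  by (simp add: opev_def)

lemma op_scale_0: "op_scale X 0 (op_one X) = 0"
  by (rule ext) (simp add: op_scale_def op_one_def act_zero_left act_zero_right)

context
  fixes T :: "'x \<Rightarrow> 'x"
  assumes T: "T \<in> adjointables X"
begin

lemma opev_pCons: "opev T (pCons c p) = op_scale X c (op_one X) + (T \<circ> opev T p)"
proof (cases "p = 0 \<and> c = 0")
  case True
  have "T \<circ> 0 = 0" by (rule ext) (simp add: op_zero[OF T])
  then show ?thesis using True by (simp add: op_scale_0)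
qed (auto simp: opev_def)

lemma opev_closed: "opev T p \<in> adjointables X"
proof (induction p)
  case 0
  show ?case unfolding opev_0 by (rule adjointables_closed)
next
  case (pCons a p)
  then show ?case unfolding opev_pCons by (simp only: adjointables_closed T)
qed

lemma opev_pCons_apply:
  assumes "x \<in> elems X"
  shows "opev T (pCons c p) x = act X x (c *\<^sub>C 1) + T (opev T p x)"
  using assms by (simp add: opev_pCons op_scale_def op_one_def)

lemma opev_add: "opev T (p + q) = opev T p + opev T q"
proof (rule operator_ext)
  show "opev T (p + q) x = (opev T p + opev T q) x" if x: "x \<in> elems X" for x
    by (induction p q rule: poly_induct2)
       (simp_all add: x opev_pCons_apply scaleC_add_left act_add_right op_add[OF T] op_closed opev_closed add_ac)
qed (use opev_closed[of "p + q"] adjointables_closed(1)[OF opev_closed[of p] opev_closed[of q]] in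
     \<open>auto simp: adjointables_def\<close>)

lemma opev_smult: "opev T (smult c p) = op_scale X c (opev T p)"
proof (rule operator_ext)
  show "opev T (smult c p) x = op_scale X c (opev T p) x" if x: "x \<in> elems X" for x
  proof (induction p)
    case (pCons a p)
    have "act X x ((c * a) *\<^sub>C 1) = act X (act X x (a *\<^sub>C 1)) (c *\<^sub>C 1)"
      using act_mult[OF x, of "a *\<^sub>C 1" "c *\<^sub>C 1"] by (simp add: mult_scaleC_left mult_scaleC_right scaleC_scaleC mult.commute)
    then show ?case
      using pCons x opev_closed T
      by (simp add: opev_pCons_apply op_scale_def act_add_left act_closed op_closed op_act)
  qed (simp add: op_scale_def act_zero_left)
  show "operator_on X (opev T (smult c p))" using opev_closed by (simp add: adjointables_def)
  show "operator_on X (op_scale X c (opev T p))"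
    using op_closed[OF opev_closed[of p]] op_outside[OF opev_closed[of p]]
    by (simp add: operator_on_def op_scale_def act_closed act_zero_left)
qed

lemma opev_mult: "opev T (p * q) = opev T p \<circ> opev T q"
proof (rule operator_ext)
  show "opev T (p * q) x = (opev T p \<circ> opev T q) x" if x: "x \<in> elems X" for x
  proof (induction p)
    case (pCons a p)
    have "act X (opev T q x) (a *\<^sub>C 1) = opev T (smult a q) x" by (simp add: opev_smult op_scale_def)
    then show ?case
      using pCons x op_closed[OF opev_closed x, of q]
      by (simp add: opev_add opev_pCons_apply act_zero_right)
  qed simp
qed (use opev_closed[of "p * q"] adjointables_closed(3)[OF opev_closed[of p] opev_closed[of q]] in
     \<open>auto simp: adjointables_def\<close>)

lemma opev_one: "opev T 1 = op_one X"
proof -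
  have "T \<circ> 0 = 0" by (rule ext) (simp add: op_zero[OF T])
  then show ?thesis by (simp add: one_pCons opev_pCons op_scale_1)
qed

lemma opev_cpoly: "opev T (cpoly P) = op_poly X P T"
proof -
  \<comment> \<open>The sum may be padded with zero coefficients up to any n, so the degrees of P
    and \<open>pCons c P\<close> need not be related.\<close>
  have eq: "op_poly X Q T x = (\<Sum>i\<le>n. act X ((T ^^ i) x) (complex_of_real (coeff Q i) *\<^sub>C 1))"
    if "degree Q \<le> n" "x \<in> elems X" for Q n x
  proof -
    have Ti: "(T ^^ i) x \<in> elems X" for i by (induction i) (simp_all add: that op_closed T)
    have "op_poly X Q T x = (\<Sum>i\<le>degree Q. act X ((T ^^ i) x) (complex_of_real (coeff Q i) *\<^sub>C 1))"
      using that(2) by (simp add: op_poly_def op_scale_def op_one_def sum_fun_apply)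
    also have "\<dots> = (\<Sum>i\<le>n. act X ((T ^^ i) x) (complex_of_real (coeff Q i) *\<^sub>C 1))"
      using that by (intro sum.mono_neutral_left) (auto simp: coeff_eq_0 act_zero_right Ti)
    finally show ?thesis .
  qed
  show ?thesis
  proof (rule operator_ext)
    show "opev T (cpoly P) x = op_poly X P T x" if x: "x \<in> elems X" for x
    proof (induction P)
      case 0
      then show ?case using eq[of 0 0 x] x by (simp add: act_zero_right)
    next
      case (pCons c P)
      have Ti: "(T ^^ i) x \<in> elems X" for i by (induction i) (simp_all add: x op_closed T)
      have "op_poly X (pCons c P) T x
          = act X x (complex_of_real c *\<^sub>C 1) + (\<Sum>i\<le>degree P. act X ((T ^^ Suc i) x) (complex_of_real (coeff P i) *\<^sub>C 1))"
        unfolding eq[OF degree_pCons_le x] sum.atMost_Suc_shift by simp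
      also have "(\<Sum>i\<le>degree P. act X ((T ^^ Suc i) x) (complex_of_real (coeff P i) *\<^sub>C 1))
          = T (\<Sum>i\<le>degree P. act X ((T ^^ i) x) (complex_of_real (coeff P i) *\<^sub>C 1))"
        by (simp add: op_sum[OF T] act_closed Ti op_act[OF T])
      also have "\<dots> = T (op_poly X P T x)" by (simp add: eq[OF order_refl x])
      finally show ?case using pCons x by (simp add: map_poly_pCons opev_pCons_apply)
    qed
    show "operator_on X (opev T (cpoly P))" using opev_closed by (simp add: adjointables_def)
    have Ti: "(T ^^ i) x \<in> elems X" if "x \<in> elems X" for i x by (induction i) (simp_all add: that op_closed T)
    have "op_poly X P T x = 0" if "x \<notin> elems X" for x
    proof -
      have "(T ^^ i) 0 = 0" for i by (induction i) (simp_all add: op_zero T)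
      then show ?thesis using that by (simp add: op_poly_def op_scale_def op_one_def act_zero_left sum_fun_apply)
    qed
    moreover have "op_poly X P T x \<in> elems X" if "x \<in> elems X" for x
      unfolding eq[OF order_refl that] by (intro sum_closed act_closed Ti that)
    ultimately show "operator_on X (op_poly X P T)" by (simp add: operator_on_def)
  qed
qed

lemma opev_linear: "opev T [:- c, 1:] = T - op_scale X c (op_one X)"
proof -
  have 1: "opev T [:0, 1:] = T"
  proof -
    have "T \<circ> (0 :: 'x \<Rightarrow> 'x) = 0" "T \<circ> op_one X = T"
      by (rule ext, simp add: op_zero[OF T] op_one_def op_outside[OF T])+
    then show ?thesis by (simp only: opev_pCons opev_0 op_scale_0 op_scale_1 add_0_left add_0_right)
  qed
  have "opev T [:0, 1:] = opev T ([:- c, 1:] + smult c 1)" by simp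
  also have "\<dots> = opev T [:- c, 1:] + op_scale X c (op_one X)" by (simp only: opev_add opev_smult opev_one)
  finally show ?thesis using 1 by (simp add: eq_diff_eq)
qed

end

lemma opev_adjoint:
  assumes T: "T \<in> adjointables X" "self_adjoint X T" and "x \<in> elems X" "y \<in> elems X"
  shows "ip X (opev T p x) y = ip X x (opev T (map_poly cnj p) y)"
  using assms(4)
proof (induction p arbitrary: y)
  case (pCons a p)
  have comm: "opev T q (T y) = T (opev T q y)" for q
  proof -
    have "opev T (q * [:0, 1:]) = opev T ([:0, 1:] * q)" by (simp add: mult.commute)
    then have "opev T q \<circ> opev T [:0, 1:] = opev T [:0, 1:] \<circ> opev T q" by (simp only: opev_mult[OF T(1)])
    moreover have "opev T [:0, 1:] = T"
      using opev_linear[OF T(1), of 0] by (simp add: op_scale_0)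
    ultimately show ?thesis by (metis comp_apply)
  qed
  have "ip X (T (opev T p x)) y = ip X (opev T p x) (T y)"
    using T(2) assms(3) pCons.prems op_closed[OF opev_closed[OF T(1)]] unfolding self_adjoint_def by blast
  also have "\<dots> = ip X x (T (opev T (map_poly cnj p) y))"
    using pCons.IH[OF op_closed[OF T(1) pCons.prems]] comm by simp
  finally have *: "ip X (T (opev T p x)) y = ip X x (T (opev T (map_poly cnj p) y))" .
  show ?case
    using assms(3) pCons.prems *
    by (simp add: map_poly_pCons opev_pCons_apply[OF T(1)] ip_add_left ip_add_right act_closed op_closed opev_closed
        T(1) ip_act_left ip_act_right star_scaleC mult_scaleC_left mult_scaleC_right)
qed (simp add: ip_zero_left ip_zero_right assms(3))

lemma sa_calculus_opev:
  assumes T: "T \<in> adjointables X" "self_adjoint X T"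
  shows "sa_calculus (adjointables X) (op_norm X) (\<circ>) (op_one X) (opev T)"
proof
  show "op_one X \<circ> U = U" if "U \<in> adjointables X" for U
    using that op_closed op_outside zero_closed by (intro ext) (auto simp: op_one_def)
  show "(U - V) \<circ> W = (U \<circ> W) - (V \<circ> W)" for U V W :: "'x \<Rightarrow> 'x" by (rule ext) simp
  show "U \<circ> (V - W) = (U \<circ> V) - (U \<circ> W)"
    if "U \<in> adjointables X" "V \<in> adjointables X" "W \<in> adjointables X" for U V W
  proof
    show "(U \<circ> (V - W)) x = ((U \<circ> V) - (U \<circ> W)) x" for x
      using that op_diff[OF that(1)] op_zero[OF that(1)]
      by (cases "x \<in> elems X") (simp_all add: op_closed op_outside)
  qed
  show "op_norm X (opev T (smult c p)) = cmod c * op_norm X (opev T p)" for c p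
    by (simp add: opev_smult op_norm_scale opev_closed T)
  show "(op_norm X (opev T p))\<^sup>2 \<le> op_norm X (opev T (map_poly cnj p * p))" for p
  proof -
    let ?N = "op_norm X (opev T (map_poly cnj p * p))"
    have N0: "0 \<le> ?N" by (simp add: op_norm_nonneg opev_closed T)
    \<comment> \<open>The C*-inequality comes from |p(T) x|^2 = |<x, (p* p)(T) x>|, where p* has the
      conjugate coefficients.\<close>
    have "op_norm X (opev T p) \<le> sqrt ?N"
    proof (rule op_norm_le)
      fix x assume x: "x \<in> elems X"
      have px: "opev T p x \<in> elems X" using x by (simp add: op_closed opev_closed T)
      have "(mnorm X (opev T p x))\<^sup>2 = norm (ip X x (opev T (map_poly cnj p * p) x))"
        unfolding mnorm_square opev_adjoint[OF T x px] by (simp add: opev_mult T)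
      also have "\<dots> \<le> ?N * (mnorm X x)\<^sup>2" using x by (intro norm_ip_op_le) (simp_all add: opev_closed T)
      also have "\<dots> = (sqrt ?N * mnorm X x)\<^sup>2" using N0 by (simp add: power_mult_distrib)
      finally show "mnorm X (opev T p x) \<le> sqrt ?N * mnorm X x"
        by (rule power2_le_imp_le) (simp add: N0 mnorm_nonneg)
    qed (simp add: N0)
    then have "(op_norm X (opev T p))\<^sup>2 \<le> (sqrt ?N)\<^sup>2"
      by (intro power_mono) (simp_all add: op_norm_nonneg opev_closed T)
    then show ?thesis using N0 by simp
  qed
qed (simp_all add: adjointables_closed op_norm_add op_norm_minus op_norm_eq_0 op_norm_nonneg op_norm_comp
    adjointables_complete opev_closed opev_add opev_mult opev_one T comp_assoc)

section \<open>Spectrum, calculus and form bounds of a self-adjoint operator\<close>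

definition op_rspec :: "('x \<Rightarrow> 'x) \<Rightarrow> real set" where
  "op_rspec T = {t. complex_of_real t \<in> op_spectrum X (adjointables X) T}"

context
  fixes T :: "'x \<Rightarrow> 'x"
  assumes T: "T \<in> adjointables X" "self_adjoint X T"
begin

interpretation A: sa_calculus "adjointables X" "op_norm X" "(\<circ>)" "op_one X" "opev T"
  by (rule sa_calculus_opev[OF T])

lemma op_spectrum_spec: "op_spectrum X (adjointables X) T = A.spec"
  unfolding op_spectrum_def A.spec_def opev_linear[OF T(1)] ..

lemma op_rspec_eq: "op_rspec T = A.apx_spec"
  unfolding op_rspec_def op_spectrum_spec by (rule A.real_spec)

lemma op_spectrum_rspec: "op_spectrum X (adjointables X) T = complex_of_real ` op_rspec T"
  unfolding op_rspec_eq op_spectrum_spec by (rule A.spec_eq)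

lemma compact_op_rspec: "compact (op_rspec T)"
  unfolding op_rspec_eq by (rule A.compact_apx_spec)

text \<open>By Cauchy-Schwarz a gap between t and the values of the quadratic form makes T - t
  bounded below. This locates the spectrum of a matrix from bounds on its form.\<close>

lemma not_op_rspecI:
  assumes K: "0 < K" "\<And>x. x \<in> elems X \<Longrightarrow> K * (mnorm X x)\<^sup>2 \<le> norm (ip X x (T x) - t *\<^sub>R ip X x x)"
  shows "t \<notin> op_rspec T"
proof -
  let ?L = "opev T [:- complex_of_real t, 1:]"
  have lower: "K * mnorm X y \<le> mnorm X (?L y)" if y: "y \<in> elems X" for y
  proof (cases "mnorm X y = 0")
    case False
    have "?L y = T y - act X y (t *\<^sub>R 1)"
      unfolding opev_linear[OF T(1)] using y by (simp add: op_scale_def op_one_def scaleC_of_real)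
    then have "ip X y (T y) - t *\<^sub>R ip X y y = ip X y (?L y)"
      using y T(1) by (simp add: ip_diff_right op_closed act_closed ip_act_scaleR)
    then have "K * (mnorm X y)\<^sup>2 \<le> norm (ip X y (?L y))" using K(2)[OF y] by simp
    also have "\<dots> \<le> mnorm X y * mnorm X (?L y)"
      using y op_closed[OF opev_closed[OF T(1)] y] by (rule Cauchy_Schwarz)
    finally have "mnorm X y * (K * mnorm X y) \<le> mnorm X y * mnorm X (?L y)"
      by (simp add: power2_eq_square mult_ac)
    then show ?thesis using False mnorm_nonneg[of y] by (simp add: mult_le_cancel_left)
  qed (simp add: mnorm_nonneg)
  have "op_norm X (opev T q) \<le> inverse K * op_norm X (opev T ([:- complex_of_real t, 1:] * q))" for q
  proof (rule op_norm_le)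
    show "0 \<le> inverse K * op_norm X (opev T ([:- complex_of_real t, 1:] * q))"
      using K(1) op_norm_nonneg[OF opev_closed[OF T(1)]] by simp
    fix x assume x: "x \<in> elems X"
    have "K * mnorm X (opev T q x) \<le> mnorm X (opev T ([:- complex_of_real t, 1:] * q) x)"
      unfolding opev_mult[OF T(1)] comp_apply by (rule lower[OF op_closed[OF opev_closed[OF T(1)] x]])
    also have "\<dots> \<le> op_norm X (opev T ([:- complex_of_real t, 1:] * q)) * mnorm X x"
      by (rule op_norm_upper[OF opev_closed[OF T(1)] x])
    finally show "mnorm X (opev T q x) \<le> inverse K * op_norm X (opev T ([:- complex_of_real t, 1:] * q)) * mnorm X x"
      using K(1) by (simp add: field_simps del: mult_pCons_left)
  qed
  then have "A.bdd_below_at [:- complex_of_real t, 1:]" unfolding A.bdd_below_at_def by blast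
  then show ?thesis unfolding op_rspec_eq A.apx_spec_def by simp
qed

lemma op_norm_poly_le:
  "0 \<le> M \<Longrightarrow> (\<And>t. t \<in> op_rspec T \<Longrightarrow> \<bar>poly P t\<bar> \<le> M) \<Longrightarrow> op_norm X (op_poly X P T) \<le> M"
  unfolding op_rspec_eq opev_cpoly[OF T(1), symmetric] by (rule A.N_le_sup)

lemma op_cfc:
  assumes "continuous_on (op_rspec T) f"
  shows "op_cfc X (adjointables X) f T \<in> adjointables X"
    and "0 \<le> M \<Longrightarrow> (\<And>t. t \<in> op_rspec T \<Longrightarrow> \<bar>poly P t - f t\<bar> \<le> M) \<Longrightarrow>
      op_norm X (op_poly X P T - op_cfc X (adjointables X) f T) \<le> M"
proof -
  have "op_cfc X (adjointables X) f T \<in> adjointables X \<and>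
    (\<forall>M P. 0 \<le> M \<longrightarrow> (\<forall>t\<in>op_rspec T. \<bar>poly P t - f t\<bar> \<le> M) \<longrightarrow>
      op_norm X (op_poly X P T - op_cfc X (adjointables X) f T) \<le> M)"
  proof (rule A.calculus[OF assms[unfolded op_rspec_eq]], unfold opev_cpoly[OF T(1)] op_rspec_eq[symmetric])
    fix U
    assume U: "U \<in> adjointables X"
      "\<And>p :: nat \<Rightarrow> real poly. uniform_limit (op_rspec T) (\<lambda>m. poly (p m)) f sequentially \<Longrightarrow>
        (\<lambda>m. op_norm X (op_poly X (p m) T - U)) \<longlonglongrightarrow> 0"
      "\<And>V. V \<in> adjointables X \<Longrightarrow>
        (\<And>p :: nat \<Rightarrow> real poly. uniform_limit (op_rspec T) (\<lambda>m. poly (p m)) f sequentially \<Longrightarrow>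
          (\<lambda>m. op_norm X (op_poly X (p m) T - V)) \<longlonglongrightarrow> 0) \<Longrightarrow> V = U"
      "\<And>P M. 0 \<le> M \<Longrightarrow> (\<And>t. t \<in> op_rspec T \<Longrightarrow> \<bar>poly P t - f t\<bar> \<le> M) \<Longrightarrow>
        op_norm X (op_poly X P T - U) \<le> M"
    have "op_cfc X (adjointables X) f T = U"
      unfolding op_cfc_def op_rspec_def[symmetric]
    proof (rule the_equality)
      fix V
      assume V: "V \<in> adjointables X \<and> (\<forall>p :: nat \<Rightarrow> real poly.
        uniform_limit (op_rspec T) (\<lambda>m. poly (p m)) f sequentially \<longrightarrow>
          (\<lambda>m. op_norm X (op_poly X (p m) T - V)) \<longlonglongrightarrow> 0)"
      then show "V = U" by (intro U(3)) blast+
    qed (use U(1,2) in blast)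
    then show ?thesis using U(1,4) by blast
  qed
  then show "op_cfc X (adjointables X) f T \<in> adjointables X"
    and "0 \<le> M \<Longrightarrow> (\<And>t. t \<in> op_rspec T \<Longrightarrow> \<bar>poly P t - f t\<bar> \<le> M) \<Longrightarrow>
      op_norm X (op_poly X P T - op_cfc X (adjointables X) f T) \<le> M"
    by blast+
qed

lemma op_poly_closed: "op_poly X P T \<in> adjointables X"
  unfolding opev_cpoly[OF T(1), symmetric] by (rule opev_closed[OF T(1)])

lemma op_poly_simps:
  "op_poly X (P + Q) T = op_poly X P T + op_poly X Q T"
  "op_poly X (P - Q) T = op_poly X P T - op_poly X Q T"
  "op_poly X (P * Q) T = op_poly X P T \<circ> op_poly X Q T"
  unfolding opev_cpoly[OF T(1), symmetric] cpoly_simps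
  by (simp_all add: opev_add opev_mult T A.ev_diff)

lemma op_poly_linear: "op_poly X [:r, s:] T x = act X x (r *\<^sub>R 1) + act X (T x) (s *\<^sub>R 1)" if "x \<in> elems X"
  using that op_zero[OF T(1)] op_act[OF T(1)]
  unfolding opev_cpoly[OF T(1), symmetric]
  by (simp add: map_poly_pCons opev_pCons_apply[OF T(1)] scaleC_of_real)

lemma ip_op_poly_self_adjoint:
  assumes "x \<in> elems X" "y \<in> elems X"
  shows "ip X (op_poly X P T x) y = ip X x (op_poly X P T y)"
  unfolding opev_cpoly[OF T(1), symmetric] opev_adjoint[OF T assms]
  by (simp add: map_poly_map_poly o_def)

text \<open>If P were a square g^2, the element would be <g(T) x, g(T) x>. In general P is a uniform
  limit of such squares on the spectrum.\<close>

lemma ip_op_poly_pos: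
  assumes P: "\<And>t. t \<in> op_rspec T \<Longrightarrow> 0 \<le> poly P t" and x: "x \<in> elems X"
  shows "cstar_pos (ip X x (op_poly X P T x))"
proof -
  have "continuous_on (op_rspec T) (poly P)" by (intro continuous_intros)
  then obtain g :: "nat \<Rightarrow> real poly" and M where M: "0 \<le> M"
    and g: "\<And>m t. t \<in> op_rspec T \<Longrightarrow> \<bar>poly (g m) t * poly (g m) t - poly P t\<bar> \<le> inverse (real (Suc m)) * M"
    by (rule sqrt_approximation[OF compact_op_rspec _ P]) (assumption, rule that)
  define c where "c m = op_poly X (g m) T" for m
  have c: "c m \<in> adjointables X" for m by (simp add: c_def op_poly_closed)
  have le: "op_norm X (op_poly X (g m * g m - P) T) \<le> inverse (real (Suc m)) * M" for m
    using g M by (intro op_norm_poly_le) simp_all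
  have bound: "norm (ip X x (c m (c m x)) - ip X x (op_poly X P T x)) \<le> inverse (real (Suc m)) * (M * (mnorm X x)\<^sup>2)" for m
  proof -
    have "ip X x (c m (c m x)) - ip X x (op_poly X P T x) = ip X x (op_poly X (g m * g m - P) T x)"
      using x c op_poly_closed by (simp add: op_poly_simps ip_diff_right op_closed c_def)
    also have "norm \<dots> \<le> op_norm X (op_poly X (g m * g m - P) T) * (mnorm X x)\<^sup>2"
      by (intro norm_ip_op_le op_poly_closed x)
    also have "\<dots> \<le> (inverse (real (Suc m)) * M) * (mnorm X x)\<^sup>2"
      by (intro mult_right_mono le) simp
    finally show ?thesis by (simp only: mult.assoc)
  qed
  have "(\<lambda>m. ip X x (c m (c m x)) - ip X x (op_poly X P T x)) \<longlonglongrightarrow> 0"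
    by (rule Lim_null_comparison[OF _ tendsto_mult_left_zero[OF LIMSEQ_inverse_real_of_nat, of "M * (mnorm X x)\<^sup>2"]])
      (use bound in simp)
  then have lim: "(\<lambda>m. ip X x (c m (c m x))) \<longlonglongrightarrow> ip X x (op_poly X P T x)" by (rule LIM_zero_cancel)
  have "ip X x (c m (c m x)) = ip X (c m x) (c m x)" for m
    unfolding c_def using x op_poly_closed by (simp add: ip_op_poly_self_adjoint op_closed)
  then have "cstar_pos (ip X x (c m (c m x)))" for m
    using ip_pos[OF op_closed[OF c x]] by simp
  then show ?thesis using lim by (rule cstar_pos_limit)
qed

text \<open>The passage from spectra to quadratic forms; the compression argument knows the
  operators' spectra only in this shape.\<close>

lemma ip_op_bounds:
  assumes "op_rspec T \<subseteq> {\<alpha>..\<beta>}" and x: "x \<in> elems X"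
  shows "cstar_pos (ip X x (T x) - \<alpha> *\<^sub>R ip X x x)" "cstar_pos (\<beta> *\<^sub>R ip X x x - ip X x (T x))"
proof -
  have "cstar_pos (ip X x (op_poly X [:- \<alpha>, 1:] T x))" "cstar_pos (ip X x (op_poly X [:\<beta>, - 1:] T x))"
    using assms by (intro ip_op_poly_pos; auto)+
  then show "cstar_pos (ip X x (T x) - \<alpha> *\<^sub>R ip X x x)" "cstar_pos (\<beta> *\<^sub>R ip X x x - ip X x (T x))"
    using x op_closed[OF T(1) x]
    by (simp_all add: op_poly_linear ip_add_right ip_act_scaleR act_closed ip_act_right)
qed

end

end

section \<open>Finite-dimensional Hilbert spaces\<close>

lemma spectrum_complex: "spectrum (z :: complex) = {z}"
proof -
  have "(\<exists>b. b * (z - c) = 1 \<and> (z - c) * b = 1) \<longleftrightarrow> z \<noteq> c" for c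
  proof
    assume "z \<noteq> c"
    then show "\<exists>b. b * (z - c) = 1 \<and> (z - c) * b = 1" by (intro exI[of _ "inverse (z - c)"]) simp
  qed auto
  then show ?thesis by (auto simp: spectrum_def scaleC_complex_def)
qed

lemma cstar_pos_complex: "cstar_pos z \<longleftrightarrow> Im z = 0 \<and> 0 \<le> Re z"
proof -
  have "cnj z = z \<longleftrightarrow> Im z = 0" by (auto simp: complex_eq_iff)
  then show ?thesis
    unfolding cstar_pos_def spectrum_complex star_complex_def
    by (auto simp: complex_eq_iff intro!: image_eqI[of _ _ "Re z"])
qed

section \<open>The space of complex N-tuples\<close>

text \<open>Placed inside \<open>nat \<Rightarrow> complex\<close>, the ambient type over which
  \<open>operator_convex\<close> quantifies.\<close>

definition cvec :: "nat \<Rightarrow> (nat \<Rightarrow> complex, complex) hmodule" where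
  "cvec N = \<lparr>elems = {v. \<forall>i\<ge>N. v i = 0}, act = (\<lambda>v c i. v i * c), ip = (\<lambda>u v. \<Sum>i<N. cnj (u i) * v i)\<rparr>"

lemma cvec_simps:
  "v \<in> elems (cvec N) \<longleftrightarrow> (\<forall>i\<ge>N. v i = 0)" "act (cvec N) v c = (\<lambda>i. v i * c)"
  "ip (cvec N) u v = (\<Sum>i<N. cnj (u i) * v i)"
  by (simp_all add: cvec_def)

lemma ip_cvec_self: "ip (cvec N) v v = complex_of_real (\<Sum>i<N. (cmod (v i))\<^sup>2)"
  unfolding cvec_simps of_real_sum
  by (intro sum.cong refl) (metis complex_norm_square mult.commute)

lemma mnorm_cvec: "mnorm (cvec N) v = sqrt (\<Sum>i<N. (cmod (v i))\<^sup>2)"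
  unfolding mnorm_def ip_cvec_self norm_of_real by (simp add: sum_nonneg)

lemma cmod_le_mnorm_cvec: "i < N \<Longrightarrow> cmod (v i) \<le> mnorm (cvec N) v"
  unfolding mnorm_cvec by (rule real_le_rsqrt) (rule member_le_sum, auto)

lemma hilbert_module_cvec: "hilbert_module (cvec N)"
proof
  show "cstar_pos (ip (cvec N) v v)" for v
    by (simp add: ip_cvec_self cstar_pos_complex sum_nonneg)
  show "v = 0" if "v \<in> elems (cvec N)" "ip (cvec N) v v = 0" for v
  proof
    have "(\<Sum>i<N. (cmod (v i))\<^sup>2) = 0" using that(2) unfolding ip_cvec_self by (simp only: of_real_eq_0_iff)
    then have "\<forall>i<N. v i = 0" by (simp add: sum_nonneg_eq_0_iff)
    then show "v i = 0 i" for i using that(1) by (cases "i < N") (auto simp: cvec_simps)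
  qed
  show "star (ip (cvec N) u v) = ip (cvec N) v u" for u v
    by (simp add: cvec_simps star_complex_def mult.commute)
next
  fix s :: "nat \<Rightarrow> nat \<Rightarrow> complex"
  assume s: "\<And>m. s m \<in> elems (cvec N)"
    and C: "\<forall>e>0. \<exists>M. \<forall>i\<ge>M. \<forall>j\<ge>M. mnorm (cvec N) (s i - s j) < e"
  have "\<exists>l. (\<lambda>m. s m k) \<longlonglongrightarrow> l" if "k < N" for k
  proof -
    have "Cauchy (\<lambda>m. s m k)"
      unfolding Cauchy_def dist_norm
    proof (intro allI impI)
      fix e :: real assume "e > 0"
      then obtain M where M: "\<And>i j. i \<ge> M \<Longrightarrow> j \<ge> M \<Longrightarrow> mnorm (cvec N) (s i - s j) < e" using C by blast
      have "cmod (s i k - s j k) < e" if "i \<ge> M" "j \<ge> M" for i j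
        using cmod_le_mnorm_cvec[OF \<open>k < N\<close>, of "s i - s j"] M[OF that] by simp
      then show "\<exists>M. \<forall>m\<ge>M. \<forall>n\<ge>M. cmod (s m k - s n k) < e" by blast
    qed
    then show ?thesis by (simp add: Cauchy_convergent_iff convergent_def)
  qed
  then obtain l where l: "\<And>k. k < N \<Longrightarrow> (\<lambda>m. s m k) \<longlonglongrightarrow> l k" by metis
  define l' where "l' k = (if k < N then l k else 0)" for k
  have "(\<lambda>m. sqrt (\<Sum>k<N. (cmod ((s m - l') k))\<^sup>2)) \<longlonglongrightarrow> sqrt (\<Sum>k<N. (cmod (l k - l k))\<^sup>2)"
  proof (intro tendsto_intros)
    fix k assume "k \<in> {..<N}"
    then show "(\<lambda>m. (s m - l') k) \<longlonglongrightarrow> l k - l k"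
      using tendsto_diff[OF l[of k] tendsto_const[of "l k"]] by (simp add: l'_def)
  qed
  then have "(\<lambda>m. mnorm (cvec N) (s m - l')) \<longlonglongrightarrow> 0" by (simp add: mnorm_cvec)
  moreover have "l' \<in> elems (cvec N)" by (simp add: cvec_simps l'_def)
  ultimately show "\<exists>l\<in>elems (cvec N). (\<lambda>m. mnorm (cvec N) (s m - l)) \<longlonglongrightarrow> 0" by blast
qed (auto simp: cvec_simps algebra_simps sum.distrib sum_distrib_left)

text \<open>The calculus above is relative to \<open>adjointables\<close>, operator convexity is
  stated relative to \<open>bounded_ops\<close>. They agree here because the conjugate transpose is
  an adjoint of any linear map.\<close>

lemma bounded_ops_cvec: "bounded_ops (cvec N) = adjointables (cvec N)"
proof -
  interpret hilbert_module "cvec N" by (rule hilbert_module_cvec)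
  have "T \<in> adjointables (cvec N)" if T: "T \<in> bounded_ops (cvec N)" for T
  proof -
    have op: "operator_on (cvec N) T" and add: "\<And>x y. x \<in> elems (cvec N) \<Longrightarrow> y \<in> elems (cvec N) \<Longrightarrow> T (x + y) = T x + T y"
      and act: "\<And>x a. x \<in> elems (cvec N) \<Longrightarrow> T (act (cvec N) x a) = act (cvec N) (T x) a"
      using T unfolding bounded_ops_def by blast+
    \<comment> \<open>The condition \<open>i < N\<close> keeps \<open>e j\<close> in the space for
      every j; it is 0 from N on.\<close>
    define e :: "nat \<Rightarrow> nat \<Rightarrow> complex" where "e j = (\<lambda>i. if i = j \<and> i < N then 1 else 0)" for j
    have e: "e j \<in> elems (cvec N)" for j by (simp add: e_def cvec_simps)
    have T0: "T 0 = 0" using add[of 0 0] zero_closed by simp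
    have Tsum: "T (\<Sum>j\<in>I. act (cvec N) (e j) (c j)) = (\<Sum>j\<in>I. act (cvec N) (T (e j)) (c j))" for I :: "nat set" and c
    proof (induction I rule: infinite_finite_induct)
      case (insert j I)
      have "T (act (cvec N) (e j) (c j) + (\<Sum>j\<in>I. act (cvec N) (e j) (c j)))
          = T (act (cvec N) (e j) (c j)) + T (\<Sum>j\<in>I. act (cvec N) (e j) (c j))"
        by (intro add sum_closed act_closed e)
      then show ?case by (simp only: sum.insert[OF insert.hyps] act[OF e] insert.IH)
    qed (simp_all only: sum.infinite sum.empty T0 not_False_eq_True)
    have expand: "x = (\<Sum>j<N. act (cvec N) (e j) (x j))" if "x \<in> elems (cvec N)" for x
    proof
      show "x i = (\<Sum>j<N. act (cvec N) (e j) (x j)) i" for i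
        using that by (cases "i < N") (simp_all add: cvec_simps sum_fun_apply e_def if_distrib[of "\<lambda>z. z * _"] cong: if_cong)
    qed
    have Tx: "T x k = (\<Sum>j<N. T (e j) k * x j)" if "x \<in> elems (cvec N)" for x k
      using arg_cong[OF expand[OF that], of T] unfolding Tsum
      by (metis (no_types, lifting) cvec_simps(2) sum.cong sum_fun_apply)
    define U where "U y = (\<lambda>i. if i < N \<and> y \<in> elems (cvec N) then \<Sum>k<N. cnj (T (e i) k) * y k else 0)" for y
    have "is_adjoint T U"
      unfolding is_adjoint_def
    proof (intro conjI ballI op)
      show "operator_on (cvec N) U" by (auto simp: operator_on_def U_def cvec_simps fun_eq_iff)
      fix x y assume xy: "x \<in> elems (cvec N)" "y \<in> elems (cvec N)"
      have "ip (cvec N) (T x) y = (\<Sum>k<N. \<Sum>j<N. cnj (T (e j) k) * cnj (x j) * y k)"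
        by (simp add: cvec_simps Tx[OF xy(1)] sum_distrib_right)
      also have "\<dots> = (\<Sum>j<N. \<Sum>k<N. cnj (T (e j) k) * cnj (x j) * y k)" by (rule sum.swap)
      also have "\<dots> = ip (cvec N) x (U y)"
        using xy(2) by (simp add: cvec_simps(3) U_def sum_distrib_left mult_ac)
      finally show "ip (cvec N) (T x) y = ip (cvec N) x (U y)" .
    qed
    then show ?thesis using adjointables_iff by blast
  qed
  moreover have "T \<in> bounded_ops (cvec N)" if "T \<in> adjointables (cvec N)" for T
    using that adjointable_bounded[OF that] op_add[OF that] op_act[OF that]
    by (auto simp: bounded_ops_def adjointables_def)
  ultimately show ?thesis by blast
qed

section \<open>Real symmetric matrices and operator convexity\<close>

definition matvec :: "nat \<Rightarrow> (nat \<Rightarrow> nat \<Rightarrow> real) \<Rightarrow> (nat \<Rightarrow> real) \<Rightarrow> nat \<Rightarrow> real" where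
  "matvec N A v = (\<lambda>i. if i < N then \<Sum>j<N. A i j * v j else 0)"

text \<open>Real matrices on complex vectors: the functionals used here are real-valued and give
  real matrices, while operator convexity is stated for complex spaces.\<close>

definition matop :: "nat \<Rightarrow> (nat \<Rightarrow> nat \<Rightarrow> real) \<Rightarrow> (nat \<Rightarrow> complex) \<Rightarrow> nat \<Rightarrow> complex" where
  "matop N A v = (\<lambda>i. if i < N \<and> v \<in> elems (cvec N) then \<Sum>j<N. complex_of_real (A i j) * v j else 0)"

text \<open>The quadratic form of P(A) at v, written in the moments that the compression argument
  delivers.\<close>

definition poly_form :: "nat \<Rightarrow> real poly \<Rightarrow> (nat \<Rightarrow> nat \<Rightarrow> real) \<Rightarrow> (nat \<Rightarrow> real) \<Rightarrow> real" where
  "poly_form N P A v = (\<Sum>m\<le>degree P. coeff P m * (\<Sum>k<N. v k * (matvec N A ^^ m) v k))"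

text \<open>The order relation \<alpha> \<le> A \<le> \<beta>, tested on real vectors. For symmetric
  A it extends to complex vectors through their real and imaginary parts, see
  \<open>ip_matop\<close>.\<close>

definition form_bounds :: "nat \<Rightarrow> real \<Rightarrow> real \<Rightarrow> (nat \<Rightarrow> nat \<Rightarrow> real) \<Rightarrow> bool" where
  "form_bounds N \<alpha> \<beta> A \<longleftrightarrow> (\<forall>c. \<alpha> * (\<Sum>i<N. (c i)\<^sup>2) \<le> (\<Sum>i<N. \<Sum>j<N. c i * A i j * c j)
      \<and> (\<Sum>i<N. \<Sum>j<N. c i * A i j * c j) \<le> \<beta> * (\<Sum>i<N. (c i)\<^sup>2))"

context
  fixes N :: nat and A :: "nat \<Rightarrow> nat \<Rightarrow> real"
  assumes sym: "\<And>i j. A i j = A j i"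
begin

interpretation hilbert_module "cvec N" by (rule hilbert_module_cvec)

lemma matop_ip:
  assumes "x \<in> elems (cvec N)" "y \<in> elems (cvec N)"
  shows "ip (cvec N) (matop N A x) y = ip (cvec N) x (matop N A y)"
proof -
  have "ip (cvec N) (matop N A x) y = (\<Sum>k<N. \<Sum>j<N. complex_of_real (A k j) * cnj (x j) * y k)"
    using assms(1) by (simp add: cvec_simps(3) matop_def sum_distrib_right)
  also have "\<dots> = (\<Sum>j<N. \<Sum>k<N. complex_of_real (A k j) * cnj (x j) * y k)" by (rule sum.swap)
  also have "\<dots> = (\<Sum>j<N. \<Sum>k<N. cnj (x j) * (complex_of_real (A j k) * y k))"
    by (intro sum.cong refl) (simp add: sym mult_ac)
  also have "\<dots> = ip (cvec N) x (matop N A y)"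
    using assms(2) by (simp add: cvec_simps(3) matop_def sum_distrib_left)
  finally show ?thesis .
qed

lemma matop_adjointable: "matop N A \<in> adjointables (cvec N)"
proof -
  have "operator_on (cvec N) (matop N A)" by (auto simp: operator_on_def matop_def cvec_simps fun_eq_iff)
  then have "is_adjoint (matop N A) (matop N A)" unfolding is_adjoint_def using matop_ip by simp
  then show ?thesis using adjointables_iff by blast
qed

lemma matop_self_adjoint: "self_adjoint (cvec N) (matop N A)"
  using matop_ip by (simp add: self_adjoint_def)

lemma ip_matop:
  assumes x: "x \<in> elems (cvec N)"
  shows "ip (cvec N) x (matop N A x) = complex_of_real
    ((\<Sum>i<N. \<Sum>j<N. Re (x i) * A i j * Re (x j)) + (\<Sum>i<N. \<Sum>j<N. Im (x i) * A i j * Im (x j)))"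
proof -
  have eq: "ip (cvec N) x (matop N A x) = (\<Sum>i<N. \<Sum>j<N. cnj (x i) * (complex_of_real (A i j) * x j))"
    using x by (simp add: cvec_simps(3) matop_def sum_distrib_left)
  have "cnj (ip (cvec N) x (matop N A x)) = ip (cvec N) (matop N A x) x"
    using ip_star[OF x op_closed[OF matop_adjointable x]] by (simp add: star_complex_def)
  then have "cnj (ip (cvec N) x (matop N A x)) = ip (cvec N) x (matop N A x)"
    by (simp add: matop_ip[OF x x])
  then have "Im (ip (cvec N) x (matop N A x)) = 0" by (simp add: complex_eq_iff)
  moreover have "Re (ip (cvec N) x (matop N A x)) =
      (\<Sum>i<N. \<Sum>j<N. Re (x i) * A i j * Re (x j)) + (\<Sum>i<N. \<Sum>j<N. Im (x i) * A i j * Im (x j))"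
    unfolding eq sum.distrib[symmetric] Re_sum by (intro sum.cong refl) (simp add: algebra_simps)
  ultimately show ?thesis by (simp add: complex_eq_iff)
qed

lemma op_rspec_matop:
  assumes "form_bounds N \<alpha> \<beta> A"
  shows "op_rspec (matop N A) \<subseteq> {\<alpha>..\<beta>}"
proof
  fix t assume t: "t \<in> op_rspec (matop N A)"
  define q where "q x = (\<Sum>i<N. \<Sum>j<N. Re (x i) * A i j * Re (x j)) + (\<Sum>i<N. \<Sum>j<N. Im (x i) * A i j * Im (x j))"
    for x :: "nat \<Rightarrow> complex"
  define n where "n x = (\<Sum>i<N. (cmod (x i))\<^sup>2)" for x :: "nat \<Rightarrow> complex"
  have n: "n x = (\<Sum>i<N. (Re (x i))\<^sup>2) + (\<Sum>i<N. (Im (x i))\<^sup>2)" for x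
    by (simp add: n_def cmod_power2 sum.distrib)
  have b: "\<alpha> * n x \<le> q x" "q x \<le> \<beta> * n x" for x
    using assms unfolding form_bounds_def q_def n distrib_left by (meson add_mono)+
  have n0: "0 \<le> n x" for x by (simp add: n_def sum_nonneg)
  have val: "norm (ip (cvec N) x (matop N A x) - t *\<^sub>R ip (cvec N) x x) = \<bar>q x - t * n x\<bar>"
    and nrm: "(mnorm (cvec N) x)\<^sup>2 = n x" if "x \<in> elems (cvec N)" for x
  proof -
    have "ip (cvec N) x (matop N A x) - t *\<^sub>R ip (cvec N) x x = complex_of_real (q x - t * n x)"
      unfolding ip_matop[OF that] ip_cvec_self q_def n_def by (simp add: scaleR_conv_of_real)
    then show "norm (ip (cvec N) x (matop N A x) - t *\<^sub>R ip (cvec N) x x) = \<bar>q x - t * n x\<bar>"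
      by (simp only: norm_of_real)
    show "(mnorm (cvec N) x)\<^sup>2 = n x" unfolding mnorm_cvec n_def by (simp add: sum_nonneg)
  qed
  have "\<alpha> \<le> t"
  proof (rule ccontr)
    assume lt: "\<not> \<alpha> \<le> t"
    have "t \<notin> op_rspec (matop N A)"
    proof (rule not_op_rspecI[OF matop_adjointable matop_self_adjoint, of "\<alpha> - t"])
      fix x assume "x \<in> elems (cvec N)"
      then show "(\<alpha> - t) * (mnorm (cvec N) x)\<^sup>2 \<le> norm (ip (cvec N) x (matop N A x) - t *\<^sub>R ip (cvec N) x x)"
        using b(1)[of x] by (simp add: val nrm left_diff_distrib)
    qed (use lt in simp)
    then show False using t by simp
  qed
  moreover have "t \<le> \<beta>"
  proof (rule ccontr)
    assume lt: "\<not> t \<le> \<beta>"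
    have "t \<notin> op_rspec (matop N A)"
    proof (rule not_op_rspecI[OF matop_adjointable matop_self_adjoint, of "t - \<beta>"])
      fix x assume "x \<in> elems (cvec N)"
      then show "(t - \<beta>) * (mnorm (cvec N) x)\<^sup>2 \<le> norm (ip (cvec N) x (matop N A x) - t *\<^sub>R ip (cvec N) x x)"
        using b(2)[of x] by (simp add: val nrm left_diff_distrib)
    qed (use lt in simp)
    then show False using t by simp
  qed
  ultimately show "t \<in> {\<alpha>..\<beta>}" by simp
qed

lemma ip_op_poly_matop:
  assumes v: "\<And>i. i \<ge> N \<Longrightarrow> v i = 0"
  shows "ip (cvec N) (\<lambda>i. complex_of_real (v i)) (op_poly (cvec N) P (matop N A) (\<lambda>i. complex_of_real (v i)))
    = complex_of_real (poly_form N P A v)"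
proof -
  let ?c = "\<lambda>v i. complex_of_real (v i)"
  have supp: "(matvec N A ^^ m) v i = 0" if "i \<ge> N" for m i
    using that v by (cases m) (simp_all add: matvec_def)
  have cv: "?c ((matvec N A ^^ m) v) \<in> elems (cvec N)" for m
    using supp by (simp add: cvec_simps)
  have it: "(matop N A ^^ m) (?c v) = ?c ((matvec N A ^^ m) v)" for m
  proof (induction m)
    case (Suc m)
    have "matop N A (?c w) = ?c (matvec N A w)" if "?c w \<in> elems (cvec N)" for w
      using that by (simp add: matop_def matvec_def fun_eq_iff)
    from this[OF cv] show ?case by (simp only: funpow.simps comp_apply Suc)
  qed simp
  have "op_poly (cvec N) P (matop N A) (?c v) = (\<Sum>m\<le>degree P. act (cvec N) (?c ((matvec N A ^^ m) v)) (complex_of_real (coeff P m)))"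
    using cv[of 0] unfolding op_poly_def sum_fun_apply
    by (simp add: op_scale_def op_one_def it scaleC_complex_def)
  then have "ip (cvec N) (?c v) (op_poly (cvec N) P (matop N A) (?c v))
      = (\<Sum>m\<le>degree P. ip (cvec N) (?c v) (act (cvec N) (?c ((matvec N A ^^ m) v)) (complex_of_real (coeff P m))))"
    using cv[of 0] by (simp add: ip_sum_right act_closed cv)
  also have "\<dots> = complex_of_real (poly_form N P A v)"
    by (simp add: poly_form_def cvec_simps sum_distrib_left mult_ac)
  finally show ?thesis .
qed

lemma op_cfc_matop_close:
  assumes bounds: "form_bounds N \<alpha> \<beta> A" and f: "continuous_on {\<alpha>..\<beta>} f"
    and P: "0 \<le> \<epsilon>" "\<And>t. t \<in> {\<alpha>..\<beta>} \<Longrightarrow> \<bar>poly P t - f t\<bar> \<le> \<epsilon>" and v: "\<And>i. i \<ge> N \<Longrightarrow> v i = 0"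
  shows "\<bar>poly_form N P A v - Re (ip (cvec N) (\<lambda>i. complex_of_real (v i))
      (op_cfc (cvec N) (bounded_ops (cvec N)) f (matop N A) (\<lambda>i. complex_of_real (v i))))\<bar> \<le> \<epsilon> * (\<Sum>i<N. (v i)\<^sup>2)"
proof -
  let ?h = "\<lambda>i. complex_of_real (v i)"
  let ?U = "op_cfc (cvec N) (adjointables (cvec N)) f (matop N A)"
  let ?PA = "op_poly (cvec N) P (matop N A)"
  note T = matop_adjointable matop_self_adjoint
  have h: "?h \<in> elems (cvec N)" using v by (simp add: cvec_simps)
  have sub: "op_rspec (matop N A) \<subseteq> {\<alpha>..\<beta>}" using bounds by (rule op_rspec_matop)
  have cont: "continuous_on (op_rspec (matop N A)) f" using f sub by (rule continuous_on_subset)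
  have U: "?U \<in> adjointables (cvec N)" using T cont by (rule op_cfc(1))
  have close: "op_norm (cvec N) (?PA - ?U) \<le> \<epsilon>" using P sub by (intro op_cfc(2)[OF T cont]) auto
  have PA: "?PA \<in> adjointables (cvec N)" using T by (rule op_poly_closed)
  have "cmod (ip (cvec N) ?h ((?PA - ?U) ?h)) \<le> op_norm (cvec N) (?PA - ?U) * (mnorm (cvec N) ?h)\<^sup>2"
    using adjointables_diff[OF PA U] h by (rule norm_ip_op_le)
  also have "\<dots> \<le> \<epsilon> * (mnorm (cvec N) ?h)\<^sup>2" using close by (rule mult_right_mono) simp
  also have "(mnorm (cvec N) ?h)\<^sup>2 = (\<Sum>i<N. (v i)\<^sup>2)" by (simp add: mnorm_cvec sum_nonneg)
  also have "ip (cvec N) ?h ((?PA - ?U) ?h) = complex_of_real (poly_form N P A v) - ip (cvec N) ?h (?U ?h)"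
    using h op_closed[OF PA h] op_closed[OF U h] ip_op_poly_matop[OF v] by (simp add: ip_diff_right)
  finally show ?thesis
    unfolding bounded_ops_cvec
    using abs_Re_le_cmod[of "complex_of_real (poly_form N P A v) - ip (cvec N) ?h (?U ?h)"] by simp
qed

end

text \<open>Midpoint convexity tested on one vector. Exchanging f for P costs \<epsilon> |v|^2 on
  the left and another \<epsilon> |v|^2 for the average on the right.\<close>

theorem operator_convex_poly_form:
  assumes convex: "operator_convex J f" and J: "{\<alpha>..\<beta>} \<subseteq> J"
    and P: "0 \<le> \<epsilon>" "\<And>t. t \<in> {\<alpha>..\<beta>} \<Longrightarrow> \<bar>poly P t - f t\<bar> \<le> \<epsilon>"
    and A: "\<And>i j. A i j = A j i" "form_bounds N \<alpha> \<beta> A"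
    and B: "\<And>i j. B i j = B j i" "form_bounds N \<alpha> \<beta> B"
    and C: "\<And>i j. C i j = (A i j + B i j) / 2" and v: "\<And>i. i \<ge> N \<Longrightarrow> v i = 0"
  shows "poly_form N P C v \<le> (poly_form N P A v + poly_form N P B v) / 2 + 2 * \<epsilon> * (\<Sum>i<N. (v i)\<^sup>2)"
proof -
  interpret hilbert_module "cvec N" by (rule hilbert_module_cvec)
  let ?H = "cvec N" and ?h = "\<lambda>i. complex_of_real (v i)"
  have h: "?h \<in> elems ?H" using v by (simp add: cvec_simps)
  have C': "\<And>i j. C i j = C j i" "form_bounds N \<alpha> \<beta> C"
  proof -
    show "C i j = C j i" for i j by (simp add: C A(1)[of i j] B(1)[of i j])
    have "(\<Sum>i<N. \<Sum>j<N. c i * C i j * c j)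
        = ((\<Sum>i<N. \<Sum>j<N. c i * A i j * c j) + (\<Sum>i<N. \<Sum>j<N. c i * B i j * c j)) / 2" for c
      unfolding sum.distrib[symmetric] sum_divide_distrib
      by (intro sum.cong refl) (simp add: C field_simps)
    moreover have "\<alpha> * s \<le> (a + b) / 2 \<and> (a + b) / 2 \<le> \<beta> * s"
      if "\<alpha> * s \<le> a \<and> a \<le> \<beta> * s" "\<alpha> * s \<le> b \<and> b \<le> \<beta> * s" for a b s using that by auto
    ultimately show "form_bounds N \<alpha> \<beta> C" using A(2) B(2) unfolding form_bounds_def by presburger
  qed
  have cont: "continuous_on {\<alpha>..\<beta>} f" using convex J continuous_on_subset unfolding operator_convex_def by blast
  have spec: "op_spectrum ?H (bounded_ops ?H) (matop N D) \<subseteq> complex_of_real ` J"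
    if D: "\<And>i j. D i j = D j i" "form_bounds N \<alpha> \<beta> D" for D
    unfolding bounded_ops_cvec op_spectrum_rspec[OF matop_adjointable[OF D(1)] matop_self_adjoint[OF D(1)]]
    using op_rspec_matop[OF D(1) D(2)] J by blast
  have conv: "\<forall>A\<in>bounded_ops ?H. \<forall>B\<in>bounded_ops ?H. \<forall>l\<in>{0..1::real}.
         self_adjoint ?H A \<longrightarrow> self_adjoint ?H B \<longrightarrow>
         op_spectrum ?H (bounded_ops ?H) A \<subseteq> complex_of_real ` J \<longrightarrow>
         op_spectrum ?H (bounded_ops ?H) B \<subseteq> complex_of_real ` J \<longrightarrow>
         (\<forall>h\<in>elems ?H.
           ip ?H h (op_cfc ?H (bounded_ops ?H) f
                     (op_scale ?H (of_real (1 - l)) A + op_scale ?H (of_real l) B) h)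
           \<preceq> ip ?H h ((op_scale ?H (of_real (1 - l)) (op_cfc ?H (bounded_ops ?H) f A) +
                        op_scale ?H (of_real l) (op_cfc ?H (bounded_ops ?H) f B)) h))"
    using convex hilbert_module_cvec[of N] unfolding operator_convex_def by blast
  let ?F = "\<lambda>D. op_cfc ?H (bounded_ops ?H) f (matop N D)"
  have mem: "matop N D \<in> bounded_ops ?H" "self_adjoint ?H (matop N D)" if "\<And>i j. D i j = D j i" for D
    unfolding bounded_ops_cvec using that by (rule matop_adjointable, rule matop_self_adjoint)
  have "ip ?H ?h (op_cfc ?H (bounded_ops ?H) f
          (op_scale ?H (of_real (1 - 1/2)) (matop N A) + op_scale ?H (of_real (1/2)) (matop N B)) ?h)
      \<preceq> ip ?H ?h ((op_scale ?H (of_real (1 - 1/2)) (?F A) + op_scale ?H (of_real (1/2)) (?F B)) ?h)"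
    by (rule conv[rule_format]) (use mem A B spec h in auto)
  also have "op_scale ?H (of_real (1 - 1/2)) (matop N A) + op_scale ?H (of_real (1/2)) (matop N B) = matop N C"
    by (rule ext, rule ext)
       (simp add: op_scale_def cvec_simps(2) matop_def C scaleC_complex_def sum.distrib[symmetric]
        sum_divide_distrib add_divide_distrib distrib_right)
  finally have "0 \<le> Re (ip ?H ?h ((op_scale ?H (of_real (1 - 1/2)) (?F A) + op_scale ?H (of_real (1/2)) (?F B)) ?h)
      - ip ?H ?h (?F C ?h))"
    unfolding cstar_le_def cstar_pos_complex by blast
  moreover have eq: "ip ?H ?h ((op_scale ?H (of_real (1 - 1/2)) (?F A) + op_scale ?H (of_real (1/2)) (?F B)) ?h)
      = (ip ?H ?h (?F A ?h) + ip ?H ?h (?F B ?h)) / 2"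
    by (simp add: op_scale_def cvec_simps(2,3) scaleC_complex_def sum.distrib[symmetric] sum_divide_distrib
        add_divide_distrib distrib_left)
  ultimately have "2 * Re (ip ?H ?h (?F C ?h)) \<le> Re (ip ?H ?h (?F A ?h)) + Re (ip ?H ?h (?F B ?h))"
    unfolding eq by simp
  moreover have "pc \<le> (pa + pb) / 2 + 2 * e"
    if "2 * c \<le> a + b" "\<bar>pa - a\<bar> \<le> e" "\<bar>pb - b\<bar> \<le> e" "\<bar>pc - c\<bar> \<le> e" for a b c pa pb pc e :: real
    using that by (simp add: abs_le_iff field_simps)
  ultimately show ?thesis
    using op_cfc_matop_close[where v = v, OF A cont P v] op_cfc_matop_close[where v = v, OF B cont P v]
      op_cfc_matop_close[where v = v, OF C' cont P v] unfolding mult.assoc by blast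
qed

section \<open>Compressions in semi-inner product spaces\<close>

text \<open>The form induced by a state may be degenerate. Null vectors are not divided out;
  instead, identities between vectors are stated after pairing with the form.\<close>

locale semi_ip =
  fixes E :: "'e::comm_monoid_add set" and sc :: "real \<Rightarrow> 'e \<Rightarrow> 'e" and B :: "'e \<Rightarrow> 'e \<Rightarrow> real"
  assumes zero_in: "0 \<in> E"
    and add_in: "u \<in> E \<Longrightarrow> v \<in> E \<Longrightarrow> u + v \<in> E"
    and sc_in: "u \<in> E \<Longrightarrow> sc r u \<in> E"
    and B_add: "u \<in> E \<Longrightarrow> v \<in> E \<Longrightarrow> w \<in> E \<Longrightarrow> B u (v + w) = B u v + B u w"
    and B_sc: "u \<in> E \<Longrightarrow> v \<in> E \<Longrightarrow> B u (sc r v) = r * B u v"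
    and B_sym: "u \<in> E \<Longrightarrow> v \<in> E \<Longrightarrow> B u v = B v u"
    and B_pos: "u \<in> E \<Longrightarrow> 0 \<le> B u u"
begin

lemma B_zero: "u \<in> E \<Longrightarrow> B u 0 = 0"
  using B_add[of u 0 0] zero_in by simp

lemma sum_in: "(\<And>i. i \<in> I \<Longrightarrow> g i \<in> E) \<Longrightarrow> sum g I \<in> E"
  by (induction I rule: infinite_finite_induct) (simp_all add: zero_in add_in)

lemma B_sum: "u \<in> E \<Longrightarrow> (\<And>i. i \<in> I \<Longrightarrow> g i \<in> E) \<Longrightarrow> B u (sum g I) = (\<Sum>i\<in>I. B u (g i))"
  by (induction I rule: infinite_finite_induct) (simp_all add: B_zero B_add sum_in)

lemma null_vector:
  assumes "u \<in> E" "w \<in> E" "B w w = 0"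
  shows "B u w = 0"
proof (rule ccontr)
  assume ne: "B u w \<noteq> 0"
  \<comment> \<open>Since B w w = 0, the square of u + s w is affine in s; this s gives it the value
    -1.\<close>
  define s where "s = - (B u u + 1) / (2 * B u w)"
  have "0 \<le> B (u + sc s w) (u + sc s w)" using assms by (intro B_pos add_in sc_in)
  also have "\<dots> = B u u + 2 * s * B u w"
    using assms B_sym[of "u + sc s w" u] B_sym[of "u + sc s w" w] B_sym[of w u]
    by (simp add: B_add B_sc add_in sc_in)
  also have "\<dots> = - 1" using ne by (simp add: s_def field_simps)
  finally show False by simp
qed

definition orthonormal :: "nat \<Rightarrow> (nat \<Rightarrow> 'e) \<Rightarrow> bool" where
  "orthonormal N e \<longleftrightarrow> (\<forall>i<N. e i \<in> E) \<and> (\<forall>i<N. \<forall>j<N. B (e i) (e j) = (if i = j then 1 else 0))"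

text \<open>w equals its orthonormal expansion up to a null vector.\<close>

definition spanned :: "nat \<Rightarrow> (nat \<Rightarrow> 'e) \<Rightarrow> 'e \<Rightarrow> bool" where
  "spanned N e w \<longleftrightarrow> (\<forall>u\<in>E. B u w = (\<Sum>k<N. B u (e k) * B (e k) w))"

lemma spanned_outside:
  assumes "orthonormal N e" "r \<le> N" "spanned r e w" "r \<le> k" "k < N"
  shows "B (e k) w = 0"
proof -
  have "B (e k) w = (\<Sum>l<r. B (e k) (e l) * B (e l) w)"
    using assms unfolding spanned_def orthonormal_def by blast
  also have "\<dots> = 0" using assms unfolding orthonormal_def by (intro sum.neutral) auto
  finally show ?thesis .
qed

lemma spanned_mono:
  assumes on: "orthonormal N e" and "r \<le> N" "spanned r e w"
  shows "spanned N e w"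
  unfolding spanned_def
proof
  fix u assume "u \<in> E"
  then have "B u w = (\<Sum>k<r. B u (e k) * B (e k) w)" using assms unfolding spanned_def by blast
  also have "\<dots> = (\<Sum>k<N. B u (e k) * B (e k) w)"
    using assms(2) spanned_outside[OF assms] by (intro sum.mono_neutral_left) auto
  finally show "B u w = (\<Sum>k<N. B u (e k) * B (e k) w)" .
qed

lemma spanned_cong: "(\<And>k. k < N \<Longrightarrow> e k = e' k) \<Longrightarrow> spanned N e w = spanned N e' w"
  unfolding spanned_def by (auto intro!: sum.cong ball_cong)

definition subspace_in :: "'e set \<Rightarrow> bool" where
  "subspace_in K \<longleftrightarrow> K \<subseteq> E \<and> 0 \<in> K \<and> (\<forall>u\<in>K. \<forall>v\<in>K. u + v \<in> K) \<and> (\<forall>u\<in>K. \<forall>r. sc r u \<in> K)"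

text \<open>If the residual is a null vector, the present system already spans w; otherwise the
  residual is normalised and appended. Earlier vectors are kept, so a system chosen in a subspace
  can be extended outside it.\<close>

lemma Gram_Schmidt_step:
  assumes on: "orthonormal N e" and K: "subspace_in K" "\<And>i. i < N \<Longrightarrow> e i \<in> K" and w: "w \<in> K"
  shows "\<exists>N' e'. N \<le> N' \<and> (\<forall>i<N. e' i = e i) \<and> orthonormal N' e' \<and> (\<forall>i<N'. e' i \<in> K) \<and> spanned N' e' w"
proof -
  have KE: "K \<subseteq> E" and K0: "0 \<in> K" and Kadd: "\<And>u v. u \<in> K \<Longrightarrow> v \<in> K \<Longrightarrow> u + v \<in> K"
    and Ksc: "\<And>u r. u \<in> K \<Longrightarrow> sc r u \<in> K" using K(1) unfolding subspace_in_def by auto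
  have Ksum: "sum g I \<in> K" if "\<And>i. i \<in> I \<Longrightarrow> g i \<in> K" for g :: "nat \<Rightarrow> 'e" and I
    using that by (induction I rule: infinite_finite_induct) (simp_all add: K0 Kadd)
  have eE: "e i \<in> E" if "i < N" for i using K(2)[OF that] KE by blast
  have wE: "w \<in> E" using w KE by blast
  define r where "r = w + (\<Sum>k<N. sc (- B (e k) w) (e k))"
  have rK: "r \<in> K" unfolding r_def using K(2) w by (intro Kadd Ksum Ksc) auto
  then have rE: "r \<in> E" using KE by blast
  have Br: "B u r = B u w - (\<Sum>k<N. B u (e k) * B (e k) w)" if "u \<in> E" for u
  proof -
    have sE: "(\<Sum>k<N. sc (- B (e k) w) (e k)) \<in> E" by (rule sum_in) (simp add: sc_in eE)
    have "B u r = B u w + B u (\<Sum>k<N. sc (- B (e k) w) (e k))" unfolding r_def by (rule B_add[OF that wE sE])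
    also have "B u (\<Sum>k<N. sc (- B (e k) w) (e k)) = (\<Sum>k<N. B u (sc (- B (e k) w) (e k)))"
      by (rule B_sum[OF that]) (simp add: sc_in eE)
    also have "\<dots> = (\<Sum>k<N. - (B u (e k) * B (e k) w))"
      by (intro sum.cong refl) (simp add: B_sc that eE)
    finally show ?thesis by (simp add: sum_negf)
  qed
  have perp: "B (e i) r = 0" if "i < N" for i
  proof -
    have "(\<Sum>k<N. B (e i) (e k) * B (e k) w) = (\<Sum>k<N. if k = i then B (e k) w else 0)"
      using on that unfolding orthonormal_def by (intro sum.cong) auto
    then show ?thesis using Br[OF eE[OF that]] that by simp
  qed
  show ?thesis
  proof (cases "B r r = 0")
    case True
    have "spanned N e w"
      unfolding spanned_def using Br null_vector[OF _ rE True] by simp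
    then show ?thesis using on K(2) by blast
  next
    case False
    then have pos: "B r r > 0" using B_pos[OF rE] by simp
    define c where "c = 1 / sqrt (B r r)"
    have cc: "c * c * B r r = 1" using pos by (simp add: c_def)
    define e' where "e' = e(N := sc c r)"
    have rr: "B (sc c r) (sc c r) = 1"
      using B_sym[of "sc c r" r] rE cc by (simp add: B_sc sc_in mult.assoc)
    have er: "B (e i) (sc c r) = 0" "B (sc c r) (e i) = 0" if "i < N" for i
      using perp[OF that] eE[OF that] rE B_sym[of "sc c r" "e i"] by (simp_all add: B_sc sc_in)
    have on': "orthonormal (Suc N) e'"
      unfolding orthonormal_def
    proof (intro conjI allI impI)
      show "e' i \<in> E" if "i < Suc N" for i using that eE rE by (auto simp: e'_def sc_in less_Suc_eq)
      show "B (e' i) (e' j) = (if i = j then 1 else 0)" if "i < Suc N" "j < Suc N" for i j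
        using that on rr er unfolding orthonormal_def by (auto simp: e'_def less_Suc_eq)
    qed
    have rw: "B r w = B r r"
    proof -
      have "B r r = B r w - (\<Sum>k<N. B r (e k) * B (e k) w)" using Br[OF rE] .
      moreover have "B r (e k) = 0" if "k < N" for k using perp[OF that] B_sym[OF rE eE[OF that]] by simp
      ultimately show ?thesis by simp
    qed
    have "spanned (Suc N) e' w"
      unfolding spanned_def
    proof
      fix u assume u: "u \<in> E"
      have "B (sc c r) w = c * B r r"
        using B_sym[of "sc c r" w] B_sym[of w r] rE wE rw by (simp add: B_sc sc_in)
      then have "B u (sc c r) * B (sc c r) w = (c * c * B r r) * B u r"
        using u rE by (simp add: B_sc mult_ac)
      then have "B u (sc c r) * B (sc c r) w = B u r" by (simp only: cc mult_1_left)
      then show "B u w = (\<Sum>k<Suc N. B u (e' k) * B (e' k) w)"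
        using Br[OF u] by (simp add: e'_def)
    qed
    moreover have "e' i \<in> K" if "i < Suc N" for i using that K(2) rK Ksc by (auto simp: e'_def less_Suc_eq)
    moreover have "\<forall>i<N. e' i = e i" by (simp add: e'_def)
    ultimately show ?thesis using on' by (intro exI[of _ "Suc N"] exI[of _ e']) auto
  qed
qed

lemma Gram_Schmidt:
  assumes "orthonormal N e" and K: "subspace_in K" and "\<And>i. i < N \<Longrightarrow> e i \<in> K" and "set ws \<subseteq> K"
  obtains N' e' where "N \<le> N'" "\<And>i. i < N \<Longrightarrow> e' i = e i" "orthonormal N' e'"
    "\<And>i. i < N' \<Longrightarrow> e' i \<in> K" "\<And>w. w \<in> set ws \<Longrightarrow> spanned N' e' w"
proof -
  have "\<exists>N' e'. N \<le> N' \<and> (\<forall>i<N. e' i = e i) \<and> orthonormal N' e' \<and> (\<forall>i<N'. e' i \<in> K) \<and> (\<forall>w\<in>set ws. spanned N' e' w)"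
    using assms(4)
  proof (induction ws)
    case Nil
    then show ?case using assms by (intro exI[of _ N] exI[of _ e]) simp
  next
    case (Cons w ws)
    then obtain M g where g: "N \<le> M" "\<forall>i<N. g i = e i" "orthonormal M g" "\<forall>i<M. g i \<in> K" "\<forall>w\<in>set ws. spanned M g w"
      by auto
    obtain N' e' where e': "M \<le> N'" "\<forall>i<M. e' i = g i" "orthonormal N' e'" "\<forall>i<N'. e' i \<in> K" "spanned N' e' w"
      using Gram_Schmidt_step[OF g(3) K _ , of w] g(4) Cons.prems by auto
    have "spanned N' e' w'" if "w' \<in> set ws" for w'
      using spanned_mono[OF e'(3,1)] g(5) that spanned_cong[of M e' g] e'(2) by blast
    then show ?case using g e' by (intro exI[of _ N'] exI[of _ e']) auto
  qed
  then obtain N' e' where "N \<le> N'" "\<forall>i<N. e' i = e i" "orthonormal N' e'" "\<forall>i<N'. e' i \<in> K" "\<forall>w\<in>set ws. spanned N' e' w"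
    by blast
  then show ?thesis using that[of N' e'] by blast
qed

text \<open>The subspace \<open>K\<close> contains the Krylov vectors of the compression of \<open>T\<close> to \<open>K\<close>, starting at \<open>v 0\<close>. In an
  orthonormal basis adapted to \<open>K\<close>, that compression is a diagonal block of the average of \<open>T\<close>
  and \<open>UTU\<close>, where \<open>U\<close> is the reflection in \<open>K\<close>.\<close>

theorem compression_inequality:
  assumes T: "\<And>u. u \<in> E \<Longrightarrow> T u \<in> E" "\<And>u v. u \<in> E \<Longrightarrow> v \<in> E \<Longrightarrow> B (T u) v = B u (T v)"
    and bounds: "\<And>u. u \<in> E \<Longrightarrow> \<alpha> * B u u \<le> B u (T u)" "\<And>u. u \<in> E \<Longrightarrow> B u (T u) \<le> \<beta> * B u u"
    and K: "subspace_in K" "\<And>i. v i \<in> K" "\<And>u i. u \<in> K \<Longrightarrow> B u (T (v i)) = B u (v (Suc i))"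
    and convex: "operator_convex J f" "{\<alpha>..\<beta>} \<subseteq> J"
    and P: "0 \<le> \<epsilon>" "\<And>t. t \<in> {\<alpha>..\<beta>} \<Longrightarrow> \<bar>poly P t - f t\<bar> \<le> \<epsilon>"
  shows "(\<Sum>m\<le>degree P. coeff P m * B (v 0) (v m))
    \<le> (\<Sum>m\<le>degree P. coeff P m * B (v 0) ((T ^^ m) (v 0))) + 2 * \<epsilon> * B (v 0) (v 0)"
proof -
  define d where "d = degree P"
  define w where "w m = (T ^^ m) (v 0)" for m
  have KE: "K \<subseteq> E" using K(1) by (simp add: subspace_in_def)
  have vE: "v m \<in> E" for m using K(2) KE by blast
  have wE: "w m \<in> E" for m by (induction m) (simp_all add: w_def vE T(1))
  have E: "subspace_in E" by (simp add: subspace_in_def zero_in add_in sc_in)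
  have on0: "orthonormal 0 (\<lambda>_. 0)" by (simp add: orthonormal_def)
  have v_in: "set (map v [0..<Suc d]) \<subseteq> K" using K(2) by auto
  \<comment> \<open>A system inside K for the v m; it is extended below, in E, to cover the Krylov
    vectors of T. The first \<open>r\<close> vectors of the result lie in K.\<close>
  obtain r g where g: "orthonormal r g" "\<And>i. i < r \<Longrightarrow> g i \<in> K" "\<And>x. x \<in> set (map v [0..<Suc d]) \<Longrightarrow> spanned r g x"
    by (rule Gram_Schmidt[OF on0 K(1) _ v_in]) (simp, rule that)
  have gE: "g i \<in> E" if "i < r" for i using g(2)[OF that] KE by blast
  have w_in: "set (map w [0..<Suc d]) \<subseteq> E" using wE by auto
  obtain N e where e: "r \<le> N" "\<And>i. i < r \<Longrightarrow> e i = g i" "orthonormal N e"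
    and eE: "\<And>i. i < N \<Longrightarrow> e i \<in> E" and ew: "\<And>x. x \<in> set (map w [0..<Suc d]) \<Longrightarrow> spanned N e x"
    by (rule Gram_Schmidt[OF g(1) E gE w_in]) (assumption, rule that)
  have eK: "e i \<in> K" if "i < r" for i using e(2) g(2) that by simp
  have sv: "spanned r e (v m)" if "m \<le> d" for m
  proof -
    have "v m \<in> set (map v [0..<Suc d])" using that by (simp only: set_map set_upt) simp
    then show ?thesis using g(3)[of "v m"] spanned_cong[of r e g "v m"] e(2) by simp
  qed
  have svN: "spanned N e (v m)" if "m \<le> d" for m using spanned_mono[OF e(3,1) sv[OF that]] .
  have sw: "spanned N e (w m)" if "m \<le> d" for m 
  proof -
    have "w m \<in> set (map w [0..<Suc d])" using that by (simp only: set_map set_upt) simp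
    then show ?thesis by (rule ew)
  qed
  have ev0: "B (e k) (v m) = 0" if "m \<le> d" "r \<le> k" "k < N" for m k
    using spanned_outside[OF e(3,1) sv] that by blast
  define A where "A i j = (if i < N \<and> j < N then B (e i) (T (e j)) else 0)" for i j
  define s where "s i = (if i < r then 1 else - 1 :: real)" for i :: nat
  define A' where "A' i j = s i * A i j * s j" for i j
  define C where "C i j = (A i j + A' i j) / 2" for i j
  define \<xi> where "\<xi> k = (if k < N then B (e k) (v 0) else 0)" for k
  have ss: "s i * s i = 1" for i by (simp add: s_def)
  \<comment> \<open>The reflection fixes \<open>v 0\<close>, so A and A' will give the same value at
    \<xi>.\<close>
  have s\<xi>: "s k * \<xi> k = \<xi> k" for k using ev0[of 0 k] by (simp add: s_def \<xi>_def)
  have Csplit: "C i j = (if (i < r) = (j < r) then A i j else 0)" for i j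
    by (simp add: C_def A'_def s_def)
  have Asym: "A i j = A j i" for i j
    using T(2)[of "e i" "e j"] B_sym[of "T (e i)" "e j"] T(1) eE by (simp add: A_def)
  have A'sym: "A' i j = A' j i" for i j using Asym[of i j] by (simp add: A'_def)
  have quad: "\<alpha> * (\<Sum>i<N. (c i)\<^sup>2) \<le> (\<Sum>i<N. \<Sum>j<N. c i * A i j * c j)"
    "(\<Sum>i<N. \<Sum>j<N. c i * A i j * c j) \<le> \<beta> * (\<Sum>i<N. (c i)\<^sup>2)" for c
  proof -
    \<comment> \<open>The matrix form at c is the form of T at this vector, so the bounds
      restrict.\<close>
    define u where "u = (\<Sum>i<N. sc (c i) (e i))"
    have uE: "u \<in> E" unfolding u_def using eE by (intro sum_in sc_in) auto
    have Bu: "B x u = (\<Sum>i<N. c i * B x (e i))" if "x \<in> E" for x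
    proof -
      have "B x u = (\<Sum>i<N. B x (sc (c i) (e i)))"
        unfolding u_def by (rule B_sum[OF that]) (simp add: sc_in eE)
      also have "\<dots> = (\<Sum>i<N. c i * B x (e i))" by (intro sum.cong refl) (simp add: B_sc that eE)
      finally show ?thesis .
    qed
    have eu: "B (e i) u = c i" if "i < N" for i
    proof -
      have "(\<Sum>j<N. c j * B (e i) (e j)) = (\<Sum>j<N. if j = i then c j else 0)"
        using e(3) that unfolding orthonormal_def by (intro sum.cong) auto
      then show ?thesis using Bu[OF eE[OF that]] that by simp
    qed
    have "B u u = (\<Sum>i<N. (c i)\<^sup>2)"
      unfolding Bu[OF uE] using eu B_sym[OF uE eE] by (simp add: power2_eq_square)
    moreover have "B u (T u) = (\<Sum>i<N. \<Sum>j<N. c i * A i j * c j)"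
    proof -
      have "B u (T u) = B (T u) u" using B_sym uE T(1) by blast
      also have "\<dots> = (\<Sum>i<N. c i * B (T u) (e i))" using uE T(1) by (intro Bu)
      also have "\<dots> = (\<Sum>i<N. c i * (\<Sum>j<N. c j * B (e i) (T (e j))))"
      proof (intro sum.cong refl)
        fix i assume "i \<in> {..<N}"
        then have i: "i < N" by simp
        have "B (T u) (e i) = B (T (e i)) u"
          using T uE eE[OF i] B_sym[of "T (e i)" u] by simp
        also have "\<dots> = (\<Sum>j<N. c j * B (T (e i)) (e j))" using T(1) eE[OF i] by (intro Bu)
        also have "\<dots> = (\<Sum>j<N. c j * B (e i) (T (e j)))" using T(2) eE i by (intro sum.cong refl) simp
        finally show "c i * B (T u) (e i) = c i * (\<Sum>j<N. c j * B (e i) (T (e j)))" by simp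
      qed
      also have "\<dots> = (\<Sum>i<N. \<Sum>j<N. c i * A i j * c j)"
        unfolding sum_distrib_left by (intro sum.cong refl) (simp add: A_def)
      finally show ?thesis .
    qed
    ultimately show "\<alpha> * (\<Sum>i<N. (c i)\<^sup>2) \<le> (\<Sum>i<N. \<Sum>j<N. c i * A i j * c j)"
      "(\<Sum>i<N. \<Sum>j<N. c i * A i j * c j) \<le> \<beta> * (\<Sum>i<N. (c i)\<^sup>2)" using bounds[OF uE] by simp_all
  qed
  have fA: "form_bounds N \<alpha> \<beta> A" using quad unfolding form_bounds_def by blast
  have fA': "form_bounds N \<alpha> \<beta> A'"
    unfolding form_bounds_def
  proof
    fix c :: "nat \<Rightarrow> real"
    have "(\<Sum>i<N. \<Sum>j<N. c i * A' i j * c j) = (\<Sum>i<N. \<Sum>j<N. (s i * c i) * A i j * (s j * c j))"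
      by (simp add: A'_def mult_ac)
    moreover have "(\<Sum>i<N. (s i * c i)\<^sup>2) = (\<Sum>i<N. (c i)\<^sup>2)"
      by (simp add: power_mult_distrib) (simp add: power2_eq_square ss)
    ultimately show "\<alpha> * (\<Sum>i<N. (c i)\<^sup>2) \<le> (\<Sum>i<N. \<Sum>j<N. c i * A' i j * c j)
        \<and> (\<Sum>i<N. \<Sum>j<N. c i * A' i j * c j) \<le> \<beta> * (\<Sum>i<N. (c i)\<^sup>2)"
      using quad[of "\<lambda>i. s i * c i"] by simp
  qed
  \<comment> \<open>Only the coordinates of T x along e are claimed, so T x itself need not be
    spanned. This is what makes the moments up to degree d exact.\<close>
  have AT: "(\<Sum>j<N. A k j * B (e j) x) = B (e k) (T x)" if "k < N" "spanned N e x" "x \<in> E" for k x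
  proof -
    have Tek: "T (e k) \<in> E" using T(1) eE that(1) by blast
    have "B (e k) (T x) = B (T (e k)) x" using T(2) eE that by simp
    also have "\<dots> = (\<Sum>j<N. B (T (e k)) (e j) * B (e j) x)" using that(2) Tek unfolding spanned_def by blast
    also have "\<dots> = (\<Sum>j<N. A k j * B (e j) x)"
      using that(1) T(2) eE by (intro sum.cong refl) (simp add: A_def)
    finally show ?thesis by simp
  qed
  have itA: "(matvec N A ^^ m) \<xi> k = B (e k) (w m)" if "m \<le> d" "k < N" for m k
    using that
  proof (induction m arbitrary: k)
    case 0
    then show ?case by (simp add: \<xi>_def w_def)
  next
    case (Suc m)
    have "(matvec N A ^^ Suc m) \<xi> k = (\<Sum>j<N. A k j * (matvec N A ^^ m) \<xi> j)"
      using Suc.prems by (simp add: matvec_def[of N A "(matvec N A ^^ m) \<xi>"])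
    also have "\<dots> = (\<Sum>j<N. A k j * B (e j) (w m))" using Suc by (intro sum.cong refl) simp
    also have "\<dots> = B (e k) (T (w m))" using Suc.prems sw[of m] wE by (intro AT) simp_all
    finally show ?case by (simp add: w_def)
  qed
  have itA': "(matvec N A' ^^ m) \<xi> k = s k * B (e k) (w m)" if "m \<le> d" "k < N" for m k
    using that
  proof (induction m arbitrary: k)
    case 0
    then show ?case using s\<xi>[of k] by (simp add: \<xi>_def w_def)
  next
    case (Suc m)
    have "(matvec N A' ^^ Suc m) \<xi> k = (\<Sum>j<N. A' k j * (matvec N A' ^^ m) \<xi> j)"
      using Suc.prems by (simp add: matvec_def[of N A' "(matvec N A' ^^ m) \<xi>"])
    also have "\<dots> = (\<Sum>j<N. s k * (A k j * B (e j) (w m)))"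
    proof (intro sum.cong refl)
      fix j assume "j \<in> {..<N}"
      then have "A' k j * (matvec N A' ^^ m) \<xi> j = (s j * s j) * (s k * (A k j * B (e j) (w m)))"
        using Suc.IH[of j] Suc.prems \<open>j \<in> {..<N}\<close> by (simp add: A'_def[of k j] mult_ac)
      then show "A' k j * (matvec N A' ^^ m) \<xi> j = s k * (A k j * B (e j) (w m))" by (simp only: ss mult_1_left)
    qed
    also have "\<dots> = s k * B (e k) (T (w m))"
      unfolding sum_distrib_left[symmetric] using Suc.prems sw[of m] wE AT by simp
    finally show ?case by (simp add: w_def)
  qed
  have itC: "(matvec N C ^^ m) \<xi> k = B (e k) (v m)" if "m \<le> d" "k < N" for m k
    using that
  proof (induction m arbitrary: k)
    case 0
    then show ?case by (simp add: \<xi>_def)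
  next
    case (Suc m)
    have "(matvec N C ^^ Suc m) \<xi> k = (\<Sum>j<N. C k j * (matvec N C ^^ m) \<xi> j)"
      using Suc.prems by (simp add: matvec_def[of N C "(matvec N C ^^ m) \<xi>"])
    also have "\<dots> = (\<Sum>j<N. C k j * B (e j) (v m))" using Suc by (intro sum.cong refl) simp
    also have "\<dots> = B (e k) (v (Suc m))"
    \<comment> \<open>For k < r the vector \<open>e k\<close> lies in K and the relation between T
      (v m) and v (m + 1) applies; for the other k both sides vanish.\<close>
    proof (cases "k < r")
      case True
      have "(\<Sum>j<N. C k j * B (e j) (v m)) = (\<Sum>j<N. A k j * B (e j) (v m))"
        using True ev0[of m] Suc.prems by (intro sum.cong refl) (auto simp: Csplit)
      also have "\<dots> = B (e k) (T (v m))" using Suc.prems svN[of m] vE by (intro AT) simp_all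
      also have "\<dots> = B (e k) (v (Suc m))" using K(3) eK[OF True] by simp
      finally show ?thesis .
    next
      case False
      have "(\<Sum>j<N. C k j * B (e j) (v m)) = 0"
        using False ev0[of m] Suc.prems by (intro sum.neutral) (auto simp: Csplit)
      then show ?thesis using ev0[of "Suc m" k] False Suc.prems by simp
    qed
    finally show ?case .
  qed
  have B0: "(\<Sum>k<N. \<xi> k * B (e k) x) = B (v 0) x" if "spanned N e x" for x
  proof -
    have "B (v 0) x = (\<Sum>k<N. B (v 0) (e k) * B (e k) x)" using that vE unfolding spanned_def by blast
    also have "\<dots> = (\<Sum>k<N. \<xi> k * B (e k) x)"
      using B_sym[OF vE eE] by (intro sum.cong refl) (simp add: \<xi>_def)
    finally show ?thesis by simp
  qed
  have "poly_form N P A \<xi> = (\<Sum>m\<le>d. coeff P m * B (v 0) (w m))"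
    unfolding poly_form_def d_def[symmetric]
    by (intro sum.cong refl) (simp add: itA B0[OF sw])
  moreover have "poly_form N P A' \<xi> = (\<Sum>m\<le>d. coeff P m * B (v 0) (w m))"
    unfolding poly_form_def d_def[symmetric]
  proof (intro sum.cong refl)
    fix m assume "m \<in> {..d}"
    then have m: "m \<le> d" by simp
    have "(\<Sum>k<N. \<xi> k * (matvec N A' ^^ m) \<xi> k) = (\<Sum>k<N. (s k * \<xi> k) * B (e k) (w m))"
      by (intro sum.cong refl) (simp add: itA'[OF m])
    then show "coeff P m * (\<Sum>k<N. \<xi> k * (matvec N A' ^^ m) \<xi> k) = coeff P m * B (v 0) (w m)"
      by (simp only: s\<xi> B0[OF sw[OF m]])
  qed
  moreover have "poly_form N P C \<xi> = (\<Sum>m\<le>d. coeff P m * B (v 0) (v m))"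
    unfolding poly_form_def d_def[symmetric]
    by (intro sum.cong refl) (simp add: itC B0[OF svN])
  moreover have "(\<Sum>k<N. (\<xi> k)\<^sup>2) = B (v 0) (v 0)"
    using B0[OF svN[of 0]] by (simp add: power2_eq_square \<xi>_def)
  moreover have "poly_form N P C \<xi> \<le> (poly_form N P A \<xi> + poly_form N P A' \<xi>) / 2 + 2 * \<epsilon> * (\<Sum>k<N. (\<xi> k)\<^sup>2)"
  proof (rule operator_convex_poly_form[OF convex P Asym fA A'sym fA'])
    show "\<xi> i = 0" if "i \<ge> N" for i using that by (simp add: \<xi>_def)
  qed (simp_all add: C_def)
  ultimately show ?thesis by (simp add: d_def w_def)
qed

end

section \<open>The Jensen inequality for Hilbert modules\<close>

context hilbert_module
begin

text \<open>The last component of the direct sum compensates for \<open>\<Sum>\<^sub>j \<langle>y\<^sub>j, y\<^sub>j\<rangle> \<le> 1\<close>: it turns the contraction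
  \<open>a \<mapsto> (y\<^sub>j a)\<^sub>j\<close> into the isometry \<open>a \<mapsto> ((y\<^sub>j a)\<^sub>j, a)\<close>. The operator is \<open>0\<close> there.\<close>

theorem state_Jensen:
  fixes y :: "nat \<Rightarrow> 'x" and G :: "nat \<Rightarrow> 'x \<Rightarrow> 'x" and \<phi> :: "'a \<Rightarrow> real"
  assumes \<phi>: "linear \<phi>" "\<phi> 1 = 1" "\<And>a. cstar_pos a \<Longrightarrow> 0 \<le> \<phi> a" "\<And>a. \<phi> (star a) = \<phi> a"
    and y: "\<And>j. j \<le> n \<Longrightarrow> y j \<in> elems X"
    and contr: "cstar_pos (1 - (\<Sum>j\<le>n. ip X (y j) (y j)))"
    and G: "\<And>j. j \<le> n \<Longrightarrow> G j \<in> adjointables X" "\<And>j. j \<le> n \<Longrightarrow> self_adjoint X (G j)"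
      "\<And>j. j \<le> n \<Longrightarrow> op_rspec (G j) \<subseteq> {\<alpha>..\<beta>}"
    and J: "operator_convex J f" "{\<alpha>..\<beta>} \<subseteq> J" and \<alpha>\<beta>: "\<alpha> \<le> 0" "0 \<le> \<beta>" and f0: "f 0 \<le> 0"
    and P: "0 \<le> \<epsilon>" "\<And>t. t \<in> {\<alpha>..\<beta>} \<Longrightarrow> \<bar>poly P t - f t\<bar> \<le> \<epsilon>"
  shows "\<phi> (poly_of P (\<Sum>j\<le>n. ip X (y j) (G j (y j))))
    \<le> \<phi> (\<Sum>j\<le>n. ip X (y j) (op_poly X P (G j) (y j))) + 3 * \<epsilon>"
proof -
  interpret \<phi>: linear \<phi> by fact
  define s where "s = (\<Sum>j\<le>n. ip X (y j) (y j))"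
  define b where "b = (\<Sum>j\<le>n. ip X (y j) (G j (y j)))"
  have s: "star s = s" unfolding s_def star_sum using y by (intro sum.cong refl) (simp add: ip_star)
  have Gy: "G j z \<in> elems X" if "j \<le> n" "z \<in> elems X" for j z using op_closed[OF G(1)] that by blast
  have Gsa: "ip X (G j z) z' = ip X z (G j z')" if "j \<le> n" "z \<in> elems X" "z' \<in> elems X" for j z z'
    using G(2) that unfolding self_adjoint_def by blast
  have b: "star b = b" unfolding b_def star_sum using y Gy Gsa by (intro sum.cong refl) (simp add: ip_star)
  define E where "E = {(u::nat \<Rightarrow> 'x, a::'a). \<forall>j\<le>n. u j \<in> elems X}"
  define sc where "sc r = (\<lambda>(u::nat \<Rightarrow> 'x, a::'a). ((\<lambda>j. act X (u j) (r *\<^sub>R 1)), r *\<^sub>R a))" for r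
  \<comment> \<open>The last component carries the weight 1 - s, the defect of the contraction; with
    it V below is isometric for the form \<phi> (star a * c).\<close>
  define B where "B = (\<lambda>(u, a) (v, c). \<phi> ((\<Sum>j\<le>n. ip X (u j) (v j)) + star a * (1 - s) * c))"
  define T where "T = (\<lambda>(u::nat \<Rightarrow> 'x, a::'a). ((\<lambda>j. G j (u j)), 0::'a))"
  interpret E: semi_ip E sc B
  proof
    show "0 \<in> E" by (simp add: E_def zero_prod_def zero_closed)
    fix p q r :: "(nat \<Rightarrow> 'x) \<times> 'a" and t :: real
    assume p: "p \<in> E"
    show "sc t p \<in> E" using p by (auto simp: E_def sc_def act_closed)
    obtain u a where pu: "p = (u, a)" "\<And>j. j \<le> n \<Longrightarrow> u j \<in> elems X" using p by (auto simp: E_def)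
    have "cstar_pos ((\<Sum>j\<le>n. ip X (u j) (u j)) + star a * (1 - s) * a)"
      using contr pu(2) by (intro cstar_pos_add cstar_pos_sum cstar_pos_conj ip_pos) (simp_all add: s_def)
    then show "0 \<le> B p p" by (simp add: B_def pu \<phi>(3))
    assume q: "q \<in> E"
    obtain v c where qv: "q = (v, c)" "\<And>j. j \<le> n \<Longrightarrow> v j \<in> elems X" using q by (auto simp: E_def)
    show "p + q \<in> E" using pu qv by (simp add: E_def add_closed)
    have "(\<Sum>j\<le>n. ip X (u j) (act X (v j) (t *\<^sub>R 1))) = t *\<^sub>R (\<Sum>j\<le>n. ip X (u j) (v j))"
      unfolding scaleR_sum_right using pu qv by (intro sum.cong refl) (simp add: ip_act_scaleR)
    then show "B p (sc t q) = t * B p q"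
      by (simp add: B_def sc_def pu qv \<phi>.add \<phi>.scale distrib_left)
    have "star ((\<Sum>j\<le>n. ip X (u j) (v j)) + star a * (1 - s) * c) = (\<Sum>j\<le>n. ip X (v j) (u j)) + star c * (1 - s) * a"
      using pu qv by (simp add: star_add star_sum star_mult star_star star_diff s ip_star mult.assoc)
    then have "\<phi> ((\<Sum>j\<le>n. ip X (u j) (v j)) + star a * (1 - s) * c) = \<phi> ((\<Sum>j\<le>n. ip X (v j) (u j)) + star c * (1 - s) * a)"
      using \<phi>(4)[of "(\<Sum>j\<le>n. ip X (u j) (v j)) + star a * (1 - s) * c"] by (simp only:)
    then show "B p q = B q p" by (simp only: B_def pu(1) qv(1) prod.case)
    assume r: "r \<in> E"
    obtain w d where rw: "r = (w, d)" "\<And>j. j \<le> n \<Longrightarrow> w j \<in> elems X" using r by (auto simp: E_def)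
    have "(\<Sum>j\<le>n. ip X (u j) (v j + w j)) = (\<Sum>j\<le>n. ip X (u j) (v j)) + (\<Sum>j\<le>n. ip X (u j) (w j))"
      unfolding sum.distrib[symmetric] using pu qv rw by (intro sum.cong refl) (simp add: ip_add_right)
    then show "B p (q + r) = B p q + B p r"
      by (simp add: B_def pu qv rw \<phi>.add distrib_left)
  qed
  define V where "V a = ((\<lambda>j. if j \<le> n then act X (y j) a else 0), a)" for a
  have VE: "V a \<in> E" for a by (simp add: V_def E_def y act_closed)
  have BV: "B (V a) (V c) = \<phi> (star a * c)" for a c
  proof -
    have "(\<Sum>j\<le>n. ip X (act X (y j) a) (act X (y j) c)) = star a * s * c"
      unfolding s_def sum_distrib_left sum_distrib_right
      using y by (intro sum.cong refl) (simp add: ip_act_left ip_act_right act_closed mult.assoc)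
    then show ?thesis by (simp add: B_def V_def algebra_simps)
  qed
  \<comment> \<open>Compared with \<open>BV\<close>: compressed to the range of V, the operator T
    acts as left multiplication by b. Hence the Krylov vectors V (b ^ i).\<close>
  have BTV: "B (V a) (T (V c)) = \<phi> (star a * b * c)" for a c
  proof -
    have "(\<Sum>j\<le>n. ip X (act X (y j) a) (G j (act X (y j) c))) = star a * b * c"
      unfolding b_def sum_distrib_left sum_distrib_right
      using y Gy by (intro sum.cong refl) (simp add: ip_act_left ip_act_right act_closed op_act G(1) mult.assoc)
    then show ?thesis by (simp add: B_def V_def T_def)
  qed
  \<comment> \<open>T is 0 on the last component, where the bounds amount to \<alpha> \<le> 0 \<le>
    \<beta>.\<close>
  have lower: "\<alpha> * B p p \<le> B p (T p)" and upper: "B p (T p) \<le> \<beta> * B p p" if pE: "p \<in> E" for p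
  proof -
    obtain u a where pu: "p = (u, a)" "\<And>j. j \<le> n \<Longrightarrow> u j \<in> elems X" using pE by (auto simp: E_def)
    define U where "U = (\<Sum>j\<le>n. ip X (u j) (u j))"
    define W where "W = (\<Sum>j\<le>n. ip X (u j) (G j (u j)))"
    define Z where "Z = star a * (1 - s) * a"
    have "cstar_pos Z" unfolding Z_def s_def using contr by (rule cstar_pos_conj)
    then have Z: "0 \<le> \<phi> Z" by (rule \<phi>(3))
    have "cstar_pos (\<Sum>j\<le>n. ip X (u j) (G j (u j)) - \<alpha> *\<^sub>R ip X (u j) (u j))"
      by (rule cstar_pos_sum) (simp add: ip_op_bounds(1)[OF G] pu)
    also have "(\<Sum>j\<le>n. ip X (u j) (G j (u j)) - \<alpha> *\<^sub>R ip X (u j) (u j)) = W - \<alpha> *\<^sub>R U"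
      by (simp add: W_def U_def sum_subtractf scaleR_sum_right)
    finally have 1: "\<alpha> * \<phi> U \<le> \<phi> W" using \<phi>(3)[of "W - \<alpha> *\<^sub>R U"] by (simp add: \<phi>.diff \<phi>.scale)
    have "cstar_pos (\<Sum>j\<le>n. \<beta> *\<^sub>R ip X (u j) (u j) - ip X (u j) (G j (u j)))"
      by (rule cstar_pos_sum) (simp add: ip_op_bounds(2)[OF G] pu)
    also have "(\<Sum>j\<le>n. \<beta> *\<^sub>R ip X (u j) (u j) - ip X (u j) (G j (u j))) = \<beta> *\<^sub>R U - W"
      by (simp add: W_def U_def sum_subtractf scaleR_sum_right)
    finally have 2: "\<phi> W \<le> \<beta> * \<phi> U" using \<phi>(3)[of "\<beta> *\<^sub>R U - W"] by (simp add: \<phi>.diff \<phi>.scale)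
    have Bpp: "B p p = \<phi> U + \<phi> Z" by (simp add: B_def pu U_def Z_def \<phi>.add)
    have BpT: "B p (T p) = \<phi> W" by (simp add: B_def T_def pu W_def)
    show "\<alpha> * B p p \<le> B p (T p)"
      unfolding Bpp BpT distrib_left using 1 mult_nonpos_nonneg[OF \<alpha>\<beta>(1) Z] by linarith
    show "B p (T p) \<le> \<beta> * B p p"
      unfolding Bpp BpT distrib_left using 2 mult_nonneg_nonneg[OF \<alpha>\<beta>(2) Z] by linarith
  qed
  have TE: "T p \<in> E" if "p \<in> E" for p using that Gy by (auto simp: E_def T_def)
  have Tsym: "B (T p) q = B p (T q)" if pE: "p \<in> E" and qE: "q \<in> E" for p q
  proof -
    obtain u a where pu: "p = (u, a)" "\<And>j. j \<le> n \<Longrightarrow> u j \<in> elems X" using pE by (auto simp: E_def)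
    obtain v c where qv: "q = (v, c)" "\<And>j. j \<le> n \<Longrightarrow> v j \<in> elems X" using qE by (auto simp: E_def)
    show ?thesis using pu qv Gsa by (simp add: B_def T_def)
  qed
  define v where "v i = V (b ^ i)" for i
  have K: "E.subspace_in (range V)"
    unfolding E.subspace_in_def
  proof (intro conjI ballI allI)
    show "range V \<subseteq> E" using VE by blast
    have V0: "V 0 = 0" by (auto simp: V_def zero_prod_def y act_zero_right fun_eq_iff)
    then show "0 \<in> range V" by (metis rangeI)
    have Vadd: "V a + V c = V (a + c)" for a c
      by (auto simp: V_def y act_add_right fun_eq_iff)
    then show "p + q \<in> range V" if "p \<in> range V" "q \<in> range V" for p q using that by auto
    have Vsc: "sc r (V a) = V (r *\<^sub>R a)" for r a
    proof -
      have "act X (act X (y j) a) (r *\<^sub>R 1) = act X (y j) (r *\<^sub>R a)" if "j \<le> n" for j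
        using act_mult[OF y[OF that], of a "r *\<^sub>R 1"] by simp
      then show ?thesis by (auto simp: V_def sc_def act_zero_left fun_eq_iff)
    qed
    then show "sc r p \<in> range V" if "p \<in> range V" for p r using that by auto
  qed
  have Kv: "v i \<in> range V" for i by (simp add: v_def)
  have Kstep: "B p (T (v i)) = B p (v (Suc i))" if "p \<in> range V" for p i
    using that by (auto simp: v_def BTV BV mult.assoc)
  have main: "(\<Sum>m\<le>degree P. coeff P m * B (v 0) (v m))
      \<le> (\<Sum>m\<le>degree P. coeff P m * B (v 0) ((T ^^ m) (v 0))) + 2 * \<epsilon> * B (v 0) (v 0)"
    by (rule E.compression_inequality[where K = "range V" and T = T and v = v and \<alpha> = \<alpha> and \<beta> = \<beta> and f = f and P = P, OF TE Tsym lower upper K Kv Kstep J P])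
  have left: "(\<Sum>m\<le>degree P. coeff P m * B (v 0) (v m)) = \<phi> (poly_of P b)"
    by (simp add: v_def BV poly_of_def \<phi>.sum \<phi>.scale)
  have Gm: "(G j ^^ m) (y j) \<in> elems X" if "j \<le> n" for j m
    by (induction m) (simp_all add: that y Gy)
  define q where "q m = \<phi> (\<Sum>j\<le>n. ip X (y j) ((G j ^^ m) (y j)))" for m
  \<comment> \<open>The last component survives only for m = 0; it contributes the extra term P(0)
    \<phi> (1 - s).\<close>
  have Tm: "(T ^^ m) (v 0) = ((\<lambda>j. (G j ^^ m) (fst (v 0) j)), if m = 0 then 1 else 0)" for m
    by (induction m) (simp_all add: T_def v_def V_def)
  have BTm: "B (v 0) ((T ^^ m) (v 0)) = q m + (if m = 0 then \<phi> (1 - s) else 0)" for m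
    unfolding Tm by (simp add: B_def q_def v_def V_def y act_one \<phi>.add)
  have "op_poly X P (G j) (y j) = (\<Sum>i\<le>degree P. act X ((G j ^^ i) (y j)) (coeff P i *\<^sub>R 1))" if "j \<le> n" for j
    using y[OF that] by (simp add: op_poly_def op_scale_def op_one_def sum_fun_apply scaleC_of_real)
  then have "ip X (y j) (op_poly X P (G j) (y j)) = (\<Sum>i\<le>degree P. coeff P i *\<^sub>R ip X (y j) ((G j ^^ i) (y j)))"
    if "j \<le> n" for j
    using that y[OF that] Gm[OF that] by (simp add: ip_sum_right act_closed ip_act_scaleR)
  then have "(\<Sum>j\<le>n. ip X (y j) (op_poly X P (G j) (y j)))
      = (\<Sum>j\<le>n. \<Sum>i\<le>degree P. coeff P i *\<^sub>R ip X (y j) ((G j ^^ i) (y j)))" by simp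
  also have "\<dots> = (\<Sum>i\<le>degree P. coeff P i *\<^sub>R (\<Sum>j\<le>n. ip X (y j) ((G j ^^ i) (y j))))"
    unfolding scaleR_sum_right by (rule sum.swap)
  finally have right: "\<phi> (\<Sum>j\<le>n. ip X (y j) (op_poly X P (G j) (y j))) = (\<Sum>m\<le>degree P. coeff P m * q m)"
    by (simp add: q_def \<phi>.sum \<phi>.scale)
  have "(\<Sum>m\<le>degree P. coeff P m * (if m = 0 then \<phi> (1 - s) else 0)) = poly P 0 * \<phi> (1 - s)"
    by (simp add: if_distrib[of "\<lambda>z. _ * z"] poly_0_coeff_0 cong: if_cong)
  then have split: "(\<Sum>m\<le>degree P. coeff P m * B (v 0) ((T ^^ m) (v 0)))
      = (\<Sum>m\<le>degree P. coeff P m * q m) + poly P 0 * \<phi> (1 - s)"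
    unfolding BTm distrib_left sum.distrib by simp
  have "cstar_pos s" unfolding s_def using y by (intro cstar_pos_sum ip_pos) simp
  then have "0 \<le> \<phi> s" by (rule \<phi>(3))
  then have "\<phi> (1 - s) \<le> 1" by (simp add: \<phi>.diff \<phi>(2))
  moreover have "0 \<le> \<phi> (1 - s)" using \<phi>(3) contr by (simp add: s_def)
  \<comment> \<open>From P(0) \<le> f(0) + \<epsilon>: the third \<epsilon> of the claim, besides
    the two from compression.\<close>
  moreover have "poly P 0 \<le> \<epsilon>" using P(2)[of 0] \<alpha>\<beta> f0 by simp
  ultimately have "poly P 0 * \<phi> (1 - s) \<le> \<epsilon> * 1"
    using P(1) by (intro order_trans[OF mult_right_mono mult_left_mono])
  moreover have "B (v 0) (v 0) = 1" by (simp add: v_def BV \<phi>(2))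
  ultimately show ?thesis using main unfolding left split right b_def by simp
qed

section \<open>From states to the order of the algebra\<close>

text \<open>The difference c' of the two sides is the limit of the differences c m for polynomials.
  Were it not positive, some state would be negative on c', against the lower bound -3/(m + 1) on c
  m.\<close>

theorem operator_Jensen:
  fixes y :: "nat \<Rightarrow> 'x" and G :: "nat \<Rightarrow> 'x \<Rightarrow> 'x"
  assumes y: "\<And>j. j \<le> n \<Longrightarrow> y j \<in> elems X"
    and contr: "cstar_pos (1 - (\<Sum>j\<le>n. ip X (y j) (y j)))"
    and G: "\<And>j. j \<le> n \<Longrightarrow> G j \<in> adjointables X" "\<And>j. j \<le> n \<Longrightarrow> self_adjoint X (G j)"
      "\<And>j. j \<le> n \<Longrightarrow> op_spectrum X (adjointables X) (G j) \<subseteq> complex_of_real ` J"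
    and J: "is_interval J" "0 \<in> J" "operator_convex J f" and f0: "f 0 \<le> 0"
  shows "cfc f (\<Sum>j\<le>n. ip X (y j) (G j (y j)))
    \<preceq> (\<Sum>j\<le>n. ip X (y j) (op_cfc X (adjointables X) f (G j) (y j)))"
proof -
  define b where "b = (\<Sum>j\<le>n. ip X (y j) (G j (y j)))"
  define F where "F j = op_cfc X (adjointables X) f (G j)" for j
  define s where "s = (\<Sum>j\<le>n. ip X (y j) (y j))"
  have Gy: "G j (y j) \<in> elems X" if "j \<le> n" for j using op_closed[OF G(1) y] that by blast
  have sb: "star b = b"
    unfolding b_def star_sum using y Gy G(2) unfolding self_adjoint_def
    by (intro sum.cong refl) (simp add: ip_star)
  \<comment> \<open>Including 0 ensures \<alpha> \<le> 0 \<le> \<beta>; the endpoints lie in J, so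
    the whole of [\<alpha>, \<beta>] does.\<close>
  define K where "K = insert 0 (\<Union>j\<le>n. op_rspec (G j))"
  have "compact K" unfolding K_def using G compact_op_rspec by (intro compact_insert compact_UN) auto
  moreover have "K \<noteq> {}" by (simp add: K_def)
  ultimately obtain \<alpha> \<beta> where \<alpha>: "\<alpha> \<in> K" "\<And>t. t \<in> K \<Longrightarrow> \<alpha> \<le> t" and \<beta>: "\<beta> \<in> K" "\<And>t. t \<in> K \<Longrightarrow> t \<le> \<beta>"
    using compact_attains_inf compact_attains_sup by metis
  have KJ: "K \<subseteq> J"
  proof -
    have "op_rspec (G j) \<subseteq> J" if "j \<le> n" for j using G(3)[OF that] by (auto simp: op_rspec_def)
    then show ?thesis using J(2) by (auto simp: K_def)
  qed
  have IJ: "{\<alpha>..\<beta>} \<subseteq> J"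
  proof
    fix t assume "t \<in> {\<alpha>..\<beta>}"
    then show "t \<in> J" using mem_is_interval_1_I[OF J(1), of \<alpha> \<beta> t] \<alpha>(1) \<beta>(1) KJ by auto
  qed
  have \<alpha>\<beta>: "\<alpha> \<le> 0" "0 \<le> \<beta>" using \<alpha>(2)[of 0] \<beta>(2)[of 0] by (simp_all add: K_def)
  have sub: "op_rspec (G j) \<subseteq> {\<alpha>..\<beta>}" if "j \<le> n" for j
  proof -
    have "op_rspec (G j) \<subseteq> K" using that by (auto simp: K_def)
    then show ?thesis using \<alpha>(2) \<beta>(2) by (simp add: subset_iff)
  qed
  have cont: "continuous_on {\<alpha>..\<beta>} f"
    using J(3) IJ continuous_on_subset unfolding operator_convex_def by blast
  \<comment> \<open>This sum equals b - \<alpha>: the multiple of 1 - s makes up for the contraction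
    and has the right sign as \<alpha> \<le> 0.\<close>
  have "cstar_pos ((\<Sum>j\<le>n. ip X (y j) (G j (y j)) - \<alpha> *\<^sub>R ip X (y j) (y j)) + (- \<alpha>) *\<^sub>R (1 - s))"
    using \<alpha>\<beta> contr ip_op_bounds(1)[OF G(1,2) sub y] unfolding s_def
    by (intro cstar_pos_add cstar_pos_sum cstar_pos_scaleR) simp_all
  then have low: "cstar_pos (b - \<alpha> *\<^sub>R 1)"
    by (simp add: sum_subtractf b_def s_def scaleR_sum_right[symmetric] algebra_simps)
  have "cstar_pos ((\<Sum>j\<le>n. \<beta> *\<^sub>R ip X (y j) (y j) - ip X (y j) (G j (y j))) + \<beta> *\<^sub>R (1 - s))"
    using \<alpha>\<beta> contr ip_op_bounds(2)[OF G(1,2) sub y] unfolding s_def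
    by (intro cstar_pos_add cstar_pos_sum cstar_pos_scaleR) simp_all
  then have upp: "cstar_pos (\<beta> *\<^sub>R 1 - b)"
    by (simp add: sum_subtractf b_def s_def scaleR_sum_right[symmetric] algebra_simps)
  have rb: "rspec b \<subseteq> {\<alpha>..\<beta>}" using rspec_bounds[OF sb low upp] by auto
  obtain p :: "nat \<Rightarrow> real poly" where p: "\<And>m t. t \<in> {\<alpha>..\<beta>} \<Longrightarrow> \<bar>poly (p m) t - f t\<bar> \<le> inverse (real (Suc m))"
    using Weierstrass_sequence[OF compact_Icc cont] by metis
  have "norm (poly_of (p m) b - cfc f b) \<le> inverse (real (Suc m))" for m
    using rb p by (intro cfc_close[OF sb continuous_on_subset[OF cont rb]]) auto
  then have "(\<lambda>m. poly_of (p m) b - cfc f b) \<longlonglongrightarrow> 0"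
    by (rule_tac Lim_null_comparison[OF _ LIMSEQ_inverse_real_of_nat]) simp
  then have limb: "(\<lambda>m. poly_of (p m) b) \<longlonglongrightarrow> cfc f b" by (rule LIM_zero_cancel)
  have limF: "(\<lambda>m. \<Sum>j\<le>n. ip X (y j) (op_poly X (p m) (G j) (y j))) \<longlonglongrightarrow> (\<Sum>j\<le>n. ip X (y j) (F j (y j)))"
  proof (rule tendsto_sum)
    fix j assume "j \<in> {..n}"
    then have j: "j \<le> n" by simp
    note GG = G(1)[OF j] G(2)[OF j]
    have c: "continuous_on (op_rspec (G j)) f" using cont sub[OF j] by (rule continuous_on_subset)
    have F: "F j \<in> adjointables X" unfolding F_def using GG c by (rule op_cfc(1))
    have PG: "op_poly X (p m) (G j) \<in> adjointables X" for m using GG by (rule op_poly_closed)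
    have le: "norm (ip X (y j) (op_poly X (p m) (G j) (y j)) - ip X (y j) (F j (y j)))
        \<le> inverse (real (Suc m)) * (mnorm X (y j))\<^sup>2" for m
    proof -
      have "op_norm X (op_poly X (p m) (G j) - F j) \<le> inverse (real (Suc m))"
        unfolding F_def using p sub[OF j] by (intro op_cfc(2)[OF GG c]) auto
      then have "op_norm X (op_poly X (p m) (G j) - F j) * (mnorm X (y j))\<^sup>2 \<le> inverse (real (Suc m)) * (mnorm X (y j))\<^sup>2"
        by (rule mult_right_mono) simp
      moreover have "norm (ip X (y j) ((op_poly X (p m) (G j) - F j) (y j)))
          \<le> op_norm X (op_poly X (p m) (G j) - F j) * (mnorm X (y j))\<^sup>2"
        using adjointables_diff[OF PG F] y[OF j] by (rule norm_ip_op_le)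
      ultimately show ?thesis
        using y[OF j] op_closed[OF PG y[OF j]] op_closed[OF F y[OF j]] by (simp add: ip_diff_right)
    qed
    have "(\<lambda>m. ip X (y j) (op_poly X (p m) (G j) (y j)) - ip X (y j) (F j (y j))) \<longlonglongrightarrow> 0"
      by (rule Lim_null_comparison[OF _ tendsto_mult_left_zero[OF LIMSEQ_inverse_real_of_nat, of "(mnorm X (y j))\<^sup>2"]])
        (use le in simp)
    then show "(\<lambda>m. ip X (y j) (op_poly X (p m) (G j) (y j))) \<longlonglongrightarrow> ip X (y j) (F j (y j))" by (rule LIM_zero_cancel)
  qed
  define c where "c m = (\<Sum>j\<le>n. ip X (y j) (op_poly X (p m) (G j) (y j))) - poly_of (p m) b" for m
  define c' where "c' = (\<Sum>j\<le>n. ip X (y j) (F j (y j))) - cfc f b"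
  have lim: "c \<longlonglongrightarrow> c'" unfolding c_def c'_def using limF limb by (rule tendsto_diff)
  have "star (c m) = c m" for m
  proof -
    have "star (ip X (y j) (op_poly X (p m) (G j) (y j))) = ip X (y j) (op_poly X (p m) (G j) (y j))" if "j \<le> n" for j
      using y[OF that] op_closed[OF op_poly_closed[OF G(1,2)] y] that
      by (simp add: ip_star ip_op_poly_self_adjoint[OF G(1,2)])
    then show ?thesis by (simp add: c_def star_diff star_sum star_poly_of[OF sb])
  qed
  then have sc': "star c' = c'" using LIMSEQ_unique[OF tendsto_star[OF lim]] lim by simp
  have "cstar_pos c'"
  proof (rule ccontr)
    assume neg: "\<not> cstar_pos c'"
    obtain \<phi> :: "'a \<Rightarrow> real" where \<phi>: "linear \<phi>" "\<phi> 1 = 1" "\<And>a. cstar_pos a \<Longrightarrow> 0 \<le> \<phi> a"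
      "\<And>a. \<phi> (star a) = \<phi> a" and bd: "\<And>a. \<bar>\<phi> a\<bar> \<le> norm a" and less: "\<phi> c' < 0"
      by (rule separating_state[OF sc' neg]) (rule that)
    interpret \<phi>: linear \<phi> by fact
    have ge: "- (3 * inverse (real (Suc m))) \<le> \<phi> (c m)" for m
    proof -
      have "\<phi> (poly_of (p m) b) \<le> \<phi> (\<Sum>j\<le>n. ip X (y j) (op_poly X (p m) (G j) (y j))) + 3 * inverse (real (Suc m))"
        unfolding b_def
        by (rule state_Jensen[OF \<phi> y contr G(1,2) sub J(3) IJ \<alpha>\<beta> f0 _ p]) simp_all
      then show ?thesis by (simp add: c_def \<phi>.diff)
    qed
    have "bounded_linear \<phi>"
      using bd \<phi>.add \<phi>.scale by (intro bounded_linear_intro[of _ 1]) auto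
    then have "(\<lambda>m. \<phi> (c m)) \<longlonglongrightarrow> \<phi> c'" using lim by (rule bounded_linear.tendsto)
    moreover have "(\<lambda>m. - (3 * inverse (real (Suc m)))) \<longlonglongrightarrow> - (3 * 0)"
      by (intro tendsto_intros LIMSEQ_inverse_real_of_nat)
    ultimately have "- (3 * 0) \<le> \<phi> c'" using ge by (rule_tac LIMSEQ_le) auto
    then show False using less by simp
  qed
  then show ?thesis by (simp add: cstar_le_def c'_def b_def F_def)
qed

end

section \<open>Reduction to the Jensen inequality by normalising the vectors\<close>

theorem theorem4p2:
  fixes X :: "('x::ab_group_add, 'a::cstar_algebra) hmodule"
    and J :: "real set" and f :: "real \<Rightarrow> real" and n :: nat
    and S :: "'x \<Rightarrow> 'x" and R T :: "nat \<Rightarrow> 'x \<Rightarrow> 'x"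
    and x :: 'x and k :: real
  assumes "hilbert_module X"
    and "is_interval J" and "0 \<in> J"
    and "operator_convex J f" and "f 0 \<le> 0"
    and "S \<in> adjointables X" and "self_adjoint X S"
    and "\<forall>i\<in>{1..n}. R i \<in> adjointables X"
    and "\<forall>i\<in>{1..n}. T i \<in> adjointables X \<and> self_adjoint X (T i)"
    and "op_spectrum X (adjointables X) (S - (\<Sum>i=1..n. adj X (R i) \<circ> T i \<circ> R i))
           \<subseteq> complex_of_real ` J"
    and "\<forall>i\<in>{1..n}. op_spectrum X (adjointables X) (T i) \<subseteq> complex_of_real ` J"
    and "x \<in> elems X" and "mnorm X x \<le> 1"
    and "k = inverse (1 + (\<Sum>i=1..n. (mnorm X (R i x))\<^sup>2))"
  shows "inverse k *\<^sub>R cfc f (k *\<^sub>R ip X x (S x)) \<preceq>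
         ip X x ((op_cfc X (adjointables X) f (S - (\<Sum>i=1..n. adj X (R i) \<circ> T i \<circ> R i)) +
                  (\<Sum>i=1..n. adj X (R i) \<circ> op_cfc X (adjointables X) f (T i) \<circ> R i)) x)"
proof -
  interpret hilbert_module X by fact
  note S = assms(6,7) and x = assms(12)
  have R: "R i \<in> adjointables X" and T: "T i \<in> adjointables X" "self_adjoint X (T i)"
    and Tspec: "op_spectrum X (adjointables X) (T i) \<subseteq> complex_of_real ` J" if "i \<in> {1..n}" for i
    using assms that by auto
  have Rx: "R i x \<in> elems X" if "i \<in> {1..n}" for i using op_closed[OF R x] that .
  let ?op = "adjointables X"
  define D where "D = S - (\<Sum>i=1..n. adj X (R i) \<circ> T i \<circ> R i)"
  define G where "G j = (if j = 0 then D else T j)" for j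
  define w where "w j = (if j = 0 then x else R j x)" for j
  define N where "N = 1 + (\<Sum>i=1..n. (mnorm X (R i x))\<^sup>2)"
  have N: "1 \<le> N" by (simp add: N_def sum_nonneg)
  have kN: "k = inverse N" using assms(14) by (simp add: N_def)
  have k: "0 < k" "k * N = 1" using N kN by simp_all
  have atMost: "(\<Sum>j\<le>n. g j) = g 0 + (\<Sum>i=1..n. g i)" for g :: "nat \<Rightarrow> 'a"
  proof -
    have "{..n} = insert 0 {1..n}" by auto
    then show ?thesis by simp
  qed
  have ARTR: "adj X (R i) \<circ> U \<circ> R i \<in> ?op" if "i \<in> {1..n}" "U \<in> ?op" for i U
    using that R by (intro adjointables_closed(3) adj_closed) auto
  have ip_ARTR: "ip X u ((adj X (R i) \<circ> U \<circ> R i) v) = ip X (R i u) (U (R i v))"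
    if "i \<in> {1..n}" "U \<in> ?op" "u \<in> elems X" "v \<in> elems X" for i U u v
    using ip_adj[OF R, of i u "U (R i v)"] op_closed[OF that(2) op_closed[OF R that(4)]] that by simp
  have D: "D \<in> ?op"
    unfolding D_def using S(1) ARTR T(1) by (intro adjointables_diff adjointables_sum) blast+
  have ipD: "ip X u (D v) = ip X u (S v) - (\<Sum>i=1..n. ip X (R i u) (T i (R i v)))"
    if "u \<in> elems X" "v \<in> elems X" for u v
  proof -
    have "ip X u ((\<Sum>i=1..n. adj X (R i) \<circ> T i \<circ> R i) v) = (\<Sum>i=1..n. ip X (R i u) (T i (R i v)))"
      unfolding sum_fun_apply
      using that by (subst ip_sum_right) (auto simp: ip_ARTR T simp del: comp_apply intro: op_closed[OF ARTR[OF _ T(1)]])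
    moreover have "(\<Sum>i=1..n. adj X (R i) \<circ> T i \<circ> R i) \<in> ?op"
      by (rule adjointables_sum) (rule ARTR[OF _ T(1)])
    then have "(\<Sum>i=1..n. adj X (R i) \<circ> T i \<circ> R i) v \<in> elems X"
      using that by (simp only: op_closed)
    ultimately show ?thesis using that op_closed[OF S(1)] by (simp add: D_def ip_diff_right)
  qed
  have Dspec: "op_spectrum X ?op D \<subseteq> complex_of_real ` J" unfolding D_def by (rule assms(10))
  have Dsa: "self_adjoint X D"
    unfolding self_adjoint_def
  proof (intro ballI)
    fix u v assume uv: "u \<in> elems X" "v \<in> elems X"
    have "ip X (T i (R i u)) (R i v) = ip X (R i u) (T i (R i v))" if "i \<in> {1..n}" for i
      using T(2)[OF that] op_closed[OF R[OF that]] uv unfolding self_adjoint_def by blast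
    then have "star (ip X (R i v) (T i (R i u))) = ip X (R i u) (T i (R i v))" if "i \<in> {1..n}" for i
      using that op_closed[OF T(1) op_closed[OF R uv(1)]] op_closed[OF R uv(2)] by (simp add: ip_star)
    moreover have "star (ip X v (S u)) = ip X u (S v)"
      using S(2) uv op_closed[OF S(1)] unfolding self_adjoint_def by (simp add: ip_star)
    ultimately have "star (ip X v (D u)) = ip X u (D v)"
      using uv by (simp add: ipD star_diff star_sum)
    then show "ip X (D u) v = ip X u (D v)" using uv op_closed[OF D] by (simp add: ip_star)
  qed
  have G: "G j \<in> ?op" "self_adjoint X (G j)" "op_spectrum X ?op (G j) \<subseteq> complex_of_real ` J" if "j \<le> n" for j
    using that D Dsa T Tspec Dspec by (simp_all add: G_def)
  have w: "w j \<in> elems X" if "j \<le> n" for j using that x Rx by (simp add: w_def)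
  define y where "y j = act X (w j) (sqrt k *\<^sub>R 1)" for j
  have y: "y j \<in> elems X" if "j \<le> n" for j using w[OF that] by (simp add: y_def act_closed)
  have ip_y: "ip X (y j) (U (y j)) = k *\<^sub>R ip X (w j) (U (w j))" if "j \<le> n" "U \<in> ?op" for j U
    using w[OF that(1)] that(2) k(1)
    by (simp add: y_def op_act ip_act_scaleR ip_act_scaleR_left act_closed op_closed)
  have contr: "cstar_pos (1 - (\<Sum>j\<le>n. ip X (y j) (y j)))"
  proof -
    \<comment> \<open>The sum of the norms is at most 1/k because x lies in the unit ball, and a
      self-adjoint element of norm at most 1 is below 1.\<close>
    let ?s = "\<Sum>j\<le>n. ip X (w j) (w j)"
    have "norm ?s \<le> (\<Sum>j\<le>n. norm (ip X (w j) (w j)))" by (rule norm_sum)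
    also have "\<dots> = (\<Sum>j\<le>n. (mnorm X (w j))\<^sup>2)" by (simp only: mnorm_square)
    also have "\<dots> = (mnorm X x)\<^sup>2 + (\<Sum>i=1..n. (mnorm X (R i x))\<^sup>2)"
    proof -
      have "{..n} = insert 0 {1..n}" by auto
      then show ?thesis by (simp add: w_def)
    qed
    also have "(mnorm X x)\<^sup>2 \<le> 1" using assms(13) mnorm_nonneg by (simp add: power_le_one)
    finally have "norm ?s \<le> N" by (simp add: N_def)
    then have "k * norm ?s \<le> 1" using k mult_left_mono[of "norm ?s" N k] by simp
    then have "norm (k *\<^sub>R ?s) \<le> 1" using k(1) by simp
    moreover have "star (k *\<^sub>R ?s) = k *\<^sub>R ?s"
      using w by (simp add: star_scaleR star_sum ip_star)
    ultimately have "cstar_pos (1 *\<^sub>R 1 - k *\<^sub>R ?s)" by (intro cstar_pos_norm_diff)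
    moreover have "(\<Sum>j\<le>n. ip X (y j) (y j)) = k *\<^sub>R ?s"
      unfolding scaleR_sum_right
      using w k(1) by (intro sum.cong refl) (simp add: y_def ip_act_scaleR ip_act_scaleR_left act_closed)
    ultimately show ?thesis by simp
  qed
  have b: "(\<Sum>j\<le>n. ip X (y j) (G j (y j))) = k *\<^sub>R ip X x (S x)"
  proof -
    have "(\<Sum>j\<le>n. ip X (y j) (G j (y j))) = k *\<^sub>R (\<Sum>j\<le>n. ip X (w j) (G j (w j)))"
      unfolding scaleR_sum_right using ip_y G(1) by (intro sum.cong refl) simp
    \<comment> \<open>The terms with T i cancel those subtracted in D.\<close>
    also have "(\<Sum>j\<le>n. ip X (w j) (G j (w j))) = ip X x (S x)"
      unfolding atMost by (simp add: w_def G_def ipD x)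
    finally show ?thesis .
  qed
  have FG: "op_cfc X ?op f (G j) \<in> ?op" if "j \<le> n" for j
  proof (rule op_cfc(1)[OF G(1,2)[OF that]])
    have "op_rspec (G j) \<subseteq> J" using G(3)[OF that] by (auto simp: op_rspec_def)
    then show "continuous_on (op_rspec (G j)) f"
      using assms(4) continuous_on_subset unfolding operator_convex_def by blast
  qed
  have FT: "op_cfc X ?op f (T i) \<in> ?op" if "i \<in> {1..n}" for i using FG[of i] that by (simp add: G_def)
  have FD: "op_cfc X ?op f D \<in> ?op" using FG[of 0] by (simp add: G_def)
  have F: "(\<Sum>j\<le>n. ip X (y j) (op_cfc X ?op f (G j) (y j)))
      = k *\<^sub>R ip X x ((op_cfc X ?op f D + (\<Sum>i=1..n. adj X (R i) \<circ> op_cfc X ?op f (T i) \<circ> R i)) x)"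
  proof -
    have "(\<Sum>j\<le>n. ip X (y j) (op_cfc X ?op f (G j) (y j))) = k *\<^sub>R (\<Sum>j\<le>n. ip X (w j) (op_cfc X ?op f (G j) (w j)))"
      unfolding scaleR_sum_right using ip_y FG by (intro sum.cong refl) simp
    also have "(\<Sum>j\<le>n. ip X (w j) (op_cfc X ?op f (G j) (w j)))
        = ip X x (op_cfc X ?op f D x) + (\<Sum>i=1..n. ip X (R i x) (op_cfc X ?op f (T i) (R i x)))"
      unfolding atMost by (simp add: w_def G_def)
    also have "(\<Sum>i=1..n. ip X (R i x) (op_cfc X ?op f (T i) (R i x)))
        = ip X x ((\<Sum>i=1..n. adj X (R i) \<circ> op_cfc X ?op f (T i) \<circ> R i) x)"
      unfolding sum_fun_apply
      using x by (subst ip_sum_right) (auto simp: ip_ARTR FT simp del: comp_apply intro: op_closed[OF ARTR[OF _ FT]])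
    also have "ip X x (op_cfc X ?op f D x) + ip X x ((\<Sum>i=1..n. adj X (R i) \<circ> op_cfc X ?op f (T i) \<circ> R i) x)
        = ip X x ((op_cfc X ?op f D + (\<Sum>i=1..n. adj X (R i) \<circ> op_cfc X ?op f (T i) \<circ> R i)) x)"
    proof -
      have "(\<Sum>i=1..n. adj X (R i) \<circ> op_cfc X ?op f (T i) \<circ> R i) \<in> ?op"
        using ARTR FT by (intro adjointables_sum) blast
      then show ?thesis using ip_add_right[OF x op_closed[OF FD x] op_closed[OF _ x]] by simp
    qed
    finally show ?thesis .
  qed
  define Z where "Z = ip X x ((op_cfc X ?op f D + (\<Sum>i=1..n. adj X (R i) \<circ> op_cfc X ?op f (T i) \<circ> R i)) x)"
  have "cfc f (\<Sum>j\<le>n. ip X (y j) (G j (y j))) \<preceq> (\<Sum>j\<le>n. ip X (y j) (op_cfc X ?op f (G j) (y j)))"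
    by (rule operator_Jensen[where y = y and G = G, OF y contr G assms(2-5)])
  then have "cfc f (k *\<^sub>R ip X x (S x)) \<preceq> k *\<^sub>R Z"
    unfolding b F Z_def .
  then have "cstar_pos (inverse k *\<^sub>R (k *\<^sub>R Z - cfc f (k *\<^sub>R ip X x (S x))))"
    unfolding cstar_le_def using k(1) by (intro cstar_pos_scaleR) simp_all
  then show ?thesis
    unfolding cstar_le_def D_def[symmetric] Z_def[symmetric] using k(1) by (simp add: scaleR_diff_right)
qed

end
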